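(* Let $0<\delta<1$, $\rho>0$, $0<p\le 1-\frac1{2^{1+\delta}}$, and let $\{x_i^t\}_{t\ge0}$ ($i\in V$) be generated by the DRGFMD algorithm (described in the context, with $X$ compact) with stepsizes $\alpha_0=1$ and $\alpha_t=\frac{\rho}{(t+1)^\delta}$ for $t\ge1$. For $l\in V$ let $$\widetilde x_l^T=\frac{\sum_{t=1}^T x_l^t/\alpha_t}{\sum_{t=1}^T1/\alpha_t}.$$ Then for every $l\in V$, every optimal point $x^\star$ and every $T\ge1$, $$\mathbb E[f(\widetilde x_l^T)]-f(x^\star)\le\sqrt n\,\widehat L\cdot\frac1N\sum_{i=1}^N\mu_i+\frac{C_{\delta,1}}{(T+1)^{1-\delta}}+\frac{C_{\delta,2}}{(T+1)^{\delta}},$$ where $$C_{\delta,1}=\frac{(\delta+1)d_\phi^2}{p\rho},\qquad C_{\delta,2}=\Big[\frac{(n+4)^2\widehat L^2}{2\sigma_\phi}+\frac{\widetilde C(\rho+1-\delta)}{\rho(1-\delta)}\Big]\cdot\frac{\rho(\delta+1)}{p},$$ $$\widetilde C=\frac{2N(n+4)^2\Gamma\widehat L^2}{\sigma_\phi(1-\gamma)}+\frac{4(n+4)^2\widehat L^2}{\sigma_\phi}.$$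
   Context: Network. There are $N$ agents $V=\{1,\dots,N\}$. At each time $t=0,1,2,\dots$ communication is described by a directed graph $G_t=(V,E^t,P^t)$ with communication matrix $P^t\in\mathbb R^{N\times N}$. Network assumption: each $P^t$ is doubly stochastic; there is a positive integer $B$ such that $(V,\bigcup_{s=0}^{B-1}E^{t+s})$ is strongly connected for every $t$; there is $0<\zeta<1$ with $[P^t]_{ii}\ge\zeta$ for all $i,t$ and $[P^t]_{ij}\ge\zeta$ whenever $(j,i)\in E^t$. Set $\Gamma=(1-\frac{\zeta}{4N^2})^{-2}$ and $\gamma=(1-\frac{\zeta}{4N^2})^{1/B}$. Problem. $X\subset\mathbb R^n$ is a nonempty compact convex set; each $f_i:\mathbb R^n\to\mathbb R$ is convex (not necessarily smooth) and $L_i$-Lipschitz on $X$ with respect to the Euclidean norm $\|\cdot\|$; $\widehat L=\max_i L_i$; $f=\frac1N\sum_{i=1}^N f_i$; an optimal point $x^\star$ is a minimizer of $f$ over $X$. Bregman divergence. $\phi$ is a real function defined on an open set containing $X$, three times continuously differentiable and $\sigma_\phi$-strongly convex with $\sigma_\phi>0$, i.e. $\phi(\theta x+(1-\theta)y)\le\theta\phi(x)+(1-\theta)\phi(y)-\frac{\sigma_\phi\theta(1-\theta)}2\|x-y\|^2$ for $x,y\in X$, $\theta\in[0,1]$; with $H=\nabla^2\phi$, the matrices $H(y)$ and $H(y)+\nabla H(y)(y-x)$ are positive semidefinite for all $x,y\in X$ (here $\nabla H(y)(v)$ is the directional derivative of $H$ at $y$ in direction $v$). $D_\phi(x,y)=\phi(x)-\phi(y)-\langle\nabla\phi(y),x-y\rangle$.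 The constant $d_\phi$ satisfies $\sup_{x,y\in X}D_\phi(x,y)\le d_\phi^2$. DRGFMD algorithm. Smoothing parameters $\mu_i>0$ and stepsizes $\alpha_t$ are given. $\xi_i^t$ ($i\in V$, $t\ge0$) are independent standard Gaussian vectors in $\mathbb R^n$. Starting from $x_i^0=0\in X$ for all $i$, for $t\ge 0$: $$y_i^t=\sum_{j=1}^N[P^t]_{ij}x_j^t,\qquad x_i^{t+1}=\arg\min_{x\in X}\Big\{\alpha_t\Big\langle \frac{f_i(y_i^t+\mu_i\xi_i^t)-f_i(y_i^t)}{\mu_i}\xi_i^t,\,x\Big\rangle+D_\phi(x,y_i^t)\Big\}.$$
   Formalization: Each f_i is assumed L_i-Lipschitz on all of R^n, not only on X: the algorithm evaluates f_i at y+μξ outside X, and the bound fails for functions that are L_i-Lipschitz on X but grow very steeply outside it. *)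

theory Defs
  imports "HOL-Probability.Probability"
begin

text \<open>
  Agents form a finite type \<open>'v\<close>, so \<open>N = CARD('v)\<close>; the decision space is \<open>real ^ 'n\<close>, so
  \<open>n = CARD('n)\<close>, and \<open>norm\<close> is the Euclidean norm.
\<close>

definition doubly_stochastic :: "real ^ 'v ^ 'v \<Rightarrow> bool" where
  "doubly_stochastic A \<longleftrightarrow>
     (\<forall>i j. 0 \<le> A $ i $ j) \<and> (\<forall>i. (\<Sum>j\<in>UNIV. A $ i $ j) = 1) \<and> (\<forall>j. (\<Sum>i\<in>UNIV. A $ i $ j) = 1)"

definition strongly_connected :: "('v \<times> 'v) set \<Rightarrow> bool" where
  "strongly_connected E \<longleftrightarrow> (\<forall>i j. (i, j) \<in> E\<^sup>*)"

text \<open>An edge \<open>(j, i)\<close> means that \<open>i\<close> receives from \<open>j\<close>, hence the transposed matrix index.\<close>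

definition network_assumption ::
    "(nat \<Rightarrow> ('v \<times> 'v) set) \<Rightarrow> (nat \<Rightarrow> real ^ 'v ^ 'v) \<Rightarrow> nat \<Rightarrow> real \<Rightarrow> bool" where
  "network_assumption E P B \<zeta> \<longleftrightarrow>
     (\<forall>t. doubly_stochastic (P t)) \<and>
     0 < B \<and> (\<forall>t. strongly_connected (\<Union>s\<in>{0..B - 1}. E (t + s))) \<and>
     0 < \<zeta> \<and> \<zeta> < 1 \<and>
     (\<forall>t i. P t $ i $ i \<ge> \<zeta>) \<and>
     (\<forall>t i j. (j, i) \<in> E t \<longrightarrow> P t $ i $ j \<ge> \<zeta>)"

definition Gamma_const :: "nat \<Rightarrow> real \<Rightarrow> real" where
  "Gamma_const N \<zeta> = (1 - \<zeta> / (4 * (real N)\<^sup>2)) powi (-2)"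

definition gamma_const :: "nat \<Rightarrow> real \<Rightarrow> nat \<Rightarrow> real" where
  "gamma_const N \<zeta> B = (1 - \<zeta> / (4 * (real N)\<^sup>2)) powr (1 / real B)"

text \<open>The gradient, the Hessian and the directional derivative of the Hessian are built from total
  choice operators; they are meaningful only where the function is differentiable often enough.\<close>

definition grad :: "(real ^ 'n \<Rightarrow> real) \<Rightarrow> real ^ 'n \<Rightarrow> real ^ 'n" where
  "grad \<phi> x = (\<chi> i. frechet_derivative \<phi> (at x) (axis i 1))"

definition hessian :: "(real ^ 'n \<Rightarrow> real) \<Rightarrow> real ^ 'n \<Rightarrow> real ^ 'n ^ 'n" where
  "hessian \<phi> x = jacobian (grad \<phi>) (at x)"

definition hessian_deriv :: "(real ^ 'n \<Rightarrow> real) \<Rightarrow> real ^ 'n \<Rightarrow> real ^ 'n \<Rightarrow> real ^ 'n ^ 'n" where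
  "hessian_deriv \<phi> y v = frechet_derivative (hessian \<phi>) (at y) v"

lemma gderiv_grad:
  assumes "\<phi> differentiable (at x)"
  shows "GDERIV \<phi> x :> grad \<phi> x"
proof -
  let ?D = "frechet_derivative \<phi> (at x)"
  have D: "(\<phi> has_derivative ?D) (at x)"
    using assms by (simp add: frechet_derivative_works)
  then have lin: "linear ?D"
    by (rule has_derivative_linear)
  have "?D h = h \<bullet> grad \<phi> x" for h
  proof -
    have "?D h = ?D (\<Sum>i\<in>UNIV. h $ i *\<^sub>R axis i 1)"
      by (simp add: basis_expansion flip: scalar_mult_eq_scaleR)
    also have "\<dots> = h \<bullet> grad \<phi> x"
      by (simp add: linear_sum[OF lin] linear_scale[OF lin] inner_vec_def grad_def)
    finally show ?thesis .
  qed
  then have "?D = (\<lambda>h. h \<bullet> grad \<phi> x)"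
    by (rule ext)
  with D show ?thesis
    by (simp add: gderiv_def)
qed

definition C3_on :: "(real ^ 'n) set \<Rightarrow> (real ^ 'n \<Rightarrow> real) \<Rightarrow> bool" where
  "C3_on U \<phi> \<longleftrightarrow>
     (\<forall>y\<in>U. \<phi> differentiable (at y)) \<and>
     (\<forall>y\<in>U. grad \<phi> differentiable (at y)) \<and>
     (\<forall>y\<in>U. hessian \<phi> differentiable (at y)) \<and>
     (\<forall>v. continuous_on U (\<lambda>y. hessian_deriv \<phi> y v))"

definition strongly_convex_on :: "real \<Rightarrow> (real ^ 'n) set \<Rightarrow> (real ^ 'n \<Rightarrow> real) \<Rightarrow> bool" where
  "strongly_convex_on \<sigma> X \<phi> \<longleftrightarrow>
     (\<forall>x\<in>X. \<forall>y\<in>X. \<forall>\<theta>\<in>{0..1}.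
        \<phi> (\<theta> *\<^sub>R x + (1 - \<theta>) *\<^sub>R y)
          \<le> \<theta> * \<phi> x + (1 - \<theta>) * \<phi> y - \<sigma> * \<theta> * (1 - \<theta>) / 2 * (norm (x - y))\<^sup>2)"

definition psd :: "real ^ 'n ^ 'n \<Rightarrow> bool" where
  "psd A \<longleftrightarrow> transpose A = A \<and> (\<forall>v. 0 \<le> v \<bullet> (A *v v))"

definition bregman :: "(real ^ 'n \<Rightarrow> real) \<Rightarrow> real ^ 'n \<Rightarrow> real ^ 'n \<Rightarrow> real" where
  "bregman \<phi> x y = \<phi> x - \<phi> y - grad \<phi> y \<bullet> (x - y)"

definition bregman_assumption ::
    "(real ^ 'n) set \<Rightarrow> (real ^ 'n) set \<Rightarrow> (real ^ 'n \<Rightarrow> real) \<Rightarrow> real \<Rightarrow> bool" where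
  "bregman_assumption U X \<phi> \<sigma> \<longleftrightarrow>
     open U \<and> X \<subseteq> U \<and> C3_on U \<phi> \<and>
     0 < \<sigma> \<and> strongly_convex_on \<sigma> X \<phi> \<and>
     (\<forall>x\<in>X. \<forall>y\<in>X. psd (hessian \<phi> y) \<and> psd (hessian \<phi> y + hessian_deriv \<phi> y (y - x)))"

definition objective :: "('v::finite \<Rightarrow> real ^ 'n \<Rightarrow> real) \<Rightarrow> real ^ 'n \<Rightarrow> real" where
  "objective f x = (\<Sum>i\<in>UNIV. f i x) / real CARD('v)"

text \<open>
  The Lipschitz condition is imposed on the whole space, not just on \<open>X\<close>: the algorithm evaluates
  \<open>f i\<close> at \<open>y + \<mu> \<xi>\<close> with \<open>\<xi>\<close> Gaussian, which leaves \<open>X\<close>, and the bounds in terms of the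
  Lipschitz constants are false if \<open>f i\<close> may grow arbitrarily fast outside \<open>X\<close>. For example
  (\<open>N = n = 1\<close>, \<open>X = {-1..1}\<close>, \<open>\<phi> x = x^2 / 2\<close>, \<open>\<mu> = 1/2\<close>), let \<open>f x = -x\<close> for
  \<open>x \<le> 1\<close> and \<open>f x = K * (x - 1) - 1\<close> beyond.  For \<open>K\<close> large depending on the horizon, every step
  with \<open>\<xi> \<ge> 5\<close> resets the iterate to \<open>-1\<close>, and the expected error of the averaged iterate
  tends to 2, against a bound that is independent of \<open>K\<close> and tends to \<open>1/2\<close>.
\<close>

definition problem_assumption ::
    "(real ^ 'n) set \<Rightarrow> ('v::finite \<Rightarrow> real ^ 'n \<Rightarrow> real) \<Rightarrow> ('v \<Rightarrow> real) \<Rightarrow> bool" where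
  "problem_assumption X f L \<longleftrightarrow>
     X \<noteq> {} \<and> compact X \<and> convex X \<and>
     (\<forall>i. convex_on UNIV (f i)) \<and> (\<forall>i. (L i)-lipschitz_on UNIV (f i))"

definition std_gaussian :: "'w measure \<Rightarrow> ('w \<Rightarrow> real ^ 'n) \<Rightarrow> bool" where
  "std_gaussian M \<xi> \<longleftrightarrow>
     distributed M lborel \<xi> (\<lambda>z. ennreal (\<Prod>k\<in>UNIV. std_normal_density (z $ k)))"

definition gaussian_noise :: "'w measure \<Rightarrow> ('v \<Rightarrow> nat \<Rightarrow> 'w \<Rightarrow> real ^ 'n) \<Rightarrow> bool" where
  "gaussian_noise M \<xi> \<longleftrightarrow>
     prob_space M \<and>
     prob_space.indep_vars M (\<lambda>_. borel) (\<lambda>(i, t). \<xi> i t) UNIV \<and>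
     (\<forall>i t. std_gaussian M (\<xi> i t))"

definition oracle_grad ::
    "(real ^ 'n \<Rightarrow> real) \<Rightarrow> real \<Rightarrow> real ^ 'n \<Rightarrow> real ^ 'n \<Rightarrow> real ^ 'n" where
  "oracle_grad g \<mu> y z = ((g (y + \<mu> *\<^sub>R z) - g y) / \<mu>) *\<^sub>R z"

text \<open>One realisation: \<open>x\<close> is the run of the algorithm driven by the noise sequence \<open>z\<close>.\<close>

definition drgfmd_run ::
    "(real ^ 'n) set \<Rightarrow> (real ^ 'n \<Rightarrow> real) \<Rightarrow> ('v::finite \<Rightarrow> real ^ 'n \<Rightarrow> real) \<Rightarrow>
     (nat \<Rightarrow> real ^ 'v ^ 'v) \<Rightarrow> ('v \<Rightarrow> real) \<Rightarrow> (nat \<Rightarrow> real) \<Rightarrow>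
     ('v \<Rightarrow> nat \<Rightarrow> real ^ 'n) \<Rightarrow> ('v \<Rightarrow> nat \<Rightarrow> real ^ 'n) \<Rightarrow> bool" where
  "drgfmd_run X \<phi> f P \<mu> \<alpha> z x \<longleftrightarrow>
     (\<forall>i. x i 0 = 0) \<and>
     (\<forall>i t. let y = (\<Sum>j\<in>UNIV. (P t $ i $ j) *\<^sub>R x j t) in
        is_arg_min (\<lambda>u. \<alpha> t * (oracle_grad (f i) (\<mu> i) y (z i t) \<bullet> u) + bregman \<phi> u y)
          (\<lambda>u. u \<in> X) (x i (Suc t)))"

definition stepsize :: "real \<Rightarrow> real \<Rightarrow> nat \<Rightarrow> real" where
  "stepsize \<rho> \<delta> t = (if t = 0 then 1 else \<rho> / (real t + 1) powr \<delta>)"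

definition weighted_avg :: "(nat \<Rightarrow> real) \<Rightarrow> (nat \<Rightarrow> real ^ 'n) \<Rightarrow> nat \<Rightarrow> real ^ 'n" where
  "weighted_avg \<alpha> x T = (\<Sum>t=1..T. (1 / \<alpha> t) *\<^sub>R x t) /\<^sub>R (\<Sum>t=1..T. 1 / \<alpha> t)"

definition C_delta1 :: "real \<Rightarrow> real \<Rightarrow> real \<Rightarrow> real \<Rightarrow> real" where
  "C_delta1 \<delta> d p \<rho> = (\<delta> + 1) * d\<^sup>2 / (p * \<rho>)"

definition C_tilde :: "nat \<Rightarrow> nat \<Rightarrow> real \<Rightarrow> real \<Rightarrow> real \<Rightarrow> real \<Rightarrow> real" where
  "C_tilde N n L \<sigma> \<Gamma> \<gamma> =
     2 * real N * (real n + 4)\<^sup>2 * \<Gamma> * L\<^sup>2 / (\<sigma> * (1 - \<gamma>)) + 4 * (real n + 4)\<^sup>2 * L\<^sup>2 / \<sigma>"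

definition C_delta2 :: "real \<Rightarrow> real \<Rightarrow> real \<Rightarrow> nat \<Rightarrow> real \<Rightarrow> real \<Rightarrow> real \<Rightarrow> real" where
  "C_delta2 \<delta> p \<rho> n L \<sigma> Ct =
     ((real n + 4)\<^sup>2 * L\<^sup>2 / (2 * \<sigma>) + Ct * (\<rho> + 1 - \<delta>) / (\<rho> * (1 - \<delta>))) * (\<rho> * (\<delta> + 1) / p)"

end

theory Submission
  imports Defs
begin

text \<open>
  The error of the averaged iterate is controlled path by path, and expectations are taken only at
  the end.

  Optimization. An update of mirror descent satisfies a three-point inequality
  (\<open>mirror_descent_step\<close>): \<open>\<alpha>\<^sub>t \<langle>g, y - u\<rangle>\<close> is at most the drop of \<open>D(u, \<cdot>)\<close> from the mixed
  point \<open>y\<close> to the new iterate, plus \<open>\<alpha>\<^sub>t\<^sup>2 \<parallel>g\<parallel>\<^sup>2 / (2 \<sigma>)\<close>. The assumption on the Hessian of \<open>\<phi>\<close> makes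
  \<open>D(u, \<cdot>)\<close> convex (\<open>bregman_convex_second\<close>), so averaging with a doubly stochastic matrix does
  not increase the sum of the divergences over the agents. Division by \<open>\<alpha>\<^sub>t\<^sup>2\<close> produces the weights
  \<open>1 / \<alpha>\<^sub>t\<close> of the average, and since \<open>1 / \<alpha>\<^sub>t\<^sup>2\<close> grows, Abel summation bounds the total drop by
  \<open>N d\<^sup>2 / \<alpha>\<^sub>T\<^sup>2\<close> (\<open>regret_bound\<close>).

  Consensus. Replacing \<open>f\<^sub>i(y\<^sub>i)\<close> by \<open>f\<^sub>i(x\<^sub>l)\<close> costs the Lipschitz constant times the disagreement
  between the agents. The disagreement is created by steps of length at most \<open>\<alpha>\<^sub>t \<parallel>g\<parallel> / \<sigma>\<close> and is
  contracted over every block of \<open>B\<close> rounds (\<open>disagreement_contraction\<close>). For the contraction, the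
  product \<open>\<Phi>\<close> of the block is tested on indicators of sets \<open>S\<close> only: if \<open>\<Phi> 1\<^sub>S\<close> were nearly
  an indicator again, every intermediate vector would have to be near \<open>1\<^sub>S\<close>, and the first edge that
  crosses the boundary of \<open>S\<close> would contradict this (\<open>cut_conductance\<close>). Such a bound for all cuts
  yields a Poincare inequality for \<open>\<Phi>\<^sup>T \<Phi>\<close> (\<open>dirichlet_form_ge_range\<close>).

  Randomness. The point \<open>y\<^sub>i\<^sup>t\<close> is a measurable function of the noise before time \<open>t\<close>, because the update
  is a Lipschitz function of its dual input (\<open>mirror_lipschitz\<close>). Hence it is independent of \<open>\<xi>\<^sub>i\<^sup>t\<close>,
  and the mean of \<open>\<langle>g, y - u\<rangle>\<close> can be computed by integrating over a Gaussian vector with \<open>y\<close> fixed.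
  Convexity and a translation of the Gaussian density show that it is at least
  \<open>f\<^sub>i(y) - f\<^sub>i(u) - \<mu>\<^sub>i L \<surd>n\<close> (\<open>oracle_grad_inequality\<close>). As \<open>\<parallel>g\<parallel> \<le> L \<parallel>\<xi>\<parallel>\<^sup>2\<close>, the remaining
  terms involve only \<open>E \<parallel>\<xi>\<parallel>\<^sup>2 = n\<close> and \<open>E \<parallel>\<xi>\<parallel>\<^sup>4 = n (n + 2)\<close>, both at most \<open>(n + 4)\<^sup>2\<close>.
\<close>

section \<open>Cuts and dissipation of doubly stochastic products\<close>

lemma sum_power2_le_power2_sum:
  fixes g :: "'a \<Rightarrow> real"
  assumes "finite I" "\<And>i. i \<in> I \<Longrightarrow> 0 \<le> g i"
  shows "(\<Sum>i\<in>I. (g i)\<^sup>2) \<le> (\<Sum>i\<in>I. g i)\<^sup>2"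
proof -
  have "(\<Sum>i\<in>I. (g i)\<^sup>2) \<le> (\<Sum>i\<in>I. g i * (\<Sum>j\<in>I. g j))"
    unfolding power2_eq_square using assms
    by (intro sum_mono mult_left_mono member_le_sum) auto
  then show ?thesis by (simp add: power2_eq_square sum_distrib_right)
qed

lemma sum_rotate3:
  "(\<Sum>i\<in>A. \<Sum>j\<in>C. \<Sum>k\<in>D. F i j k) = (\<Sum>k\<in>D. \<Sum>i\<in>A. \<Sum>j\<in>C. F i j k)"
proof -
  have "(\<Sum>i\<in>A. \<Sum>j\<in>C. \<Sum>k\<in>D. F i j k) = (\<Sum>i\<in>A. \<Sum>k\<in>D. \<Sum>j\<in>C. F i j k)"
    by (intro sum.cong refl sum.swap)
  also have "\<dots> = (\<Sum>k\<in>D. \<Sum>i\<in>A. \<Sum>j\<in>C. F i j k)" by (rule sum.swap)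
  finally show ?thesis .
qed

text \<open>
  Sort the values of \<open>x\<close>. A square \<open>(x i - x j)\<^sup>2\<close> dominates the sum of the squares of the gaps between
  consecutive values that separate \<open>x i\<close> from \<open>x j\<close>; summing against \<open>W\<close>, each squared gap is
  multiplied by the weight of the cut at this gap, once in each direction. By the Cauchy-Schwarz
  inequality, the squared range is at most \<open>CARD('v)\<close> times the sum of the squared gaps.
\<close>

lemma dirichlet_form_ge_range:
  fixes W :: "'v::finite \<Rightarrow> 'v \<Rightarrow> real" and x :: "'v \<Rightarrow> real"
  assumes W: "\<And>i j. 0 \<le> W i j" and c: "0 \<le> c"
    and cut: "\<And>S. S \<noteq> {} \<Longrightarrow> S \<noteq> UNIV \<Longrightarrow> c \<le> (\<Sum>i\<in>S. \<Sum>j\<in>-S. W i j)"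
  shows "2 * c * (x a - x b)\<^sup>2 \<le> real CARD('v) * (\<Sum>i\<in>UNIV. \<Sum>j\<in>UNIV. W i j * (x i - x j)\<^sup>2)"
proof -
  define vs where "vs = sorted_list_of_set (range x)"
  define m where "m = length vs - 1"
  define v where "v k = vs ! k" for k
  define g where "g d = v (Suc d) - v d" for d
  define S where "S d = {i. x i \<le> v d}" for d
  have set_vs: "set vs = range x" by (simp add: vs_def)
  have len: "length vs = Suc m" using set_vs by (cases vs) (auto simp: m_def)
  have v_mono: "v k < v l" if "k < l" "l \<le> m" for k l
    unfolding v_def using that len
    by (metis (no_types) vs_def less_Suc_eq_le sorted_wrt_nth_less strict_sorted_list_of_set)
  have v_le: "v k \<le> v l \<longleftrightarrow> k \<le> l" if "k \<le> m" "l \<le> m" for k l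
    using v_mono[of k l] v_mono[of l k] that by (metis linorder_not_le nat_less_le order_less_imp_le order_refl)
  have idx: "\<exists>k\<le>m. x i = v k" for i
    using set_vs len by (metis in_set_conv_nth less_Suc_eq_le rangeI v_def)
  have m_card: "m \<le> CARD('v)"
  proof -
    have "length vs = card (range x)" by (simp add: vs_def)
    also have "\<dots> \<le> CARD('v)" by (rule card_image_le) simp
    finally show ?thesis using len by simp
  qed
  have g_nonneg: "0 \<le> g d" if "d < m" for d
    using v_mono[of d "Suc d"] that by (simp add: g_def)
  have tele: "(\<Sum>d\<in>{k..<l}. g d) = v l - v k" if "k \<le> l" for k l
    unfolding g_def using that by (rule sum_Suc_diff')
  have prp: "S d \<noteq> {}" "S d \<noteq> UNIV" if "d < m" for d
  proof -
    have "v d \<in> range x" "v (Suc d) \<in> range x"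
      using nth_mem[of d vs] nth_mem[of "Suc d" vs] len that set_vs by (simp_all add: v_def)
    then obtain i j where "x i = v d" and j: "x j = v (Suc d)" by (metis imageE)
    then have "i \<in> S d" by (simp add: S_def)
    then show "S d \<noteq> {}" by blast
    have "j \<notin> S d" using j v_mono[of d "Suc d"] that by (simp add: S_def)
    then show "S d \<noteq> UNIV" by blast
  qed
  have sep: "(\<Sum>d<m. (g d)\<^sup>2 * of_bool ((i \<in> S d) \<noteq> (j \<in> S d))) \<le> (x i - x j)\<^sup>2" for i j
  proof -
    have *: "(\<Sum>d<m. (g d)\<^sup>2 * of_bool ((i \<in> S d) \<noteq> (j \<in> S d))) \<le> (x i - x j)\<^sup>2"
      if le: "x i \<le> x j" for i j
    proof -
      obtain k l where kl: "k \<le> m" "l \<le> m" "x i = v k" "x j = v l" using idx[of i] idx[of j] by blast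
      have "k \<le> l" using kl le v_le by auto
      have "(\<Sum>d<m. (g d)\<^sup>2 * of_bool ((i \<in> S d) \<noteq> (j \<in> S d)))
          = (\<Sum>d\<in>{k..<l}. (g d)\<^sup>2)"
      proof (rule sum.mono_neutral_cong_right)
        show "(g d)\<^sup>2 * of_bool ((i \<in> S d) \<noteq> (j \<in> S d)) = (g d)\<^sup>2" if "d \<in> {k..<l}" for d
          using that kl by (simp add: S_def v_le)
        show "\<forall>d\<in>{..<m} - {k..<l}. (g d)\<^sup>2 * of_bool ((i \<in> S d) \<noteq> (j \<in> S d)) = 0"
          using kl \<open>k \<le> l\<close> by (auto simp: S_def v_le)
      qed (use kl in auto)
      also have "\<dots> \<le> (\<Sum>d\<in>{k..<l}. g d)\<^sup>2"
        using kl by (intro sum_power2_le_power2_sum g_nonneg) auto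
      also have "\<dots> = (x i - x j)\<^sup>2"
        using kl tele[OF \<open>k \<le> l\<close>] by (simp add: power2_commute)
      finally show ?thesis .
    qed
    show ?thesis
      using *[of i j] *[of j i] by (cases "x i \<le> x j") (auto simp: power2_commute eq_commute)
  qed
  have range: "(x a - x b)\<^sup>2 \<le> real CARD('v) * (\<Sum>d<m. (g d)\<^sup>2)"
  proof -
    have bound: "x i - x j \<le> (\<Sum>d<m. g d)" for i j
    proof -
      obtain k l where kl: "k \<le> m" "l \<le> m" "x i = v k" "x j = v l" using idx[of i] idx[of j] by blast
      have "v k \<le> v m" "v 0 \<le> v l" using kl v_le by auto
      then show ?thesis using tele[of 0 m] kl by (simp add: lessThan_atLeast0)
    qed
    have "\<bar>x a - x b\<bar> \<le> (\<Sum>d<m. g d)" using bound[of a b] bound[of b a] by simp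
    then have "(x a - x b)\<^sup>2 \<le> (\<Sum>d<m. g d)\<^sup>2"
      using abs_le_square_iff by fastforce
    also have "\<dots> \<le> real m * (\<Sum>d<m. (g d)\<^sup>2)"
      using sum_squared_le_sum_of_squares[of g "{..<m}"] by (simp add: mult.commute)
    also have "\<dots> \<le> real CARD('v) * (\<Sum>d<m. (g d)\<^sup>2)"
      using m_card by (intro mult_right_mono sum_nonneg) auto
    finally show ?thesis .
  qed
  have cuts: "2 * c \<le> (\<Sum>i\<in>UNIV. \<Sum>j\<in>UNIV. W i j * of_bool ((i \<in> S d) \<noteq> (j \<in> S d)))"
    if "d < m" for d
  proof -
    have split: "(\<Sum>i\<in>UNIV. h i) = (\<Sum>i\<in>S d. h i) + (\<Sum>i\<in>- S d. h i)" for h :: "'v \<Rightarrow> real"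
      using sum.union_disjoint[of "S d" "- S d" h] by simp
    have "(\<Sum>i\<in>UNIV. \<Sum>j\<in>UNIV. W i j * of_bool ((i \<in> S d) \<noteq> (j \<in> S d)))
        = (\<Sum>i\<in>S d. \<Sum>j\<in>- S d. W i j) + (\<Sum>i\<in>- S d. \<Sum>j\<in>S d. W i j)"
      by (simp add: split)
    moreover have "c \<le> (\<Sum>i\<in>S d. \<Sum>j\<in>- S d. W i j)" by (rule cut[OF prp[OF that]])
    moreover have "c \<le> (\<Sum>i\<in>- S d. \<Sum>j\<in>- (- S d). W i j)"
      using prp[OF that] by (intro cut) auto
    ultimately show ?thesis by simp
  qed
  have "2 * c * (x a - x b)\<^sup>2 \<le> 2 * c * (real CARD('v) * (\<Sum>d<m. (g d)\<^sup>2))"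
    using range c by (intro mult_left_mono) auto
  also have "\<dots> = real CARD('v) * (\<Sum>d<m. (g d)\<^sup>2 * (2 * c))"
    by (simp add: sum_distrib_left sum_distrib_right mult_ac)
  also have "\<dots> \<le> real CARD('v) * (\<Sum>d<m. (g d)\<^sup>2 *
      (\<Sum>i\<in>UNIV. \<Sum>j\<in>UNIV. W i j * of_bool ((i \<in> S d) \<noteq> (j \<in> S d))))"
    using cuts by (intro mult_left_mono sum_mono) auto
  also have "\<dots> = real CARD('v) * (\<Sum>i\<in>UNIV. \<Sum>j\<in>UNIV. W i j *
      (\<Sum>d<m. (g d)\<^sup>2 * of_bool ((i \<in> S d) \<noteq> (j \<in> S d))))"
    unfolding sum_distrib_left sum_rotate3[where D = "{..<m}"] by (simp add: mult_ac)
  also have "\<dots> \<le> real CARD('v) * (\<Sum>i\<in>UNIV. \<Sum>j\<in>UNIV. W i j * (x i - x j)\<^sup>2)"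
    using W sep by (intro mult_left_mono sum_mono) auto
  finally show ?thesis .
qed

text \<open>
  \<open>transition P t k\<close> is the product \<open>P (t + k - 1) \<cdots> P t\<close>: it maps the states at time \<open>t\<close> to those at
  time \<open>t + k\<close>.
\<close>

fun transition :: "(nat \<Rightarrow> real ^ 'v ^ 'v) \<Rightarrow> nat \<Rightarrow> nat \<Rightarrow> real ^ 'v::finite ^ 'v" where
  "transition P t 0 = mat 1"
| "transition P t (Suc k) = P (t + k) ** transition P t k"

lemma doubly_stochastic_mat1: "doubly_stochastic (mat 1 :: real ^ 'v::finite ^ 'v)"
  by (simp add: doubly_stochastic_def mat_def)

lemma doubly_stochastic_mult:
  fixes A C :: "real ^ 'v::finite ^ 'v"
  assumes "doubly_stochastic A" "doubly_stochastic C"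
  shows "doubly_stochastic (A ** C)"
proof -
  have 1: "(\<Sum>j\<in>UNIV. \<Sum>k\<in>UNIV. A $ i $ k * C $ k $ j) = 1" for i
    by (subst sum.swap) (use assms in \<open>simp add: doubly_stochastic_def flip: sum_distrib_left\<close>)
  have 2: "(\<Sum>i\<in>UNIV. \<Sum>k\<in>UNIV. A $ i $ k * C $ k $ j) = 1" for j
    by (subst sum.swap) (use assms in \<open>simp add: doubly_stochastic_def flip: sum_distrib_right\<close>)
  show ?thesis using assms 1 2
    by (auto simp: doubly_stochastic_def matrix_matrix_mult_def intro!: sum_nonneg)
qed

lemma doubly_stochastic_transition:
  assumes "\<And>t. doubly_stochastic (P t)"
  shows "doubly_stochastic (transition P t k)"
  by (induction k) (auto intro: doubly_stochastic_mat1 doubly_stochastic_mult assms)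

lemma transition_add:
  "transition P t (k + m) = transition P (t + k) m ** transition P t k"
  by (induction m) (simp_all add: matrix_mul_assoc add.assoc)

lemma weighted_variance:
  fixes a x :: "'v::finite \<Rightarrow> real"
  assumes "(\<Sum>i\<in>UNIV. a i) = 1"
  shows "(\<Sum>i\<in>UNIV. \<Sum>j\<in>UNIV. a i * a j * (x i - x j)\<^sup>2)
     = 2 * ((\<Sum>i\<in>UNIV. a i * (x i)\<^sup>2) - (\<Sum>i\<in>UNIV. a i * x i)\<^sup>2)"
proof -
  have "(\<Sum>i\<in>UNIV. \<Sum>j\<in>UNIV. a i * a j * (x i - x j)\<^sup>2)
    = (\<Sum>i\<in>UNIV. \<Sum>j\<in>UNIV. (a i * (x i)\<^sup>2) * a j + a i * (a j * (x j)\<^sup>2) - 2 * ((a i * x i) * (a j * x j)))"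
    by (intro sum.cong refl) (simp add: power2_eq_square algebra_simps)
  also have "\<dots> = (\<Sum>i\<in>UNIV. \<Sum>j\<in>UNIV. (a i * (x i)\<^sup>2) * a j)
      + (\<Sum>i\<in>UNIV. \<Sum>j\<in>UNIV. a i * (a j * (x j)\<^sup>2))
      - 2 * (\<Sum>i\<in>UNIV. \<Sum>j\<in>UNIV. (a i * x i) * (a j * x j))"
    by (simp only: sum.distrib sum_subtractf sum_distrib_left)
  also have "\<dots> = (\<Sum>i\<in>UNIV. a i * (x i)\<^sup>2) * (\<Sum>j\<in>UNIV. a j)
      + (\<Sum>i\<in>UNIV. a i) * (\<Sum>j\<in>UNIV. a j * (x j)\<^sup>2) - 2 * ((\<Sum>i\<in>UNIV. a i * x i) * (\<Sum>j\<in>UNIV. a j * x j))"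
    by (simp only: sum_product)
  finally show ?thesis using assms by (simp add: power2_eq_square)
qed

lemma square_sum_le_weighted:
  fixes a x :: "'v::finite \<Rightarrow> real"
  assumes "(\<Sum>i\<in>UNIV. a i) = 1" "\<And>i. 0 \<le> a i"
  shows "(\<Sum>i\<in>UNIV. a i * x i)\<^sup>2 \<le> (\<Sum>i\<in>UNIV. a i * (x i)\<^sup>2)"
proof -
  have "0 \<le> (\<Sum>i\<in>UNIV. \<Sum>j\<in>UNIV. a i * a j * (x i - x j)\<^sup>2)"
    using assms by (intro sum_nonneg) auto
  then show ?thesis using weighted_variance[OF assms(1), of x] by simp
qed

text \<open>
  The loss of \<open>\<Sum> x\<^sub>i\<^sup>2\<close> under averaging is the sum over the rows of the variances of \<open>x\<close> with respect to the
  rows, that is, a Dirichlet form with the weights \<open>A\<^sup>T A\<close>.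
\<close>

lemma doubly_stochastic_dissipation:
  fixes A :: "real ^ 'v::finite ^ 'v" and x :: "'v \<Rightarrow> real"
  assumes "doubly_stochastic A"
  shows "(\<Sum>i\<in>UNIV. \<Sum>j\<in>UNIV. (\<Sum>k\<in>UNIV. A $ k $ i * A $ k $ j) * (x i - x j)\<^sup>2)
     = 2 * ((\<Sum>i\<in>UNIV. (x i)\<^sup>2) - (\<Sum>k\<in>UNIV. (\<Sum>i\<in>UNIV. A $ k $ i * x i)\<^sup>2))"
proof -
  have "(\<Sum>i\<in>UNIV. \<Sum>j\<in>UNIV. (\<Sum>k\<in>UNIV. A $ k $ i * A $ k $ j) * (x i - x j)\<^sup>2)
     = (\<Sum>k\<in>UNIV. \<Sum>i\<in>UNIV. \<Sum>j\<in>UNIV. A $ k $ i * A $ k $ j * (x i - x j)\<^sup>2)"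
    unfolding sum_distrib_right by (rule sum_rotate3)
  also have "\<dots> = (\<Sum>k\<in>UNIV. 2 * ((\<Sum>i\<in>UNIV. A $ k $ i * (x i)\<^sup>2) - (\<Sum>i\<in>UNIV. A $ k $ i * x i)\<^sup>2))"
    using assms by (intro sum.cong refl weighted_variance) (auto simp: doubly_stochastic_def)
  also have "\<dots> = 2 * ((\<Sum>k\<in>UNIV. \<Sum>i\<in>UNIV. A $ k $ i * (x i)\<^sup>2) - (\<Sum>k\<in>UNIV. (\<Sum>i\<in>UNIV. A $ k $ i * x i)\<^sup>2))"
    by (simp add: sum_subtractf flip: sum_distrib_left)
  also have "(\<Sum>k\<in>UNIV. \<Sum>i\<in>UNIV. A $ k $ i * (x i)\<^sup>2) = (\<Sum>i\<in>UNIV. (x i)\<^sup>2)"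
    by (subst sum.swap) (use assms in \<open>simp add: doubly_stochastic_def flip: sum_distrib_right\<close>)
  finally show ?thesis .
qed

lemma rtrancl_crosses:
  assumes "(a, b) \<in> R\<^sup>*" "a \<notin> S" "b \<in> S"
  shows "\<exists>i j. (j, i) \<in> R \<and> j \<notin> S \<and> i \<in> S"
  using assms by (induction rule: rtrancl_induct) blast+

text \<open>
  The cut weight of \<open>\<Phi>\<^sup>T \<Phi>\<close> at \<open>S\<close> is \<open>\<Sum> z\<^sub>i (1 - z\<^sub>i)\<close> for \<open>z = \<Phi> 1\<^sub>S\<close>, and this quantity does not decrease
  during the block. If it stayed below \<open>\<zeta> / 4\<close>, each \<open>z\<^sub>i\<close> would stay on its side of \<open>1 / 2\<close>, since an
  agent keeps at least the fraction \<open>\<zeta>\<close> of its own value. But when an edge into \<open>S\<close> is active, its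
  head receives at least \<open>\<zeta>\<close> times a value from either side of \<open>1 / 2\<close>, so both \<open>z\<^sub>i\<close> and \<open>1 - z\<^sub>i\<close>
  are at least \<open>\<zeta> / 2\<close>. Following \<open>1\<^sub>S\<close> through the whole block also accounts for small weights off
  the edges, which may carry mass across the cut before the first active edge does.
\<close>

lemma cut_conductance:
  fixes P :: "nat \<Rightarrow> real ^ 'v::finite ^ 'v"
  assumes net: "network_assumption E P B \<zeta>" and S: "S \<noteq> {}" "S \<noteq> UNIV"
  shows "\<zeta> / 4 \<le> (\<Sum>i\<in>S. \<Sum>j\<in>-S. \<Sum>k\<in>UNIV. transition P t B $ k $ i * transition P t B $ k $ j)"
proof -
  have ds: "\<And>t. doubly_stochastic (P t)" and \<zeta>: "0 < \<zeta>" "\<zeta> < 1" and B: "0 < B"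
    and diag: "\<And>t i. \<zeta> \<le> P t $ i $ i"
    and edge: "\<And>t i j. (j, i) \<in> E t \<Longrightarrow> \<zeta> \<le> P t $ i $ j"
    and conn: "strongly_connected (\<Union>s\<in>{0..B - 1}. E (t + s))"
    using net by (auto simp: network_assumption_def)
  have P0: "0 \<le> P t $ i $ j" and P1: "(\<Sum>j\<in>UNIV. P t $ i $ j) = 1"
    and P2: "(\<Sum>i\<in>UNIV. P t $ i $ j) = 1" for t i j
    using ds by (auto simp: doubly_stochastic_def)
  define z where "z k i = (\<Sum>j\<in>S. transition P t k $ i $ j)" for k i
  define Q where "Q k = (\<Sum>i\<in>UNIV. z k i * (1 - z k i))" for k
  have T: "doubly_stochastic (transition P t k)" for k
    by (rule doubly_stochastic_transition[OF ds])
  have z_compl: "1 - z k i = (\<Sum>j\<in>-S. transition P t k $ i $ j)" for k i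
  proof -
    have "(\<Sum>j\<in>S. transition P t k $ i $ j) + (\<Sum>j\<in>-S. transition P t k $ i $ j) = 1"
      using T[of k] sum.union_disjoint[of S "-S" "\<lambda>j. transition P t k $ i $ j"]
      by (simp add: doubly_stochastic_def)
    then show ?thesis by (simp add: z_def)
  qed
  have z0: "0 \<le> z k i" and z1: "z k i \<le> 1" for k i
  proof -
    show "0 \<le> z k i" using T[of k] by (auto simp: z_def doubly_stochastic_def intro!: sum_nonneg)
    have "0 \<le> 1 - z k i" unfolding z_compl
      using T[of k] by (auto simp: doubly_stochastic_def intro!: sum_nonneg)
    then show "z k i \<le> 1" by simp
  qed
  have z_Suc: "z (Suc k) i = (\<Sum>j\<in>UNIV. P (t + k) $ i $ j * z k j)" for k i
    unfolding z_def transition.simps matrix_matrix_mult_def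
    by (simp add: sum_distrib_left) (rule sum.swap)
  have zc_Suc: "1 - z (Suc k) i = (\<Sum>j\<in>UNIV. P (t + k) $ i $ j * (1 - z k j))" for k i
    using P1[where t="t+k" and i=i] by (simp add: z_Suc right_diff_distrib sum_subtractf)
  have z_ge: "P (t + k) $ i $ j * z k j \<le> z (Suc k) i" for k i j
    unfolding z_Suc using P0 z0 by (intro member_le_sum) auto
  have zc_ge: "P (t + k) $ i $ j * (1 - z k j) \<le> 1 - z (Suc k) i" for k i j
    unfolding zc_Suc using P0 z1 by (intro member_le_sum) auto
  have Q_step: "Q k \<le> Q (Suc k)" for k
  proof -
    have "(\<Sum>i\<in>UNIV. (z (Suc k) i)\<^sup>2) \<le> (\<Sum>i\<in>UNIV. \<Sum>j\<in>UNIV. P (t + k) $ i $ j * (z k j)\<^sup>2)"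
      unfolding z_Suc by (intro sum_mono square_sum_le_weighted P1 P0)
    also have "\<dots> = (\<Sum>j\<in>UNIV. (z k j)\<^sup>2)"
      by (subst sum.swap) (simp add: P2 flip: sum_distrib_right)
    finally have "(\<Sum>i\<in>UNIV. (z (Suc k) i)\<^sup>2) \<le> (\<Sum>j\<in>UNIV. (z k j)\<^sup>2)" .
    moreover have "(\<Sum>i\<in>UNIV. z (Suc k) i) = (\<Sum>j\<in>UNIV. z k j)"
      unfolding z_Suc by (subst sum.swap) (simp add: P2 flip: sum_distrib_right)
    ultimately show ?thesis
      by (simp add: Q_def right_diff_distrib sum_subtractf power2_eq_square)
  qed
  have Q_mono: "Q k \<le> Q m" if "k \<le> m" for k m
    using lift_Suc_mono_le[of Q, OF Q_step that] .
  have term_le: "z k i * (1 - z k i) \<le> Q m" if "k \<le> m" for k m i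
  proof -
    have "z k i * (1 - z k i) \<le> Q k"
      unfolding Q_def using z0 z1 by (intro member_le_sum) auto
    then show ?thesis using Q_mono[OF that] by simp
  qed
  have "\<zeta> / 4 \<le> Q B"
  proof (rule ccontr)
    assume "\<not> \<zeta> / 4 \<le> Q B"
    then have small: "z k i * (1 - z k i) < \<zeta> / 4" if "k \<le> B" for k i
      using term_le[OF that, of i] by simp
    \<comment> \<open>On the interval from \<open>\<zeta> / 2\<close> to \<open>1 - \<zeta> / 2\<close>, the product \<open>z (1 - z)\<close> is at least \<open>\<zeta> / 4\<close>.\<close>
    have not_both: False if "k \<le> B" "\<zeta> / 2 \<le> z k i" "\<zeta> / 2 \<le> 1 - z k i" for k i
    proof (cases "z k i \<le> 1 / 2")
      case True
      have "\<zeta> / 2 * (1 / 2) \<le> z k i * (1 - z k i)" using that True \<zeta> by (intro mult_mono) auto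
      then show False using small[OF \<open>k \<le> B\<close>, of i] by simp
    next
      case False
      have "1 / 2 * (\<zeta> / 2) \<le> z k i * (1 - z k i)" using that False \<zeta> by (intro mult_mono) auto
      then show False using small[OF \<open>k \<le> B\<close>, of i] by simp
    qed
    have stay: "if i \<in> S then 1 / 2 < z k i else z k i < 1 / 2" if "k \<le> B" for k i
      using that
    proof (induction k)
      case 0
      have "z 0 i = of_bool (i \<in> S)"
        by (simp add: z_def mat_def)
      then show ?case by simp
    next
      case (Suc k)
      show ?case
      proof (cases "i \<in> S")
        case True
        then have "1 / 2 < z k i" using Suc by simp
        then have "\<zeta> / 2 \<le> P (t + k) $ i $ i * z k i"
          using mult_mono[OF diag[of "t+k" i], of "1/2" "z k i"] \<zeta> P0 by auto
        then have "\<zeta> / 2 \<le> z (Suc k) i" using z_ge[of k i i] by simp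
        with not_both[OF Suc.prems this] True \<zeta> show ?thesis by force
      next
        case False
        then have "z k i < 1 / 2" using Suc by simp
        then have "\<zeta> / 2 \<le> P (t + k) $ i $ i * (1 - z k i)"
          using mult_mono[OF diag[of "t+k" i], of "1/2" "1 - z k i"] \<zeta> P0 by auto
        then have "\<zeta> / 2 \<le> 1 - z (Suc k) i" using zc_ge[of k i i] by simp
        with not_both[OF Suc.prems _ this] False \<zeta> show ?thesis by force
      qed
    qed
    obtain a b where "a \<notin> S" "b \<in> S" using S by auto
    then obtain i j where ij: "(j, i) \<in> (\<Union>s\<in>{0..B - 1}. E (t + s))" "j \<notin> S" "i \<in> S"
      using rtrancl_crosses[of a b _ S] conn unfolding strongly_connected_def by metis
    then obtain k where "k \<le> B - 1" and k: "(j, i) \<in> E (t + k)" by auto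
    with B have kB: "k < B" by linarith
    have "1 / 2 < z k i" "z k j < 1 / 2" using stay[of k i] stay[of k j] ij kB by auto
    then have "\<zeta> / 2 \<le> P (t + k) $ i $ i * z k i" "\<zeta> / 2 \<le> P (t + k) $ i $ j * (1 - z k j)"
      using mult_mono[OF diag[of "t+k" i], of "1/2" "z k i"]
        mult_mono[OF edge[OF k], of "1/2" "1 - z k j"] \<zeta> P0 by auto
    then have "\<zeta> / 2 \<le> z (Suc k) i" "\<zeta> / 2 \<le> 1 - z (Suc k) i"
      using z_ge[of k i i] zc_ge[of k i j] by simp_all
    then show False using not_both[of "Suc k" i] kB by simp
  qed
  also have "Q B = (\<Sum>k\<in>UNIV. \<Sum>i\<in>S. \<Sum>j\<in>-S. transition P t B $ k $ i * transition P t B $ k $ j)"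
    unfolding Q_def z_compl by (simp add: z_def sum_product)
  also have "\<dots> = (\<Sum>i\<in>S. \<Sum>j\<in>-S. \<Sum>k\<in>UNIV. transition P t B $ k $ i * transition P t B $ k $ j)"
    by (rule sum_rotate3[symmetric])
  finally show ?thesis .
qed

section \<open>Contraction of the disagreement between agents\<close>

definition mixing :: "real ^ 'v ^ 'v \<Rightarrow> ('v::finite \<Rightarrow> real ^ 'n) \<Rightarrow> 'v \<Rightarrow> real ^ 'n" where
  "mixing A x i = (\<Sum>j\<in>UNIV. (A $ i $ j) *\<^sub>R x j)"

definition centroid :: "('v::finite \<Rightarrow> real ^ 'n) \<Rightarrow> real ^ 'n" where
  "centroid x = (\<Sum>i\<in>UNIV. x i) /\<^sub>R real CARD('v)"

definition disagreement :: "('v::finite \<Rightarrow> real ^ 'n) \<Rightarrow> real" where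
  "disagreement x = L2_set (\<lambda>i. norm (x i - centroid x)) UNIV"

lemma mixing_mat1 [simp]: "mixing (mat 1) x = x"
proof
  fix i
  have "mixing (mat 1) x i = (\<Sum>j\<in>UNIV. if i = j then x j else 0)"
    unfolding mixing_def mat_def by (intro sum.cong) auto
  then show "mixing (mat 1) x i = x i" by simp
qed

lemma mixing_mult: "mixing (A ** C) x = mixing A (mixing C x)"
proof
  fix i
  show "mixing (A ** C) x i = mixing A (mixing C x) i"
    unfolding mixing_def matrix_matrix_mult_def
    by (simp add: scaleR_sum_left scaleR_sum_right) (rule sum.swap)
qed

lemma mixing_sum: "mixing A (\<lambda>i. \<Sum>s\<in>I. x s i) = (\<lambda>i. \<Sum>s\<in>I. mixing A (x s) i)"
  by (rule ext) (simp add: mixing_def scaleR_sum_right, rule sum.swap)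

lemma centroid_mixing:
  assumes "doubly_stochastic A"
  shows "centroid (mixing A x) = centroid x"
proof -
  have "(\<Sum>i\<in>UNIV. mixing A x i) = (\<Sum>j\<in>UNIV. \<Sum>i\<in>UNIV. (A $ i $ j) *\<^sub>R x j)"
    unfolding mixing_def by (rule sum.swap)
  also have "\<dots> = (\<Sum>j\<in>UNIV. x j)"
    using assms by (simp add: doubly_stochastic_def flip: scaleR_sum_left)
  finally show ?thesis by (simp add: centroid_def)
qed

lemma disagreement_add_le: "disagreement (\<lambda>i. x i + y i) \<le> disagreement x + disagreement y"
proof -
  have "centroid (\<lambda>i. x i + y i) = centroid x + centroid y"
    by (simp add: centroid_def sum.distrib scaleR_add_right)
  then have "disagreement (\<lambda>i. x i + y i)
      = L2_set (\<lambda>i. norm ((x i - centroid x) + (y i - centroid y))) UNIV"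
    by (simp add: disagreement_def algebra_simps)
  also have "\<dots> \<le> L2_set (\<lambda>i. norm (x i - centroid x) + norm (y i - centroid y)) UNIV"
    by (intro L2_set_mono norm_triangle_ineq norm_ge_zero)
  also have "\<dots> \<le> disagreement x + disagreement y"
    unfolding disagreement_def by (rule L2_set_triangle_ineq)
  finally show ?thesis .
qed

lemma disagreement_zero [simp]: "disagreement (\<lambda>i. 0) = 0"
  by (simp add: disagreement_def centroid_def L2_set_def)

lemma disagreement_sum_le:
  assumes "finite I"
  shows "disagreement (\<lambda>i. \<Sum>s\<in>I. x s i) \<le> (\<Sum>s\<in>I. disagreement (x s))"
  using assms
proof (induction I rule: finite_induct)
  case (insert s I)
  then show ?case using disagreement_add_le[of "x s" "\<lambda>i. \<Sum>s\<in>I. x s i"] by simp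
qed simp

lemma disagreement_nonneg [simp]: "0 \<le> disagreement x"
  by (simp add: disagreement_def)

lemma norm_diff_centroid_le: "norm (x i - centroid x) \<le> disagreement x"
  unfolding disagreement_def by (rule member_le_L2_set) auto

lemma centroid_nth: "centroid x $ k = (\<Sum>i\<in>UNIV. x i $ k) / real CARD('v)"
  for x :: "'v::finite \<Rightarrow> real ^ 'n"
  by (simp add: centroid_def divide_inverse mult.commute)

text \<open>
  The squared disagreement splits into coordinates, so that estimates for scalar states carry over to
  vectors.
\<close>

lemma disagreement_power2:
  "(disagreement x)\<^sup>2 = (\<Sum>k\<in>UNIV. \<Sum>i\<in>UNIV. (x i $ k - centroid x $ k)\<^sup>2)"
proof -
  have "(disagreement x)\<^sup>2 = (\<Sum>i\<in>UNIV. (norm (x i - centroid x))\<^sup>2)"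
    by (simp add: disagreement_def L2_set_def sum_nonneg)
  also have "\<dots> = (\<Sum>i\<in>UNIV. \<Sum>k\<in>UNIV. (x i $ k - centroid x $ k)\<^sup>2)"
    by (simp add: norm_vec_def L2_set_def sum_nonneg)
  finally show ?thesis by (subst sum.swap)
qed

text \<open>
  With \<open>c\<close> the mean itself this is the formula for the variance; comparing it with any other \<open>c\<close> shows
  that the mean minimizes the sum of the squared deviations.
\<close>

lemma sum_power2_about_mean:
  fixes u :: "'v::finite \<Rightarrow> real"
  assumes "m = (\<Sum>i\<in>UNIV. u i) / real CARD('v)"
  shows "(\<Sum>i\<in>UNIV. (u i - c)\<^sup>2) = (\<Sum>i\<in>UNIV. (u i)\<^sup>2) - real CARD('v) * m\<^sup>2 + real CARD('v) * (m - c)\<^sup>2"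
proof -
  have m: "(\<Sum>i\<in>UNIV. u i) = real CARD('v) * m" using assms by simp
  have "(\<Sum>i\<in>UNIV. (u i - c)\<^sup>2) = (\<Sum>i\<in>UNIV. (u i)\<^sup>2 + c\<^sup>2 - 2 * c * u i)"
    by (intro sum.cong refl) (simp add: power2_eq_square algebra_simps)
  also have "\<dots> = (\<Sum>i\<in>UNIV. (u i)\<^sup>2) + real CARD('v) * c\<^sup>2 - 2 * c * (\<Sum>i\<in>UNIV. u i)"
    by (simp add: sum.distrib sum_subtractf sum_distrib_left)
  finally show ?thesis by (simp add: m power2_eq_square algebra_simps)
qed

lemma disagreement_le_L2: "disagreement x \<le> L2_set (\<lambda>i. norm (x i)) UNIV"
proof -
  have "(disagreement x)\<^sup>2 \<le> (\<Sum>k\<in>UNIV. \<Sum>i\<in>UNIV. (x i $ k)\<^sup>2)"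
    unfolding disagreement_power2
    by (rule sum_mono) (simp add: sum_power2_about_mean[OF centroid_nth])
  also have "\<dots> = (\<Sum>i\<in>UNIV. (norm (x i))\<^sup>2)"
    by (subst sum.swap) (simp add: norm_vec_def L2_set_def sum_nonneg)
  finally have "sqrt ((disagreement x)\<^sup>2) \<le> sqrt (\<Sum>i\<in>UNIV. (norm (x i))\<^sup>2)"
    by (rule real_sqrt_le_mono)
  then show ?thesis by (simp add: L2_set_def)
qed

lemma disagreement_le_sum_norm: "disagreement x \<le> (\<Sum>i\<in>UNIV. norm (x i))"
  using disagreement_le_L2[of x] L2_set_le_sum[of UNIV "\<lambda>i. norm (x i)"] by simp

lemma mixing_component: "mixing A x i $ k = (\<Sum>j\<in>UNIV. A $ i $ j * (x j $ k))"
  by (simp add: mixing_def)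

lemma disagreement_mixing_diff:
  fixes x :: "'v::finite \<Rightarrow> real ^ 'n"
  assumes "doubly_stochastic A"
  shows "(disagreement x)\<^sup>2 - (disagreement (mixing A x))\<^sup>2
    = (\<Sum>k\<in>UNIV. (\<Sum>i\<in>UNIV. (x i $ k)\<^sup>2) - (\<Sum>i\<in>UNIV. (mixing A x i $ k)\<^sup>2))"
proof -
  have *: "(\<Sum>i\<in>UNIV. (y i $ k - centroid y $ k)\<^sup>2) = (\<Sum>i\<in>UNIV. (y i $ k)\<^sup>2) - real CARD('v) * (centroid y $ k)\<^sup>2"
    for y :: "'v \<Rightarrow> real ^ 'n" and k
    by (subst sum_power2_about_mean[OF centroid_nth]) simp
  show ?thesis
    unfolding disagreement_power2 * by (simp add: centroid_mixing[OF assms] sum_subtractf)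
qed

lemma disagreement_mixing_le:
  assumes "doubly_stochastic A"
  shows "disagreement (mixing A x) \<le> disagreement x"
proof -
  have "(\<Sum>i\<in>UNIV. (mixing A x i $ k)\<^sup>2) \<le> (\<Sum>i\<in>UNIV. (x i $ k)\<^sup>2)" for k
  proof -
    have "0 \<le> (\<Sum>i\<in>UNIV. \<Sum>j\<in>UNIV. (\<Sum>k\<in>UNIV. A $ k $ i * A $ k $ j) * (x i $ k - x j $ k)\<^sup>2)"
      using assms by (intro sum_nonneg mult_nonneg_nonneg) (auto simp: doubly_stochastic_def)
    then show ?thesis
      unfolding doubly_stochastic_dissipation[OF assms] mixing_component by simp
  qed
  then have "0 \<le> (disagreement x)\<^sup>2 - (disagreement (mixing A x))\<^sup>2"
    unfolding disagreement_mixing_diff[OF assms] by (intro sum_nonneg) simp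
  then show ?thesis by - (rule power2_le_imp_le, auto)
qed

lemma network_rate_bounds:
  assumes "network_assumption E (P :: nat \<Rightarrow> real ^ 'v::finite ^ 'v) B \<zeta>"
  shows "0 < 1 - \<zeta> / (4 * (real CARD('v))\<^sup>2)" and "1 - \<zeta> / (4 * (real CARD('v))\<^sup>2) < 1"
proof -
  have N: "1 \<le> (real CARD('v))\<^sup>2" by (simp add: Suc_le_eq)
  have \<zeta>: "0 < \<zeta>" "\<zeta> < 1" using assms by (auto simp: network_assumption_def)
  have "\<zeta> < 4 * (real CARD('v))\<^sup>2" using \<zeta> N by linarith
  then show "0 < 1 - \<zeta> / (4 * (real CARD('v))\<^sup>2)" using N by simp
  show "1 - \<zeta> / (4 * (real CARD('v))\<^sup>2) < 1" using \<zeta> N by simp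
qed

text \<open>
  In each coordinate, the dissipation over a block is at least \<open>\<zeta> / (4 N)\<close> times the squared range, by
  the bound on all cuts, while the sum of the squared deviations is at most \<open>N / 4\<close> times the squared
  range. So the fraction \<open>\<zeta> / N\<^sup>2\<close> of the squared disagreement is lost, more than
  \<open>(1 - \<zeta> / (4 N\<^sup>2))\<^sup>2\<close> requires.
\<close>

lemma disagreement_contraction:
  fixes x :: "'v::finite \<Rightarrow> real ^ 'n"
  assumes net: "network_assumption E P B \<zeta>"
  shows "disagreement (mixing (transition P t B) x) \<le> (1 - \<zeta> / (4 * (real CARD('v))\<^sup>2)) * disagreement x"
proof -
  let ?N = "real CARD('v)" and ?A = "transition P t B"
  have \<zeta>: "0 < \<zeta>" "\<zeta> < 1" using net by (auto simp: network_assumption_def)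
  have N: "1 \<le> ?N" by (simp add: Suc_le_eq)
  have ds: "doubly_stochastic ?A"
    using net by (intro doubly_stochastic_transition) (simp add: network_assumption_def)
  have coord: "\<zeta> / ?N\<^sup>2 * (\<Sum>i\<in>UNIV. (x i $ k - centroid x $ k)\<^sup>2)
      \<le> (\<Sum>i\<in>UNIV. (x i $ k)\<^sup>2) - (\<Sum>i\<in>UNIV. (mixing ?A x i $ k)\<^sup>2)" for k
  proof -
    define u where "u i = x i $ k" for i
    define hi where "hi = Max (range u)"
    define lo where "lo = Min (range u)"
    have "hi \<in> range u" "lo \<in> range u" unfolding hi_def lo_def by (auto intro: Max_in Min_in)
    then obtain a b where ab: "hi = u a" "lo = u b" by auto
    have bd: "lo \<le> u i" "u i \<le> hi" for i unfolding hi_def lo_def by auto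
    let ?D = "(\<Sum>i\<in>UNIV. (u i)\<^sup>2) - (\<Sum>i\<in>UNIV. (\<Sum>j\<in>UNIV. ?A $ i $ j * u j)\<^sup>2)"
    have "2 * (\<zeta> / 4) * (u a - u b)\<^sup>2 \<le> ?N * (\<Sum>i\<in>UNIV. \<Sum>j\<in>UNIV.
        (\<Sum>k\<in>UNIV. ?A $ k $ i * ?A $ k $ j) * (u i - u j)\<^sup>2)"
      using cut_conductance[OF net] \<zeta> ds
      by (intro dirichlet_form_ge_range) (auto simp: doubly_stochastic_def intro!: sum_nonneg)
    then have "2 * (\<zeta> / 4) * (u a - u b)\<^sup>2 \<le> ?N * (2 * ?D)"
      unfolding doubly_stochastic_dissipation[OF ds] .
    then have D: "\<zeta> * (u a - u b)\<^sup>2 / 4 \<le> ?N * ?D" by (simp add: algebra_simps)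
    \<comment> \<open>The midpoint of the range is a worse centre than the mean, but all deviations from it
      are at most half the range.\<close>
    have "(\<Sum>i\<in>UNIV. (u i - centroid x $ k)\<^sup>2) \<le> (\<Sum>i\<in>UNIV. (u i - (hi + lo) / 2)\<^sup>2)"
      unfolding u_def sum_power2_about_mean[OF centroid_nth] by simp
    also have "\<dots> \<le> (\<Sum>i\<in>(UNIV :: 'v set). ((u a - u b) / 2)\<^sup>2)"
    proof (intro sum_mono)
      fix i
      have "\<bar>u i - (hi + lo) / 2\<bar> \<le> \<bar>(u a - u b) / 2\<bar>"
        using bd[of i] ab by (auto simp: abs_if field_simps)
      then show "(u i - (hi + lo) / 2)\<^sup>2 \<le> ((u a - u b) / 2)\<^sup>2" by (simp only: abs_le_square_iff)
    qed
    also have "\<dots> = ?N * (u a - u b)\<^sup>2 / 4" by (simp add: power_divide)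
    finally have "\<zeta> / ?N\<^sup>2 * (\<Sum>i\<in>UNIV. (u i - centroid x $ k)\<^sup>2) \<le> \<zeta> / ?N\<^sup>2 * (?N * (u a - u b)\<^sup>2 / 4)"
      using \<zeta> by (intro mult_left_mono) auto
    also have "\<dots> = (\<zeta> * (u a - u b)\<^sup>2 / 4) / ?N" using N by (simp add: power2_eq_square)
    also have "\<dots> \<le> ?D" using D N by (simp add: divide_le_eq mult.commute)
    finally show ?thesis by (simp add: u_def mixing_component)
  qed
  have "\<zeta> / ?N\<^sup>2 * (disagreement x)\<^sup>2 \<le> (disagreement x)\<^sup>2 - (disagreement (mixing ?A x))\<^sup>2"
    unfolding disagreement_mixing_diff[OF ds] unfolding disagreement_power2 sum_distrib_left
    by (intro sum_mono) (use coord in \<open>simp add: sum_distrib_left\<close>)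
  then have "(disagreement (mixing ?A x))\<^sup>2 \<le> (1 - \<zeta> / ?N\<^sup>2) * (disagreement x)\<^sup>2"
    by (simp add: left_diff_distrib)
  also have "1 - \<zeta> / ?N\<^sup>2 \<le> (1 - \<zeta> / (4 * ?N\<^sup>2))\<^sup>2"
  proof -
    define a where "a = \<zeta> / (4 * ?N\<^sup>2)"
    have "0 \<le> a" using \<zeta> by (simp add: a_def)
    moreover have "\<zeta> / ?N\<^sup>2 = 4 * a" by (simp add: a_def)
    moreover have "(1 - a)\<^sup>2 = 1 - 2 * a + a\<^sup>2" by (simp add: power2_diff)
    moreover have "0 \<le> a\<^sup>2" by simp
    ultimately show ?thesis unfolding a_def[symmetric] by linarith
  qed
  finally have "(disagreement (mixing ?A x))\<^sup>2 \<le> ((1 - \<zeta> / (4 * ?N\<^sup>2)) * disagreement x)\<^sup>2"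
    by (simp add: power_mult_distrib mult_right_mono)
  moreover have "0 \<le> 1 - \<zeta> / (4 * ?N\<^sup>2)" using network_rate_bounds(1)[OF net] by simp
  ultimately show ?thesis by - (rule power2_le_imp_le, auto)
qed

text \<open>
  The \<open>k div B\<close> complete blocks contract; the incomplete one is nonexpansive.
\<close>

lemma disagreement_transition:
  fixes x :: "'v::finite \<Rightarrow> real ^ 'n"
  assumes net: "network_assumption E P B \<zeta>"
  shows "disagreement (mixing (transition P t k) x) \<le> (1 - \<zeta> / (4 * (real CARD('v))\<^sup>2)) ^ (k div B) * disagreement x"
proof (induction k rule: less_induct)
  case (less k)
  let ?q = "1 - \<zeta> / (4 * (real CARD('v))\<^sup>2)"
  have B: "0 < B" and ds: "\<And>t. doubly_stochastic (P t)" using net by (auto simp: network_assumption_def)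
  have q: "0 \<le> ?q" using network_rate_bounds(1)[OF net] by simp
  show ?case
  proof (cases "k < B")
    case True
    have "doubly_stochastic (transition P t k)" by (rule doubly_stochastic_transition[OF ds])
    from disagreement_mixing_le[OF this, of x] True show ?thesis by simp
  next
    case False
    have "transition P t k = transition P (t + (k - B)) B ** transition P t (k - B)"
      using transition_add[of P t "k - B" B] False by simp
    then have "disagreement (mixing (transition P t k) x)
        \<le> ?q * disagreement (mixing (transition P t (k - B)) x)"
      using disagreement_contraction[OF net] by (simp add: mixing_mult)
    also have "\<dots> \<le> ?q * (?q ^ ((k - B) div B) * disagreement x)"
      using less[of "k - B"] B False q by (intro mult_left_mono) auto
    also have "\<dots> = ?q ^ (k div B) * disagreement x"
      using False B by (simp add: le_div_geq)
    finally show ?thesis .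
  qed
qed

text \<open>
  Duhamel's formula: the state is the superposition of the perturbations of all earlier rounds, each
  propagated by the mixing since then.
\<close>

lemma perturbed_consensus_unroll:
  assumes x0: "\<And>i. x i 0 = 0"
  shows "x i t = (\<Sum>s<t. mixing (transition P (Suc s) (t - Suc s))
      (\<lambda>j. x j (Suc s) - mixing (P s) (\<lambda>k. x k s) j) i)"
proof (induction t arbitrary: i)
  case (Suc t)
  let ?e = "\<lambda>s j. x j (Suc s) - mixing (P s) (\<lambda>k. x k s) j"
  have "mixing (P t) (\<lambda>k. x k t) i
      = (\<Sum>s<t. mixing (P t) (mixing (transition P (Suc s) (t - Suc s)) (?e s)) i)"
    by (subst Suc.IH) (simp add: mixing_sum)
  also have "\<dots> = (\<Sum>s<t. mixing (transition P (Suc s) (Suc t - Suc s)) (?e s) i)"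
  proof (rule sum.cong[OF refl])
    fix s assume "s \<in> {..<t}"
    then have "Suc t - Suc s = Suc (t - Suc s)" "Suc s + (t - Suc s) = t" by auto
    then show "mixing (P t) (mixing (transition P (Suc s) (t - Suc s)) (?e s)) i
        = mixing (transition P (Suc s) (Suc t - Suc s)) (?e s) i"
      by (simp only: transition.simps mixing_mult)
  qed
  finally show ?case by simp
qed (simp add: x0)

lemma perturbed_consensus:
  fixes x :: "'v::finite \<Rightarrow> nat \<Rightarrow> real ^ 'n"
  assumes net: "network_assumption E P B \<zeta>" and x0: "\<And>i. x i 0 = 0"
    and b: "\<And>i s. norm (x i (Suc s) - mixing (P s) (\<lambda>k. x k s) i) \<le> b i s"
  shows "disagreement (\<lambda>i. x i t)
    \<le> (\<Sum>s<t. (1 - \<zeta> / (4 * (real CARD('v))\<^sup>2)) ^ ((t - Suc s) div B) * (\<Sum>i\<in>UNIV. b i s))"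
proof -
  let ?q = "1 - \<zeta> / (4 * (real CARD('v))\<^sup>2)"
  let ?e = "\<lambda>s j. x j (Suc s) - mixing (P s) (\<lambda>k. x k s) j"
  have q: "0 \<le> ?q" using network_rate_bounds(1)[OF net] by simp
  have "disagreement (\<lambda>i. x i t)
      \<le> (\<Sum>s<t. disagreement (mixing (transition P (Suc s) (t - Suc s)) (?e s)))"
    by (subst perturbed_consensus_unroll[of x _ t P, OF x0]) (rule disagreement_sum_le, simp)
  also have "\<dots> \<le> (\<Sum>s<t. ?q ^ ((t - Suc s) div B) * (\<Sum>i\<in>UNIV. b i s))"
  proof (rule sum_mono)
    fix s
    have "disagreement (?e s) \<le> (\<Sum>i\<in>UNIV. b i s)"
      using disagreement_le_sum_norm[of "?e s"] sum_mono[of UNIV "\<lambda>i. norm (?e s i)" "\<lambda>i. b i s"] b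
      by (meson order_trans)
    then have "?q ^ ((t - Suc s) div B) * disagreement (?e s) \<le> ?q ^ ((t - Suc s) div B) * (\<Sum>i\<in>UNIV. b i s)"
      using q by (intro mult_left_mono) auto
    then show "disagreement (mixing (transition P (Suc s) (t - Suc s)) (?e s))
      \<le> ?q ^ ((t - Suc s) div B) * (\<Sum>i\<in>UNIV. b i s)"
      using disagreement_transition[OF net, of "Suc s" "t - Suc s" "?e s"] by linarith
  qed
  finally show ?thesis .
qed

text \<open>
  Since \<open>k div B \<ge> k / B - 1\<close>, the blockwise rate is bounded by the geometric sequence with ratio
  \<open>\<gamma>\<close> up to the factor \<open>1 / q\<close>, where \<open>q = 1 - \<zeta> / (4 N\<^sup>2)\<close>; this factor is at most \<open>\<Gamma> = 1 / q\<^sup>2\<close>.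
\<close>

lemma sum_block_geometric_le:
  assumes net: "network_assumption E (P :: nat \<Rightarrow> real ^ 'v::finite ^ 'v) B \<zeta>"
  shows "(\<Sum>k<n. (1 - \<zeta> / (4 * (real CARD('v))\<^sup>2)) ^ (k div B))
    \<le> Gamma_const CARD('v) \<zeta> / (1 - gamma_const CARD('v) \<zeta> B)"
    "0 < gamma_const CARD('v) \<zeta> B" "gamma_const CARD('v) \<zeta> B < 1"
proof -
  define q where "q = 1 - \<zeta> / (4 * (real CARD('v))\<^sup>2)"
  define \<gamma> where "\<gamma> = gamma_const CARD('v) \<zeta> B"
  have B: "0 < B" using net by (simp add: network_assumption_def)
  have q: "0 < q" "q < 1" unfolding q_def by (rule network_rate_bounds[OF net])+
  have \<gamma>: "\<gamma> = q powr (1 / real B)" by (simp add: \<gamma>_def gamma_const_def q_def)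
  show *: "0 < gamma_const CARD('v) \<zeta> B" using q \<gamma> by (simp add: \<gamma>_def)
  have "q powr (1 / real B) < 1" using q B powr_less_mono2[of "1 / real B" q 1] by simp
  then show **: "gamma_const CARD('v) \<zeta> B < 1" using \<gamma> by (simp add: \<gamma>_def)
  have geo: "q ^ (k div B) \<le> Gamma_const CARD('v) \<zeta> * \<gamma> ^ k" for k
  proof -
    have "real k / real B \<le> real (k div B) + 1"
    proof -
      have "k \<le> (k div B) * B + B"
        using div_mult_mod_eq[of k B] mod_less_divisor[OF B, of k] by linarith
      then have "real k \<le> (real (k div B) + 1) * real B"
        by (metis (mono_tags) distrib_right mult_1 of_nat_1 of_nat_add of_nat_le_iff of_nat_mult)
      then show ?thesis using B by (simp add: divide_le_eq)
    qed
    then have "q powr (real (k div B) + 1) \<le> q powr (real k / real B)"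
      using q by (intro powr_mono') auto
    moreover have "\<gamma> ^ k = q powr (real k / real B)"
      using q by (simp add: \<gamma> powr_power)
    moreover have "q powr (real (k div B) + 1) = q ^ (k div B) * q"
      using q by (simp add: powr_add powr_realpow)
    ultimately have "q ^ (k div B) \<le> \<gamma> ^ k / q" using q by (simp add: le_divide_eq)
    also have "\<dots> \<le> \<gamma> ^ k / q / q"
      using q by (simp add: le_divide_eq mult_left_le \<gamma>)
    also have "\<dots> = Gamma_const CARD('v) \<zeta> * \<gamma> ^ k"
      unfolding Gamma_const_def q_def[symmetric] by (simp add: power_int_minus power2_eq_square field_simps)
    finally show ?thesis .
  qed
  have "(\<Sum>k<n. q ^ (k div B)) \<le> (\<Sum>k<n. Gamma_const CARD('v) \<zeta> * \<gamma> ^ k)"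
    by (intro sum_mono geo)
  also have "\<dots> = Gamma_const CARD('v) \<zeta> * (\<Sum>k<n. \<gamma> ^ k)" by (simp add: sum_distrib_left)
  also have "\<dots> \<le> Gamma_const CARD('v) \<zeta> * (1 / (1 - \<gamma>))"
  proof (rule mult_left_mono)
    show "(\<Sum>k<n. \<gamma> ^ k) \<le> 1 / (1 - \<gamma>)"
      using * ** by (simp add: \<gamma>_def[symmetric] sum_gp_strict divide_right_mono)
    show "0 \<le> Gamma_const CARD('v) \<zeta>"
      by (simp add: Gamma_const_def power_int_minus)
  qed
  finally show "(\<Sum>k<n. (1 - \<zeta> / (4 * (real CARD('v))\<^sup>2)) ^ (k div B))
    \<le> Gamma_const CARD('v) \<zeta> / (1 - gamma_const CARD('v) \<zeta> B)"
    by (simp add: q_def \<gamma>_def)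
qed

text \<open>
  Young's inequality for the convolution: each \<open>b s\<close> is counted with a total weight of at most \<open>K\<close>.
\<close>

lemma convolution_sum_le:
  fixes h b :: "nat \<Rightarrow> real"
  assumes h: "\<And>k. 0 \<le> h k" and b: "\<And>s. 0 \<le> b s" and K: "\<And>n. (\<Sum>k<n. h k) \<le> K"
  shows "(\<Sum>t=1..T. \<Sum>s<t. h (t - Suc s) * b s) \<le> K * (\<Sum>s<T. b s)"
proof -
  have "(\<Sum>t=1..T. \<Sum>s<t. h (t - Suc s) * b s) = (\<Sum>s<T. (\<Sum>k<T - s. h k) * b s)"
  proof (induction T)
    case (Suc T)
    have "(\<Sum>s<Suc T. (\<Sum>k<Suc T - s. h k) * b s)
        = (\<Sum>s<Suc T. (\<Sum>k<T - s. h k) * b s + h (Suc T - Suc s) * b s)"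
    proof (intro sum.cong refl)
      fix s assume "s \<in> {..<Suc T}"
      then have "Suc T - s = Suc (T - s)" by auto
      then show "(\<Sum>k<Suc T - s. h k) * b s = (\<Sum>k<T - s. h k) * b s + h (Suc T - Suc s) * b s"
        by (simp add: distrib_right)
    qed
    also have "\<dots> = (\<Sum>s<T. (\<Sum>k<T - s. h k) * b s) + (\<Sum>s<Suc T. h (Suc T - Suc s) * b s)"
      by (simp add: sum.distrib)
    finally show ?case using Suc by simp
  qed simp
  also have "\<dots> \<le> (\<Sum>s<T. K * b s)" by (intro sum_mono mult_right_mono K b)
  finally show ?thesis by (simp add: sum_distrib_left)
qed

section \<open>Symmetry of second derivatives and convexity of the Bregman divergence\<close>

text \<open>
  The mean value theorem, applied to the difference of \<open>g\<close> along two parallel segments in direction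
  \<open>v\<close> that are displaced by \<open>s w\<close>. The left-hand side is symmetric in \<open>v\<close> and \<open>w\<close> except for the
  term \<open>v \<bullet> H w\<close>.
\<close>

lemma second_difference_estimate:
  fixes g :: "'a::real_inner \<Rightarrow> real"
  assumes D: "\<And>y. norm (y - x) < r \<Longrightarrow> (g has_derivative (\<lambda>h. G y \<bullet> h)) (at y)"
    and G: "\<And>y. norm (y - x) < r \<Longrightarrow> norm (G y - G x - H (y - x)) \<le> e * norm (y - x)"
    and H: "linear H" and s: "0 < s" "s * (norm v + norm w) < r" and e: "0 \<le> e"
  shows "\<bar>g (x + s *\<^sub>R v + s *\<^sub>R w) - g (x + s *\<^sub>R v) - g (x + s *\<^sub>R w) + g x - s\<^sup>2 * (v \<bullet> H w)\<bar>
     \<le> 2 * e * s\<^sup>2 * (norm v + norm w)\<^sup>2"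
proof -
  define c where "c = norm v + norm w"
  define p where "p \<tau> = (\<tau> * s) *\<^sub>R v" for \<tau> :: real
  define h where "h \<tau> = g (x + p \<tau> + s *\<^sub>R w) - g (x + p \<tau>)" for \<tau>
  have norm_p: "norm (p \<tau> + s *\<^sub>R w) \<le> s * c" "norm (p \<tau>) \<le> s * c" if "0 \<le> \<tau>" "\<tau> \<le> 1" for \<tau>
  proof -
    have "\<tau> * s * norm v \<le> s * norm v" using that s by (simp add: mult_left_le_one_le mult_right_mono)
    then have *: "norm (p \<tau>) \<le> s * norm v" using that s by (simp add: p_def)
    then show "norm (p \<tau>) \<le> s * c" using s by (simp add: c_def distrib_left add_increasing2)
    show "norm (p \<tau> + s *\<^sub>R w) \<le> s * c"
      using * norm_triangle_ineq[of "p \<tau>" "s *\<^sub>R w"] s by (simp add: c_def distrib_left)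
  qed
  have sc: "s * c < r" using s by (simp add: c_def)
  have dh: "(h has_real_derivative s * (v \<bullet> (G (x + p \<tau> + s *\<^sub>R w) - G (x + p \<tau>)))) (at \<tau>)"
    if \<tau>: "0 \<le> \<tau>" "\<tau> \<le> 1" for \<tau>
  proof -
    have dp: "((\<lambda>\<tau>. x + p \<tau> + a) has_derivative (\<lambda>t. (t * s) *\<^sub>R v)) (at \<tau>)" for a
      unfolding p_def by (auto intro!: derivative_eq_intros)
    have 1: "((\<lambda>\<tau>. g (x + p \<tau> + s *\<^sub>R w)) has_derivative (\<lambda>t. G (x + p \<tau> + s *\<^sub>R w) \<bullet> ((t * s) *\<^sub>R v))) (at \<tau>)"
      by (rule has_derivative_compose[OF dp D]) (use norm_p[OF \<tau>] sc in \<open>simp add: add.assoc\<close>)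
    have 2: "((\<lambda>\<tau>. g (x + p \<tau> + 0)) has_derivative (\<lambda>t. G (x + p \<tau> + 0) \<bullet> ((t * s) *\<^sub>R v))) (at \<tau>)"
      by (rule has_derivative_compose[OF dp D]) (use norm_p[OF \<tau>] sc in simp)
    show ?thesis
      unfolding h_def has_field_derivative_def
      by (rule has_derivative_eq_rhs[OF has_derivative_diff[OF 1 2[simplified]]])
        (auto simp: inner_diff_right inner_commute algebra_simps)
  qed
  obtain \<tau> where \<tau>: "0 < \<tau>" "\<tau> < 1"
    and mvt: "h 1 - h 0 = s * (v \<bullet> (G (x + p \<tau> + s *\<^sub>R w) - G (x + p \<tau>)))"
    using MVT2[of 0 1 h "\<lambda>\<tau>. s * (v \<bullet> (G (x + p \<tau> + s *\<^sub>R w) - G (x + p \<tau>)))", OF _ dh] by auto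
  define R where "R = G (x + p \<tau> + s *\<^sub>R w) - G (x + p \<tau>) - s *\<^sub>R H w"
  have np: "norm (p \<tau> + s *\<^sub>R w) \<le> s * c" "norm (p \<tau>) \<le> s * c" using norm_p \<tau> by auto
  have "R = (G (x + p \<tau> + s *\<^sub>R w) - G x - H (p \<tau> + s *\<^sub>R w)) - (G (x + p \<tau>) - G x - H (p \<tau>))"
    by (simp add: R_def linear_add[OF H] linear_scale[OF H])
  then have "norm R \<le> norm (G (x + p \<tau> + s *\<^sub>R w) - G x - H (p \<tau> + s *\<^sub>R w)) + norm (G (x + p \<tau>) - G x - H (p \<tau>))"
    by (simp only: norm_triangle_ineq4)
  also have "\<dots> \<le> e * norm (p \<tau> + s *\<^sub>R w) + e * norm (p \<tau>)"
    using G[of "x + p \<tau> + s *\<^sub>R w"] G[of "x + p \<tau>"] np sc by (intro add_mono) (simp_all add: add.assoc)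
  also have "\<dots> \<le> e * (s * c) + e * (s * c)" using np e by (intro add_mono mult_left_mono)
  finally have R: "norm R \<le> 2 * e * s * c" by (simp add: algebra_simps)
  have "g (x + s *\<^sub>R v + s *\<^sub>R w) - g (x + s *\<^sub>R v) - g (x + s *\<^sub>R w) + g x - s\<^sup>2 * (v \<bullet> H w)
     = s * (v \<bullet> R)"
    using mvt by (simp add: h_def p_def R_def inner_diff_right power2_eq_square algebra_simps)
  also have "\<bar>\<dots>\<bar> \<le> s * (norm v * norm R)"
    using s Cauchy_Schwarz_ineq2[of v R] by (simp add: abs_mult)
  also have "\<dots> \<le> s * (c * (2 * e * s * c))"
    using s R by (intro mult_left_mono mult_mono) (auto simp: c_def)
  finally show ?thesis by (simp add: c_def power2_eq_square algebra_simps)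
qed

text \<open>
  The second difference of \<open>g\<close> at scale \<open>s\<close> is within \<open>O(e s\<^sup>2)\<close> of both \<open>s\<^sup>2 (v \<bullet> H w)\<close> and
  \<open>s\<^sup>2 (w \<bullet> H v)\<close>, where \<open>e\<close> becomes arbitrarily small with \<open>s\<close>.
\<close>

lemma symmetric_second_derivative:
  fixes g :: "'a::real_inner \<Rightarrow> real"
  assumes U: "open U" "x \<in> U"
    and D: "\<And>y. y \<in> U \<Longrightarrow> (g has_derivative (\<lambda>h. G y \<bullet> h)) (at y)"
    and G: "(G has_derivative H) (at x)"
  shows "v \<bullet> H w = w \<bullet> H v"
proof -
  define c where "c = norm v + norm w"
  have H: "linear H" using G by (rule has_derivative_linear)
  have "\<bar>v \<bullet> H w - w \<bullet> H v\<bar> \<le> 0 + \<epsilon>" if \<epsilon>: "0 < \<epsilon>" for \<epsilon>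
  proof -
    \<comment> \<open>Both estimates below have the error \<open>2 e s\<^sup>2 c\<^sup>2\<close>, and \<open>4 e c\<^sup>2 \<le> \<epsilon>\<close>; the \<open>+ 1\<close> covers \<open>c = 0\<close>.\<close>
    define e where "e = \<epsilon> / (4 * (c\<^sup>2 + 1))"
    have c2: "0 < c\<^sup>2 + 1" by (simp add: add_nonneg_pos)
    have e: "0 < e" using \<epsilon> c2 by (simp add: e_def)
    obtain r1 where r1: "0 < r1" "\<And>y. norm (y - x) < r1 \<Longrightarrow> norm (G y - G x - H (y - x)) \<le> e * norm (y - x)"
      using G e unfolding has_derivative_at_alt by blast
    obtain r2 where r2: "0 < r2" "ball x r2 \<subseteq> U" using U open_contains_ball by blast
    define r where "r = min r1 r2"
    define s where "s = r / (c + 1)"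
    have c0: "0 \<le> c" by (simp add: c_def)
    have r: "0 < r" using r1 r2 by (simp add: r_def)
    then have s: "0 < s" "s * c < r" using c0 by (auto simp: s_def field_simps)
    have D': "(g has_derivative (\<lambda>h. G y \<bullet> h)) (at y)" if "norm (y - x) < r" for y
      using that r2 by (intro D) (auto simp: r_def dist_norm norm_minus_commute subset_iff)
    have G': "norm (G y - G x - H (y - x)) \<le> e * norm (y - x)" if "norm (y - x) < r" for y
      using that r1 by (simp add: r_def)
    have "\<bar>g (x + s *\<^sub>R v + s *\<^sub>R w) - g (x + s *\<^sub>R v) - g (x + s *\<^sub>R w) + g x - s\<^sup>2 * (v \<bullet> H w)\<bar> \<le> 2 * e * s\<^sup>2 * c\<^sup>2"
      using second_difference_estimate[OF D' G' H s(1), where v = v and w = w] s e by (simp add: c_def)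
    moreover have "\<bar>g (x + s *\<^sub>R v + s *\<^sub>R w) - g (x + s *\<^sub>R v) - g (x + s *\<^sub>R w) + g x - s\<^sup>2 * (w \<bullet> H v)\<bar> \<le> 2 * e * s\<^sup>2 * c\<^sup>2"
      using second_difference_estimate[OF D' G' H s(1), where v = w and w = v] s e by (simp add: c_def add_ac algebra_simps)
    ultimately have "\<bar>s\<^sup>2 * (v \<bullet> H w) - s\<^sup>2 * (w \<bullet> H v)\<bar> \<le> 4 * e * s\<^sup>2 * c\<^sup>2"
      unfolding abs_le_iff by linarith
    then have "\<bar>s\<^sup>2 * (v \<bullet> H w - w \<bullet> H v)\<bar> \<le> s\<^sup>2 * (4 * e * c\<^sup>2)"
      by (simp add: algebra_simps)
    then have "s\<^sup>2 * \<bar>v \<bullet> H w - w \<bullet> H v\<bar> \<le> s\<^sup>2 * (4 * e * c\<^sup>2)"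
      by (simp only: abs_mult abs_power2)
    then have "\<bar>v \<bullet> H w - w \<bullet> H v\<bar> \<le> 4 * e * c\<^sup>2" using s by simp
    also have "\<dots> = \<epsilon> * (c\<^sup>2 / (c\<^sup>2 + 1))" using c2 by (simp add: e_def field_simps)
    also have "\<dots> \<le> \<epsilon>" using \<epsilon> c2 by (intro mult_left_le) (simp_all add: divide_le_eq)
    finally show ?thesis by simp
  qed
  then have "\<bar>v \<bullet> H w - w \<bullet> H v\<bar> \<le> 0" by (rule field_le_epsilon)
  then show ?thesis by simp
qed

lemma has_vector_derivative_along_line:
  assumes "(F has_derivative F') (at (a + s *\<^sub>R v))"
  shows "((\<lambda>s. F (a + s *\<^sub>R v)) has_vector_derivative F' v) (at s)"
proof -
  have "((\<lambda>s. a + s *\<^sub>R v) has_derivative (\<lambda>t. t *\<^sub>R v)) (at s)"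
    by (auto intro!: derivative_eq_intros)
  from has_derivative_compose[OF this assms] show ?thesis
    unfolding has_vector_derivative_def
    by (simp add: linear_scale[OF has_derivative_linear[OF assms]])
qed

lemma bregman_assumption_derivatives:
  fixes \<phi> :: "real ^ 'n \<Rightarrow> real"
  assumes "bregman_assumption U X \<phi> \<sigma>" "y \<in> U"
  shows "(\<phi> has_derivative (\<lambda>h. grad \<phi> y \<bullet> h)) (at y)"
    and "(grad \<phi> has_derivative (\<lambda>h. hessian \<phi> y *v h)) (at y)"
    and "(hessian \<phi> has_derivative hessian_deriv \<phi> y) (at y)"
proof -
  have d: "\<phi> differentiable (at y)" "grad \<phi> differentiable (at y)" "hessian \<phi> differentiable (at y)"
    using assms by (auto simp: bregman_assumption_def C3_on_def)
  show "(\<phi> has_derivative (\<lambda>h. grad \<phi> y \<bullet> h)) (at y)"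
    using gderiv_grad[OF d(1)] by (simp add: gderiv_def inner_commute)
  show "(grad \<phi> has_derivative (\<lambda>h. hessian \<phi> y *v h)) (at y)"
    using d(2) by (simp add: jacobian_works hessian_def)
  show "(hessian \<phi> has_derivative hessian_deriv \<phi> y) (at y)"
    using d(3) by (simp add: frechet_derivative_works hessian_deriv_def[abs_def])
qed

lemma hessian_symmetric:
  assumes "bregman_assumption U X \<phi> \<sigma>" "y \<in> U"
  shows "v \<bullet> (hessian \<phi> y *v w) = w \<bullet> (hessian \<phi> y *v v)"
  using assms bregman_assumption_derivatives[OF assms(1)]
  by (intro symmetric_second_derivative[of U y \<phi> "grad \<phi>"]) (auto simp: bregman_assumption_def)

lemma bounded_linear_matrix_vector: "bounded_linear (\<lambda>A :: real ^ 'n ^ 'm. A *v v)"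
  by (intro linear_conv_bounded_linear[THEN iffD1] linearI)
    (auto simp: matrix_vector_mult_add_rdistrib scaleR_matrix_vector_assoc)

text \<open>
  The two arguments that come from differentiating \<open>y \<mapsto> \<nabla>\<phi>(y) \<bullet> a\<close> twice can be exchanged; the
  symmetry of the Hessian identifies the gradient of this function as \<open>H(y) a\<close>.
\<close>

lemma hessian_deriv_symmetric:
  assumes br: "bregman_assumption U X \<phi> \<sigma>" and y: "y \<in> U"
  shows "v \<bullet> (hessian_deriv \<phi> y w *v a) = w \<bullet> (hessian_deriv \<phi> y v *v a)"
proof (rule symmetric_second_derivative[of U y "\<lambda>y. grad \<phi> y \<bullet> a" "\<lambda>y. hessian \<phi> y *v a"])
  show "open U" using br by (simp add: bregman_assumption_def)
  show "((\<lambda>y. grad \<phi> y \<bullet> a) has_derivative (\<lambda>h. (hessian \<phi> z *v a) \<bullet> h)) (at z)" if "z \<in> U" for z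
    using has_derivative_inner_left[OF bregman_assumption_derivatives(2)[OF br that], of a]
    using hessian_symmetric[OF br that, of a] by (simp add: inner_commute)
  show "((\<lambda>y. hessian \<phi> y *v a) has_derivative (\<lambda>v. hessian_deriv \<phi> y v *v a)) (at y)"
    by (rule bounded_linear.has_derivative[OF bounded_linear_matrix_vector bregman_assumption_derivatives(3)[OF br y]])
qed (rule y)

text \<open>
  Along a segment with direction \<open>v\<close>, the second derivative of \<open>D(x, \<cdot>)\<close> is
  \<open>v \<bullet> H(y) v + (y - x) \<bullet> \<nabla>H(y)(v) v\<close>. The symmetry of the third derivative turns it into the
  quadratic form of \<open>H(y) + \<nabla>H(y)(y - x)\<close> at \<open>v\<close>, which is assumed to be nonnegative.
\<close>

lemma bregman_convex_second:
  fixes \<phi> :: "real ^ 'n \<Rightarrow> real"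
  assumes br: "bregman_assumption U X \<phi> \<sigma>" and X: "convex X" and x: "x \<in> X"
  shows "convex_on X (\<lambda>y. bregman \<phi> x y)"
proof (rule convex_onI)
  fix t :: real and a b assume t: "0 < t" "t < 1" and ab: "a \<in> X" "b \<in> X"
  define v where "v = b - a"
  let ?y = "\<lambda>s. a + s *\<^sub>R v"
  have yX: "?y s \<in> X" if "s \<in> {0..1}" for s
  proof -
    have "?y s = (1 - s) *\<^sub>R a + s *\<^sub>R b" by (simp add: v_def algebra_simps)
    then show ?thesis using X ab that by (simp add: convexD)
  qed
  have XU: "X \<subseteq> U" using br by (simp add: bregman_assumption_def)
  let ?h = "\<lambda>s. bregman \<phi> x (?y s)"
  let ?h' = "\<lambda>s. (hessian \<phi> (?y s) *v v) \<bullet> (?y s - x)"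
  let ?h'' = "\<lambda>s. (hessian \<phi> (?y s) *v v) \<bullet> v + (hessian_deriv \<phi> (?y s) v *v v) \<bullet> (?y s - x)"
  have "convex_on {0..1} ?h"
  proof (rule f''_ge0_imp_convex)
    fix s :: real assume s: "s \<in> {0..1}"
    then have yU: "?y s \<in> U" using yX XU by blast
    have dy: "((\<lambda>s. ?y s - x) has_vector_derivative v) (at s)"
      by (auto intro!: derivative_eq_intros)
    have dy': "((\<lambda>s. x - ?y s) has_vector_derivative - v) (at s)"
      by (auto intro!: derivative_eq_intros)
    note d = bregman_assumption_derivatives[OF br yU]
    have d1: "((\<lambda>s. \<phi> (?y s)) has_vector_derivative grad \<phi> (?y s) \<bullet> v) (at s)"
      by (rule has_vector_derivative_along_line[OF d(1)])
    have d2: "((\<lambda>s. grad \<phi> (?y s)) has_vector_derivative hessian \<phi> (?y s) *v v) (at s)"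
      by (rule has_vector_derivative_along_line[OF d(2)])
    have d3: "((\<lambda>s. hessian \<phi> (?y s) *v v) has_vector_derivative hessian_deriv \<phi> (?y s) v *v v) (at s)"
      by (rule bounded_linear.has_vector_derivative[OF bounded_linear_matrix_vector
          has_vector_derivative_along_line[OF d(3)]])
    show "(?h has_real_derivative ?h' s) (at s)"
      unfolding has_real_derivative_iff_has_vector_derivative bregman_def
      by (rule has_vector_derivative_eq_rhs[OF has_vector_derivative_diff[OF has_vector_derivative_diff[OF
            has_vector_derivative_const d1]
            bounded_bilinear.has_vector_derivative[OF bounded_bilinear_inner d2 dy']]])
        (simp add: inner_diff_right)
    show "(?h' has_real_derivative ?h'' s) (at s)"
      unfolding has_real_derivative_iff_has_vector_derivative
      by (rule bounded_bilinear.has_vector_derivative[OF bounded_bilinear_inner d3 dy])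
    have "(hessian_deriv \<phi> (?y s) v *v v) \<bullet> (?y s - x) = v \<bullet> (hessian_deriv \<phi> (?y s) (?y s - x) *v v)"
      using hessian_deriv_symmetric[OF br yU] by (simp add: inner_commute)
    then have "?h'' s = v \<bullet> ((hessian \<phi> (?y s) + hessian_deriv \<phi> (?y s) (?y s - x)) *v v)"
      by (simp add: matrix_vector_mult_add_rdistrib inner_add_right inner_commute)
    then show "0 \<le> ?h'' s"
      using br yX[OF s] x by (auto simp: bregman_assumption_def psd_def)
  qed simp
  from convex_onD[OF this, of t 0 1] t
  show "bregman \<phi> x ((1 - t) *\<^sub>R a + t *\<^sub>R b) \<le> (1 - t) * bregman \<phi> x a + t * bregman \<phi> x b"
    by (simp add: v_def algebra_simps)
qed (rule X)

section \<open>Mirror steps\<close>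

text \<open>
  Dividing by \<open>\<theta>\<close> and letting \<open>\<theta> \<down> 0\<close> extracts first-order conditions from inequalities along a
  segment; the quadratic slack \<open>\<theta>\<^sup>2 b\<close> comes from strong convexity.
\<close>

lemma derivative_le_of_increment_le:
  fixes \<psi> :: "real \<Rightarrow> real"
  assumes D: "(\<psi> has_real_derivative D) (at 0)"
    and le: "\<And>\<theta>. 0 < \<theta> \<Longrightarrow> \<theta> < 1 \<Longrightarrow> \<psi> \<theta> - \<psi> 0 \<le> \<theta> * (a + \<theta> * b)"
  shows "D \<le> a"
proof (rule tendsto_le[OF trivial_limit_at_right_real])
  show "((\<lambda>\<theta>. a + \<theta> * b) \<longlongrightarrow> a) (at_right 0)" by (auto intro!: tendsto_eq_intros)
  show "((\<lambda>\<theta>. (\<psi> \<theta> - \<psi> 0) / \<theta>) \<longlongrightarrow> D) (at_right 0)"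
    using D by (simp add: has_field_derivative_iff filterlim_at_split)
  have "\<forall>\<^sub>F \<theta> in at_right 0. \<theta> \<in> {0<..<1::real}" by (rule eventually_at_right_real) simp
  then show "\<forall>\<^sub>F \<theta> in at_right 0. (\<psi> \<theta> - \<psi> 0) / \<theta> \<le> a + \<theta> * b"
    by eventually_elim (use le in \<open>auto simp: divide_le_eq mult.commute\<close>)
qed

lemma bregman_ge:
  assumes br: "bregman_assumption U X \<phi> \<sigma>" and xy: "x \<in> X" "y \<in> X"
  shows "\<sigma> / 2 * (norm (x - y))\<^sup>2 \<le> bregman \<phi> x y"
proof -
  have yU: "y \<in> U" using br xy by (auto simp: bregman_assumption_def)
  have "((\<lambda>\<theta>. \<phi> (y + \<theta> *\<^sub>R (x - y))) has_real_derivative grad \<phi> y \<bullet> (x - y)) (at 0)"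
    unfolding has_real_derivative_iff_has_vector_derivative
    by (rule has_vector_derivative_along_line) (use bregman_assumption_derivatives(1)[OF br yU] in simp)
  then have "grad \<phi> y \<bullet> (x - y) \<le> \<phi> x - \<phi> y - \<sigma> / 2 * (norm (x - y))\<^sup>2"
  proof (rule derivative_le_of_increment_le)
    fix \<theta> :: real assume \<theta>: "0 < \<theta>" "\<theta> < 1"
    have "y + \<theta> *\<^sub>R (x - y) = \<theta> *\<^sub>R x + (1 - \<theta>) *\<^sub>R y" by (simp add: algebra_simps)
    then have "\<phi> (y + \<theta> *\<^sub>R (x - y)) \<le> \<theta> * \<phi> x + (1 - \<theta>) * \<phi> y - \<sigma> * \<theta> * (1 - \<theta>) / 2 * (norm (x - y))\<^sup>2"
      using br xy \<theta> by (simp add: bregman_assumption_def strongly_convex_on_def)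
    then show "\<phi> (y + \<theta> *\<^sub>R (x - y)) - \<phi> (y + 0 *\<^sub>R (x - y))
      \<le> \<theta> * (\<phi> x - \<phi> y - \<sigma> / 2 * (norm (x - y))\<^sup>2 + \<theta> * (\<sigma> / 2 * (norm (x - y))\<^sup>2))"
      by (simp add: algebra_simps diff_divide_distrib)
  qed
  then show ?thesis by (simp add: bregman_def)
qed

lemma bregman_nonneg:
  assumes "bregman_assumption U X \<phi> \<sigma>" "x \<in> X" "y \<in> X"
  shows "0 \<le> bregman \<phi> x y"
proof -
  have "0 \<le> \<sigma> / 2 * (norm (x - y))\<^sup>2" using assms(1) by (simp add: bregman_assumption_def)
  then show ?thesis using bregman_ge[OF assms] by linarith
qed

lemma mirror_optimality:
  assumes br: "bregman_assumption U X \<phi> \<sigma>" and X: "convex X"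
    and m: "is_arg_min (\<lambda>u. \<phi> u - w \<bullet> u) (\<lambda>u. u \<in> X) z" and u: "u \<in> X"
  shows "0 \<le> (grad \<phi> z - w) \<bullet> (u - z)"
proof -
  have z: "z \<in> X" and min: "\<phi> z - w \<bullet> z \<le> \<phi> u - w \<bullet> u" if "u \<in> X" for u
    using m that by (auto simp: is_arg_min_linorder)
  have zU: "z \<in> U" using br z[OF u] by (auto simp: bregman_assumption_def)
  let ?\<psi> = "\<lambda>\<theta>. \<phi> (z + \<theta> *\<^sub>R (u - z)) - w \<bullet> (z + \<theta> *\<^sub>R (u - z))"
  have "((\<lambda>\<theta>. \<phi> (z + \<theta> *\<^sub>R (u - z))) has_real_derivative grad \<phi> z \<bullet> (u - z)) (at 0)"
    unfolding has_real_derivative_iff_has_vector_derivative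
    by (rule has_vector_derivative_along_line) (use bregman_assumption_derivatives(1)[OF br zU] in simp)
  then have "((\<lambda>\<theta>. - ?\<psi> \<theta>) has_real_derivative - ((grad \<phi> z - w) \<bullet> (u - z))) (at 0)"
    unfolding inner_add_right inner_scaleR_right
    by (auto intro!: derivative_eq_intros simp: inner_diff_left)
  then have "- ((grad \<phi> z - w) \<bullet> (u - z)) \<le> 0"
  proof (rule derivative_le_of_increment_le)
    fix \<theta> :: real assume \<theta>: "0 < \<theta>" "\<theta> < 1"
    have "z + \<theta> *\<^sub>R (u - z) = (1 - \<theta>) *\<^sub>R z + \<theta> *\<^sub>R u" by (simp add: algebra_simps)
    then have "z + \<theta> *\<^sub>R (u - z) \<in> X" using convexD[OF X z[OF u] u, of "1 - \<theta>" \<theta>] \<theta> by simp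
    from min[OF this] show "- ?\<psi> \<theta> - (- ?\<psi> 0) \<le> \<theta> * (0 + \<theta> * 0)" by simp
  qed
  then show ?thesis by simp
qed

text \<open>
  The variational inequalities of both minimizers add up to the monotonicity estimate
  \<open>(\<nabla>\<phi>(z1) - \<nabla>\<phi>(z2)) \<bullet> (z1 - z2) \<le> (w1 - w2) \<bullet> (z1 - z2)\<close>, whose left-hand side is the
  symmetrized divergence and hence at least \<open>\<sigma> \<parallel>z1 - z2\<parallel>\<^sup>2\<close>.
\<close>

lemma mirror_lipschitz:
  assumes br: "bregman_assumption U X \<phi> \<sigma>" and X: "convex X"
    and m1: "is_arg_min (\<lambda>u. \<phi> u - w1 \<bullet> u) (\<lambda>u. u \<in> X) z1"
    and m2: "is_arg_min (\<lambda>u. \<phi> u - w2 \<bullet> u) (\<lambda>u. u \<in> X) z2"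
  shows "\<sigma> * norm (z1 - z2) \<le> norm (w1 - w2)"
proof -
  have z: "z1 \<in> X" "z2 \<in> X" using m1 m2 by (auto simp: is_arg_min_def)
  have "\<sigma> / 2 * (norm (z1 - z2))\<^sup>2 + \<sigma> / 2 * (norm (z2 - z1))\<^sup>2 \<le> bregman \<phi> z1 z2 + bregman \<phi> z2 z1"
    by (intro add_mono bregman_ge[OF br] z)
  also have "\<dots> = (grad \<phi> z1 - grad \<phi> z2) \<bullet> (z1 - z2)"
    by (simp add: bregman_def inner_diff_left inner_diff_right)
  also have "\<dots> \<le> (w1 - w2) \<bullet> (z1 - z2)"
    using mirror_optimality[OF br X m1 z(2)] mirror_optimality[OF br X m2 z(1)]
    by (simp add: inner_diff_left inner_diff_right)
  also have "\<dots> \<le> norm (w1 - w2) * norm (z1 - z2)" by (rule norm_cauchy_schwarz)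
  finally have "(\<sigma> * norm (z1 - z2)) * norm (z1 - z2) \<le> norm (w1 - w2) * norm (z1 - z2)"
    by (simp add: norm_minus_commute power2_eq_square algebra_simps)
  then show ?thesis by (cases "z1 = z2") (auto simp: mult_le_cancel_right)
qed

text \<open>
  An update with gradient \<open>g\<close> at \<open>y\<close> depends only on the dual vector \<open>\<nabla>\<phi>(y) - \<alpha> g\<close>. Expressing it
  by a single map on the whole space makes the iterates continuous functions of \<open>y\<close> and \<open>g\<close>, so they
  are measurable in the noise.
\<close>

definition mirror_map :: "(real ^ 'n) set \<Rightarrow> (real ^ 'n \<Rightarrow> real) \<Rightarrow> real ^ 'n \<Rightarrow> real ^ 'n" where
  "mirror_map X \<phi> w = (SOME u. is_arg_min (\<lambda>u. \<phi> u - w \<bullet> u) (\<lambda>u. u \<in> X) u)"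

lemma mirror_map_works:
  assumes br: "bregman_assumption U X \<phi> \<sigma>" and X: "compact X" "X \<noteq> {}"
  shows "is_arg_min (\<lambda>u. \<phi> u - w \<bullet> u) (\<lambda>u. u \<in> X) (mirror_map X \<phi> w)"
proof -
  have "continuous_on X \<phi>"
    using bregman_assumption_derivatives(1)[OF br] br
    by (intro differentiable_imp_continuous_on)
      (auto simp: differentiable_on_def differentiable_def bregman_assumption_def intro: has_derivative_at_withinI)
  then have "continuous_on X (\<lambda>u. \<phi> u - w \<bullet> u)" by (intro continuous_intros)
  then obtain z where "z \<in> X" "\<forall>u\<in>X. \<phi> z - w \<bullet> z \<le> \<phi> u - w \<bullet> u"
    using continuous_attains_inf[OF X] by blast
  then have "is_arg_min (\<lambda>u. \<phi> u - w \<bullet> u) (\<lambda>u. u \<in> X) z" by (auto simp: is_arg_min_linorder)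
  then show ?thesis unfolding mirror_map_def by (rule someI)
qed

lemma mirror_map_unique:
  assumes br: "bregman_assumption U X \<phi> \<sigma>" and X: "compact X" "convex X"
    and m: "is_arg_min (\<lambda>u. \<phi> u - w \<bullet> u) (\<lambda>u. u \<in> X) z"
  shows "mirror_map X \<phi> w = z"
proof -
  have "X \<noteq> {}" using m by (auto simp: is_arg_min_def)
  from mirror_lipschitz[OF br X(2) mirror_map_works[OF br X(1) this, of w] m]
  show ?thesis using br by (simp add: bregman_assumption_def mult_le_0_iff)
qed

lemma continuous_mirror_map:
  assumes br: "bregman_assumption U X \<phi> \<sigma>" and X: "compact X" "convex X" "X \<noteq> {}"
  shows "continuous_on UNIV (mirror_map X \<phi>)"
proof (rule lipschitz_on_continuous_on)
  have \<sigma>: "0 < \<sigma>" using br by (simp add: bregman_assumption_def)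
  show "(1 / \<sigma>)-lipschitz_on UNIV (mirror_map X \<phi>)"
    using mirror_lipschitz[OF br X(2) mirror_map_works[OF br X(1,3)] mirror_map_works[OF br X(1,3)]] \<sigma>
    by (intro lipschitz_onI) (auto simp: dist_norm le_divide_eq mult.commute)
qed

lemma mirror_map_step:
  assumes br: "bregman_assumption U X \<phi> \<sigma>" and X: "compact X" "convex X"
    and z: "is_arg_min (\<lambda>u. \<alpha> * (g \<bullet> u) + bregman \<phi> u y) (\<lambda>u. u \<in> X) z"
  shows "is_arg_min (\<lambda>u. \<phi> u - (grad \<phi> y - \<alpha> *\<^sub>R g) \<bullet> u) (\<lambda>u. u \<in> X) z"
    and "z = mirror_map X \<phi> (grad \<phi> y - \<alpha> *\<^sub>R g)"
proof -
  have "\<alpha> * (g \<bullet> u) + bregman \<phi> u y = (\<phi> u - (grad \<phi> y - \<alpha> *\<^sub>R g) \<bullet> u) - (\<phi> y - grad \<phi> y \<bullet> y)" for u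
    by (simp add: bregman_def algebra_simps inner_diff_right)
  then show *: "is_arg_min (\<lambda>u. \<phi> u - (grad \<phi> y - \<alpha> *\<^sub>R g) \<bullet> u) (\<lambda>u. u \<in> X) z"
    using z by (auto simp: is_arg_min_linorder)
  show "z = mirror_map X \<phi> (grad \<phi> y - \<alpha> *\<^sub>R g)" using mirror_map_unique[OF br X *] by simp
qed

text \<open>
  The point \<open>y\<close> is itself the image of \<open>\<nabla>\<phi>(y)\<close> under the mirror map, so the step is the response of the
  Lipschitz mirror map to the displacement \<open>\<alpha> g\<close>.
\<close>

lemma mirror_step_length:
  assumes br: "bregman_assumption U X \<phi> \<sigma>" and X: "compact X" "convex X" and y: "y \<in> X"
    and z: "is_arg_min (\<lambda>u. \<alpha> * (g \<bullet> u) + bregman \<phi> u y) (\<lambda>u. u \<in> X) z" and \<alpha>: "0 \<le> \<alpha>"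
  shows "norm (z - y) \<le> \<alpha> * norm g / \<sigma>"
proof -
  have \<sigma>: "0 < \<sigma>" using br by (simp add: bregman_assumption_def)
  have "\<phi> y - grad \<phi> y \<bullet> y \<le> \<phi> u - grad \<phi> y \<bullet> u" if "u \<in> X" for u
    using bregman_nonneg[OF br that y] by (simp add: bregman_def inner_diff_right)
  then have "is_arg_min (\<lambda>u. \<phi> u - grad \<phi> y \<bullet> u) (\<lambda>u. u \<in> X) y"
    using y by (simp add: is_arg_min_linorder)
  from mirror_lipschitz[OF br X(2) mirror_map_step(1)[OF br X z] this]
  show ?thesis using \<sigma> \<alpha> by (simp add: le_divide_eq mult.commute)
qed

text \<open>
  The variational inequality at \<open>z\<close> gives \<open>\<alpha> \<langle>g, z - u\<rangle> \<le> D(u, y) - D(u, z) - D(z, y)\<close>. The remaining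
  term \<open>\<alpha> \<langle>g, y - z\<rangle>\<close> is absorbed by \<open>D(z, y) \<ge> \<sigma>/2 \<parallel>z - y\<parallel>\<^sup>2\<close> on completing the square.
\<close>

lemma mirror_descent_step:
  assumes br: "bregman_assumption U X \<phi> \<sigma>" and X: "compact X" "convex X" and y: "y \<in> X"
    and z: "is_arg_min (\<lambda>u. \<alpha> * (g \<bullet> u) + bregman \<phi> u y) (\<lambda>u. u \<in> X) z" and u: "u \<in> X"
  shows "\<alpha> * (g \<bullet> (y - u)) \<le> bregman \<phi> u y - bregman \<phi> u z + \<alpha>\<^sup>2 * (norm g)\<^sup>2 / (2 * \<sigma>)"
proof -
  have \<sigma>: "0 < \<sigma>" using br by (simp add: bregman_assumption_def)
  have zX: "z \<in> X" using z by (auto simp: is_arg_min_def)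
  have "0 \<le> (grad \<phi> z - (grad \<phi> y - \<alpha> *\<^sub>R g)) \<bullet> (u - z)"
    by (rule mirror_optimality[OF br X(2) mirror_map_step(1)[OF br X z] u])
  then have 1: "\<alpha> * (g \<bullet> (z - u)) \<le> bregman \<phi> u y - bregman \<phi> u z - bregman \<phi> z y"
    by (simp add: bregman_def inner_diff_left inner_diff_right inner_add_left algebra_simps)
  have 2: "\<sigma> / 2 * (norm (z - y))\<^sup>2 \<le> bregman \<phi> z y" by (rule bregman_ge[OF br zX y])
  have "0 \<le> (norm (\<alpha> *\<^sub>R g + \<sigma> *\<^sub>R (z - y)))\<^sup>2" by simp
  also have "\<dots> = \<alpha>\<^sup>2 * (norm g)\<^sup>2 + 2 * \<sigma> * (\<alpha> * (g \<bullet> (z - y))) + \<sigma>\<^sup>2 * (norm (z - y))\<^sup>2"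
    unfolding power2_norm_eq_inner
    by (simp add: inner_add_left inner_add_right inner_diff_left inner_diff_right inner_commute
        power2_eq_square algebra_simps)
  also have "\<dots> = 2 * \<sigma> * (\<alpha>\<^sup>2 * (norm g)\<^sup>2 / (2 * \<sigma>) + \<alpha> * (g \<bullet> (z - y)) + \<sigma> / 2 * (norm (z - y))\<^sup>2)"
    using \<sigma> by (simp add: power2_eq_square field_simps)
  finally have 3: "0 \<le> \<alpha>\<^sup>2 * (norm g)\<^sup>2 / (2 * \<sigma>) + \<alpha> * (g \<bullet> (z - y)) + \<sigma> / 2 * (norm (z - y))\<^sup>2"
    using \<sigma> by (simp add: zero_le_mult_iff)
  have "\<alpha> * (g \<bullet> (y - u)) = \<alpha> * (g \<bullet> (z - u)) - \<alpha> * (g \<bullet> (z - y))"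
    by (simp add: inner_diff_right algebra_simps)
  then show ?thesis using 1 2 3 by linarith
qed

section \<open>Gaussian moments and smoothing\<close>

definition std_gauss :: "(real ^ 'n) measure" where
  "std_gauss = density lborel (\<lambda>z. ennreal (\<Prod>k\<in>UNIV. std_normal_density (z $ k)))"

lemma space_std_gauss [simp]: "space std_gauss = UNIV"
  and sets_std_gauss [simp, measurable_cong]: "sets std_gauss = sets borel"
  by (simp_all add: std_gauss_def)

lemma std_gaussian_distr:
  assumes "std_gaussian M \<xi>"
  shows "distr M borel \<xi> = std_gauss" and "\<xi> \<in> borel_measurable M"
  using assms distributed_distr_eq_density[of M lborel \<xi>] distributed_measurable[of M lborel \<xi>]
  by (auto simp: std_gaussian_def std_gauss_def cong: distr_cong)

text \<open>
  The coordinates are independent standard normal variables. Every Gaussian moment below is an instance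
  of this formula.
\<close>

lemma nn_integral_std_gauss_prod:
  fixes h :: "'n::finite \<Rightarrow> real \<Rightarrow> ennreal"
  assumes [measurable]: "\<And>k. h k \<in> borel_measurable borel"
  shows "(\<integral>\<^sup>+z. (\<Prod>k\<in>UNIV. h k (z $ k)) \<partial>std_gauss)
    = (\<Prod>k\<in>UNIV. \<integral>\<^sup>+x. ennreal (std_normal_density x) * h k x \<partial>lborel)"
proof -
  define idx where "idx = inv (\<lambda>k::'n. axis k (1::real))"
  have inj: "inj (\<lambda>k::'n. axis k (1::real))" by (auto simp: inj_on_def axis_eq_axis)
  have idx: "idx (axis k 1) = k" for k unfolding idx_def by (rule inv_f_f[OF inj])
  have basis: "(Basis :: (real ^ 'n) set) = range (\<lambda>k. axis k 1)"
    by (auto simp: Basis_vec_def)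
  have reindex: "(\<Prod>b\<in>(Basis :: (real ^ 'n) set). c b) = (\<Prod>k\<in>UNIV. c (axis k 1))" for c :: "real ^ 'n \<Rightarrow> ennreal"
    unfolding basis by (subst prod.reindex[OF inj]) simp
  have "(\<integral>\<^sup>+z. (\<Prod>k\<in>UNIV. h k (z $ k)) \<partial>std_gauss)
      = (\<integral>\<^sup>+z. ennreal (\<Prod>k\<in>UNIV. std_normal_density (z $ k)) * (\<Prod>k\<in>UNIV. h k (z $ k)) \<partial>lborel)"
    unfolding std_gauss_def by (subst nn_integral_density) auto
  also have "\<dots> = (\<integral>\<^sup>+z. (\<Prod>k\<in>UNIV. ennreal (std_normal_density (z $ k)) * h k (z $ k)) \<partial>lborel)"
    by (simp add: prod.distrib prod_ennreal)
  also have "\<dots> = (\<integral>\<^sup>+z. (\<Prod>b\<in>Basis. ennreal (std_normal_density (z \<bullet> b)) * h (idx b) (z \<bullet> b)) \<partial>lborel)"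
    by (simp add: reindex idx cart_eq_inner_axis)
  also have "\<dots> = (\<Prod>b\<in>(Basis :: (real ^ 'n) set). \<integral>\<^sup>+x. ennreal (std_normal_density x) * h (idx b) x \<partial>lborel)"
    by (rule nn_integral_lborel_prod) auto
  also have "\<dots> = (\<Prod>k\<in>UNIV. \<integral>\<^sup>+x. ennreal (std_normal_density x) * h k x \<partial>lborel)"
    by (simp add: reindex idx)
  finally show ?thesis .
qed

lemma nn_integral_std_normal_moments:
  "(\<integral>\<^sup>+x. ennreal (std_normal_density x) \<partial>lborel) = 1"
  "(\<integral>\<^sup>+x. ennreal (std_normal_density x) * ennreal (x\<^sup>2) \<partial>lborel) = 1"
  "(\<integral>\<^sup>+x. ennreal (std_normal_density x) * ennreal (x ^ 4) \<partial>lborel) = 3"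
proof -
  have *: "(\<integral>\<^sup>+x. ennreal (std_normal_density x) * ennreal (x ^ (2 * k)) \<partial>lborel)
      = ennreal (fact (2 * k) / (2 ^ k * fact k))" for k
    using nn_integral_eq_integral[of lborel "\<lambda>x. std_normal_density x * x ^ (2 * k)"]
      std_normal_moment_even[of k] integral_std_normal_moment_even[of k]
    by (auto simp: ennreal_mult has_bochner_integral_iff)
  show "(\<integral>\<^sup>+x. ennreal (std_normal_density x) \<partial>lborel) = 1" using *[of 0] by simp
  show "(\<integral>\<^sup>+x. ennreal (std_normal_density x) * ennreal (x\<^sup>2) \<partial>lborel) = 1" using *[of 1] by simp
  show "(\<integral>\<^sup>+x. ennreal (std_normal_density x) * ennreal (x ^ 4) \<partial>lborel) = 3"
    using *[of 2] by (simp add: fact_numeral)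
qed

lemma prob_space_std_gauss: "prob_space (std_gauss :: (real ^ 'n) measure)"
proof
  have "emeasure (std_gauss :: (real ^ 'n) measure) UNIV = (\<integral>\<^sup>+z. (\<Prod>k\<in>(UNIV :: 'n set). (\<lambda>_ _. 1) k (z $ k)) \<partial>std_gauss)"
    by (simp add: nn_integral_const)
  also have "\<dots> = 1" by (subst nn_integral_std_gauss_prod) (simp_all add: nn_integral_std_normal_moments)
  finally show "emeasure (std_gauss :: (real ^ 'n) measure) (space std_gauss) = 1" by simp
qed

lemma measure_std_gauss_UNIV [simp]: "measure (std_gauss :: (real ^ 'n) measure) UNIV = 1"
  using prob_space.prob_space[OF prob_space_std_gauss] by simp

lemma std_gauss_fourth_moments:
  "has_bochner_integral std_gauss (\<lambda>z :: real ^ 'n. (z $ k)\<^sup>2 * (z $ l)\<^sup>2) (if k = l then 3 else 1)"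
proof (rule has_bochner_integral_nn_integral)
  let ?h = "\<lambda>j x. ennreal ((if j = k then x\<^sup>2 else 1) * (if j = l then x\<^sup>2 else 1))"
  have "(\<integral>\<^sup>+z. ennreal ((z $ k)\<^sup>2 * (z $ l)\<^sup>2) \<partial>(std_gauss :: (real ^ 'n) measure))
      = (\<integral>\<^sup>+z. (\<Prod>j\<in>UNIV. ?h j (z $ j)) \<partial>std_gauss)"
    by (simp add: prod_ennreal prod.distrib prod.delta ennreal_mult)
  also have "\<dots> = (\<Prod>j\<in>UNIV. \<integral>\<^sup>+x. ennreal (std_normal_density x) * ?h j x \<partial>lborel)"
    by (rule nn_integral_std_gauss_prod) auto
  also have "\<dots> = (\<Prod>j\<in>UNIV. if j = k \<and> k = l then 3 else 1)"
  proof (rule prod.cong[OF refl])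
    fix j
    have "x\<^sup>2 * x\<^sup>2 = x ^ 4" for x :: real by (simp flip: power_add)
    then show "(\<integral>\<^sup>+x. ennreal (std_normal_density x) * ?h j x \<partial>lborel) = (if j = k \<and> k = l then 3 else 1)"
      by (cases "j = k"; cases "j = l") (auto simp: nn_integral_std_normal_moments)
  qed
  also have "\<dots> = ennreal (if k = l then 3 else 1)" by (cases "k = l") (auto simp: prod.delta)
  finally show "(\<integral>\<^sup>+z. ennreal ((z $ k)\<^sup>2 * (z $ l)\<^sup>2) \<partial>(std_gauss :: (real ^ 'n) measure)) = ennreal (if k = l then 3 else 1)" .
qed auto

lemma std_gauss_second_moments:
  "has_bochner_integral std_gauss (\<lambda>z :: real ^ 'n. (z $ k)\<^sup>2) 1"
proof (rule has_bochner_integral_nn_integral)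
  let ?h = "\<lambda>j x. ennreal (if j = k then x\<^sup>2 else 1)"
  have "(\<integral>\<^sup>+z. ennreal ((z $ k)\<^sup>2) \<partial>(std_gauss :: (real ^ 'n) measure))
      = (\<integral>\<^sup>+z. (\<Prod>j\<in>UNIV. ?h j (z $ j)) \<partial>std_gauss)"
    by (simp add: prod_ennreal prod.delta)
  also have "\<dots> = (\<Prod>j\<in>UNIV. \<integral>\<^sup>+x. ennreal (std_normal_density x) * ?h j x \<partial>lborel)"
    by (rule nn_integral_std_gauss_prod) auto
  also have "\<dots> = (\<Prod>j\<in>(UNIV :: 'n set). 1)"
  proof (rule prod.cong[OF refl])
    fix j show "(\<integral>\<^sup>+x. ennreal (std_normal_density x) * ?h j x \<partial>lborel) = 1"
      by (cases "j = k") (simp_all add: nn_integral_std_normal_moments)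
  qed
  finally show "(\<integral>\<^sup>+z. ennreal ((z $ k)\<^sup>2) \<partial>(std_gauss :: (real ^ 'n) measure)) = ennreal 1" by simp
qed auto

lemma norm_power2_vec: "(norm (z :: real ^ 'n))\<^sup>2 = (\<Sum>k\<in>UNIV. (z $ k)\<^sup>2)"
  by (simp add: norm_vec_def L2_set_def sum_nonneg)

lemma std_gauss_norm_power2:
  "has_bochner_integral std_gauss (\<lambda>z :: real ^ 'n. (norm z)\<^sup>2) (real CARD('n))"
proof -
  have "has_bochner_integral std_gauss (\<lambda>z :: real ^ 'n. \<Sum>k\<in>UNIV. (z $ k)\<^sup>2) (\<Sum>k\<in>(UNIV :: 'n set). 1)"
    by (intro has_bochner_integral_sum std_gauss_second_moments)
  then show ?thesis by (simp add: norm_power2_vec)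
qed

lemma std_gauss_norm_power4:
  "has_bochner_integral std_gauss (\<lambda>z :: real ^ 'n. norm z ^ 4) (real CARD('n) * (real CARD('n) + 2))"
proof -
  have eq: "norm z ^ 4 = (\<Sum>k\<in>UNIV. \<Sum>l\<in>UNIV. (z $ k)\<^sup>2 * (z $ l)\<^sup>2)" for z :: "real ^ 'n"
  proof -
    have "norm z ^ 4 = (norm z)\<^sup>2 * (norm z)\<^sup>2" by (simp flip: power_add)
    then show ?thesis by (simp add: norm_power2_vec sum_product)
  qed
  have "(\<Sum>k\<in>(UNIV :: 'n set). \<Sum>l\<in>UNIV. if k = l then 3 else 1 :: real) = real CARD('n) * (real CARD('n) + 2)"
  proof -
    have "(\<Sum>l\<in>UNIV. if k = l then 3 else 1 :: real) = real CARD('n) + 2" for k :: 'n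
    proof -
      have "(\<Sum>l\<in>UNIV. if k = l then 3 else 1 :: real) = (\<Sum>l\<in>UNIV. 1 + (if k = l then 2 else 0))"
        by (intro sum.cong) auto
      then show ?thesis by (simp add: sum.distrib)
    qed
    then show ?thesis by simp
  qed
  moreover have "has_bochner_integral std_gauss (\<lambda>z :: real ^ 'n. \<Sum>k\<in>UNIV. \<Sum>l\<in>UNIV. (z $ k)\<^sup>2 * (z $ l)\<^sup>2)
      (\<Sum>k\<in>(UNIV :: 'n set). \<Sum>l\<in>UNIV. if k = l then 3 else 1)"
    by (intro has_bochner_integral_sum std_gauss_fourth_moments)
  ultimately show ?thesis by (simp add: eq)
qed

text \<open>
  Integrate the inequality \<open>\<parallel>z\<parallel> \<le> \<parallel>z\<parallel>\<^sup>2 / (2 \<surd>n) + \<surd>n / 2\<close>, which is sharp at \<open>\<parallel>z\<parallel> = \<surd>n\<close>.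
\<close>

lemma std_gauss_norm_le: "(\<integral>z. norm z \<partial>(std_gauss :: (real ^ 'n) measure)) \<le> sqrt (real CARD('n))"
proof -
  interpret prob_space "std_gauss :: (real ^ 'n) measure" by (rule prob_space_std_gauss)
  let ?n = "real CARD('n)"
  have n: "0 < sqrt ?n" by simp
  have "(\<integral>z. norm z \<partial>(std_gauss :: (real ^ 'n) measure)) \<le> (\<integral>z. (norm z)\<^sup>2 / (2 * sqrt ?n) + sqrt ?n / 2 \<partial>(std_gauss :: (real ^ 'n) measure))"
  proof (rule integral_mono_AE')
    show "integrable std_gauss (\<lambda>z :: real ^ 'n. (norm z)\<^sup>2 / (2 * sqrt ?n) + sqrt ?n / 2)"
      using std_gauss_norm_power2[where 'n='n] by (auto simp: has_bochner_integral_iff)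
    show "AE z in (std_gauss :: (real ^ 'n) measure). norm z \<le> (norm z)\<^sup>2 / (2 * sqrt ?n) + sqrt ?n / 2"
    proof (rule AE_I2)
      fix z :: "real ^ 'n"
      have "0 \<le> (norm z - sqrt ?n)\<^sup>2" by simp
      then have "2 * sqrt ?n * norm z \<le> (norm z)\<^sup>2 + sqrt ?n * sqrt ?n"
        by (simp add: power2_diff power2_eq_square algebra_simps)
      then show "norm z \<le> (norm z)\<^sup>2 / (2 * sqrt ?n) + sqrt ?n / 2"
        using n by (simp add: field_simps)
    qed
  qed auto
  also have "\<dots> = ?n / (2 * sqrt ?n) + sqrt ?n / 2"
    using std_gauss_norm_power2[where 'n='n] by (simp add: has_bochner_integral_iff)
  also have "\<dots> = sqrt ?n" using n by (simp add: field_simps)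
  finally show ?thesis .
qed

lemma integrable_std_gauss_quadratic:
  fixes h :: "real ^ 'n \<Rightarrow> real"
  assumes [measurable]: "h \<in> borel_measurable borel" and h: "\<And>z. \<bar>h z\<bar> \<le> A + C * (norm z)\<^sup>2"
  shows "integrable std_gauss h"
proof (rule Bochner_Integration.integrable_bound)
  interpret prob_space "std_gauss :: (real ^ 'n) measure" by (rule prob_space_std_gauss)
  show "integrable std_gauss (\<lambda>z :: real ^ 'n. A + C * (norm z)\<^sup>2)"
    using std_gauss_norm_power2[where 'n='n] by (auto simp: has_bochner_integral_iff)
  show "AE z in std_gauss. norm (h z) \<le> norm (A + C * (norm z)\<^sup>2)"
    using h by (intro AE_I2) (metis abs_ge_self order_trans real_norm_def)
qed auto

lemma integrable_std_gauss_linear: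
  fixes h :: "real ^ 'n \<Rightarrow> real"
  assumes "h \<in> borel_measurable borel" "0 \<le> C" and h: "\<And>z. \<bar>h z\<bar> \<le> A + C * norm z"
  shows "integrable std_gauss h" "integrable std_gauss (\<lambda>z. h z * (a \<bullet> z))"
proof -
  have n1: "norm z \<le> 1 + (norm z)\<^sup>2" for z :: "real ^ 'n"
  proof -
    have "0 \<le> (norm z - 1)\<^sup>2" by simp
    then have "2 * norm z \<le> 1 + (norm z)\<^sup>2" by (simp add: power2_diff)
    then show ?thesis using norm_ge_zero[of z] by linarith
  qed
  show "integrable std_gauss h"
  proof (rule integrable_std_gauss_quadratic)
    fix z show "\<bar>h z\<bar> \<le> (A + C) + C * (norm z)\<^sup>2"
      using h[of z] mult_left_mono[OF n1[of z] assms(2)] by (simp add: algebra_simps)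
  qed fact
  have A: "0 \<le> A" using h[of 0] by simp
  show "integrable std_gauss (\<lambda>z. h z * (a \<bullet> z))"
  proof (rule integrable_std_gauss_quadratic)
    show "(\<lambda>z. h z * (a \<bullet> z)) \<in> borel_measurable borel" using assms(1) by measurable
    fix z
    have "\<bar>h z * (a \<bullet> z)\<bar> \<le> (A + C * norm z) * (norm a * norm z)"
      unfolding abs_mult using h Cauchy_Schwarz_ineq2[of a z] assms(2) A
      by (intro mult_mono) auto
    also have "\<dots> = A * norm a * norm z + C * norm a * (norm z)\<^sup>2"
      by (simp add: algebra_simps power2_eq_square)
    also have "\<dots> \<le> A * norm a * (1 + (norm z)\<^sup>2) + C * norm a * (norm z)\<^sup>2"
      using n1 A by (intro add_right_mono mult_left_mono) auto
    finally show "\<bar>h z * (a \<bullet> z)\<bar> \<le> A * norm a + (A * norm a + C * norm a) * (norm z)\<^sup>2"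
      by (simp add: algebra_simps)
  qed
qed

text \<open>
  The Cameron-Martin formula.
\<close>

lemma std_gauss_density_shift:
  "(\<Prod>k\<in>UNIV. std_normal_density ((z - a) $ k))
    = (\<Prod>k\<in>UNIV. std_normal_density (z $ k)) * exp (a \<bullet> z - (a \<bullet> a) / 2)" for a z :: "real ^ 'n"
proof -
  have "std_normal_density ((z - a) $ k) = std_normal_density (z $ k) * exp (a $ k * z $ k - (a $ k * a $ k) / 2)" for k
    by (simp add: std_normal_density_def power2_eq_square field_simps flip: exp_add)
  then have "(\<Prod>k\<in>UNIV. std_normal_density ((z - a) $ k)) = (\<Prod>k\<in>UNIV. std_normal_density (z $ k))
      * (\<Prod>k\<in>UNIV. exp (a $ k * z $ k - (a $ k * a $ k) / 2))"
    by (simp only: prod.distrib)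
  also have "(\<Prod>k\<in>UNIV. exp (a $ k * z $ k - (a $ k * a $ k) / 2)) = exp (\<Sum>k\<in>UNIV. a $ k * z $ k - (a $ k * a $ k) / 2)"
    by (simp add: exp_sum)
  also have "(\<Sum>k\<in>UNIV. a $ k * z $ k - (a $ k * a $ k) / 2) = a \<bullet> z - (a \<bullet> a) / 2"
    by (simp add: inner_vec_def sum_subtractf sum_divide_distrib)
  finally show ?thesis .
qed

lemma nn_integral_std_gauss_shift:
  fixes F :: "real ^ 'n \<Rightarrow> ennreal"
  assumes [measurable]: "F \<in> borel_measurable borel"
  shows "(\<integral>\<^sup>+z. F (z + a) \<partial>std_gauss) = (\<integral>\<^sup>+z. F z * ennreal (exp (a \<bullet> z - (a \<bullet> a) / 2)) \<partial>std_gauss)"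
proof -
  let ?p = "\<lambda>z :: real ^ 'n. \<Prod>k\<in>UNIV. std_normal_density (z $ k)"
  have "(\<integral>\<^sup>+z. F (z + a) \<partial>std_gauss) = (\<integral>\<^sup>+z. ennreal (?p z) * F (z + a) \<partial>lborel)"
    unfolding std_gauss_def by (rule nn_integral_density) auto
  also have "\<dots> = (\<integral>\<^sup>+z. ennreal (?p (a + z - a)) * F (a + z) \<partial>lborel)"
    by (simp add: add.commute)
  also have "\<dots> = (\<integral>\<^sup>+z. ennreal (?p (z - a)) * F z \<partial>distr lborel borel ((+) a))"
    by (rule nn_integral_distr[symmetric]) auto
  also have "distr lborel borel ((+) a) = (lborel :: (real ^ 'n) measure)" by (rule lborel_distr_plus)
  also have "(\<integral>\<^sup>+z. ennreal (?p (z - a)) * F z \<partial>lborel)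
      = (\<integral>\<^sup>+z. ennreal (?p z) * (F z * ennreal (exp (a \<bullet> z - (a \<bullet> a) / 2))) \<partial>lborel)"
    unfolding std_gauss_density_shift
    by (intro nn_integral_cong) (simp add: ennreal_mult prod_nonneg mult_ac)
  also have "\<dots> = (\<integral>\<^sup>+z. F z * ennreal (exp (a \<bullet> z - (a \<bullet> a) / 2)) \<partial>std_gauss)"
    unfolding std_gauss_def by (rule nn_integral_density[symmetric]) auto
  finally show ?thesis .
qed

lemma integral_std_gauss_shift:
  fixes F :: "real ^ 'n \<Rightarrow> real"
  assumes F[measurable]: "F \<in> borel_measurable borel" and nn: "\<And>z. 0 \<le> F z"
    and int: "integrable std_gauss (\<lambda>z. F (z + a))"
  shows "has_bochner_integral std_gauss (\<lambda>z. F z * exp (a \<bullet> z - (a \<bullet> a) / 2)) (\<integral>z. F (z + a) \<partial>std_gauss)"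
proof (rule has_bochner_integral_nn_integral)
  have "(\<integral>\<^sup>+z. ennreal (F z * exp (a \<bullet> z - (a \<bullet> a) / 2)) \<partial>std_gauss)
      = (\<integral>\<^sup>+z. ennreal (F z) * ennreal (exp (a \<bullet> z - (a \<bullet> a) / 2)) \<partial>std_gauss)"
    by (simp add: ennreal_mult nn)
  also have "\<dots> = (\<integral>\<^sup>+z. ennreal (F (z + a)) \<partial>std_gauss)"
    by (rule nn_integral_std_gauss_shift[symmetric]) simp
  also have "\<dots> = ennreal (\<integral>z. F (z + a) \<partial>std_gauss)"
    using int nn by (intro nn_integral_eq_integral) auto
  finally show "(\<integral>\<^sup>+z. ennreal (F z * exp (a \<bullet> z - (a \<bullet> a) / 2)) \<partial>std_gauss) = ennreal (\<integral>z. F (z + a) \<partial>std_gauss)" .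
qed (auto simp: nn intro!: integral_nonneg)

lemma std_gauss_uminus: "distr std_gauss borel uminus = (std_gauss :: (real ^ 'n) measure)"
proof -
  have "(lborel :: (real ^ 'n) measure) = density (distr lborel borel (\<lambda>x. 0 + (-1) *\<^sub>R x)) (\<lambda>_. ennreal (\<bar>-1\<bar> ^ DIM(real ^ 'n)))"
    by (rule lborel_affine) simp
  then have "distr lborel borel uminus = (lborel :: (real ^ 'n) measure)"
    by (simp add: density_1 flip: one_ennreal_def cong: distr_cong)
  then have "std_gauss = density (distr lborel borel uminus) (\<lambda>z :: real ^ 'n. ennreal (\<Prod>k\<in>UNIV. std_normal_density (z $ k)))"
    by (simp add: std_gauss_def)
  also have "\<dots> = distr (density lborel (\<lambda>z. ennreal (\<Prod>k\<in>UNIV. std_normal_density ((- z) $ k)))) borel uminus"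
    by (rule density_distr) auto
  also have "\<dots> = distr std_gauss borel uminus"
    by (simp add: std_gauss_def std_normal_density_def)
  finally show ?thesis by (rule sym)
qed

lemma integral_std_gauss_uminus:
  fixes F :: "real ^ 'n \<Rightarrow> real"
  assumes "F \<in> borel_measurable borel"
  shows "(\<integral>z. F (- z) \<partial>std_gauss) = (\<integral>z. F z \<partial>std_gauss)"
  using integral_distr[of uminus std_gauss borel F] assms by (simp add: std_gauss_uminus)

lemma integral_std_gauss_inner: "(\<integral>z. a \<bullet> z \<partial>(std_gauss :: (real ^ 'n) measure)) = 0"
  using integral_std_gauss_uminus[of "\<lambda>z. a \<bullet> z"] by simp

text \<open>
  By symmetry of the law, \<open>F\<close> may be replaced by the mean of \<open>F z\<close> and \<open>F (- z)\<close>, which is at least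
  \<open>F 0\<close> pointwise.
\<close>

lemma std_gauss_jensen:
  fixes F :: "real ^ 'n \<Rightarrow> real"
  assumes F[measurable]: "F \<in> borel_measurable borel" and int: "integrable std_gauss F" and conv: "convex_on UNIV F"
  shows "F 0 \<le> (\<integral>z. F z \<partial>std_gauss)"
proof -
  interpret prob_space "std_gauss :: (real ^ 'n) measure" by (rule prob_space_std_gauss)
  have int': "integrable std_gauss (\<lambda>z. F (- z))"
    using integrable_distr[of uminus std_gauss borel F] int by (simp add: std_gauss_uminus)
  have "F 0 = (\<integral>z. F 0 \<partial>(std_gauss :: (real ^ 'n) measure))" by simp
  also have "\<dots> \<le> (\<integral>z. (F z + F (- z)) / 2 \<partial>std_gauss)"
  proof (rule integral_mono)
    fix z
    have "F ((1 - 1/2) *\<^sub>R z + (1/2) *\<^sub>R (- z)) \<le> (1 - 1/2) * F z + (1/2) * F (- z)"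
      by (rule convex_onD[OF conv]) auto
    then show "F 0 \<le> (F z + F (- z)) / 2" by simp
  qed (use int int' in auto)
  also have "\<dots> = (\<integral>z. F z \<partial>std_gauss)"
    using int int' by (simp add: integral_std_gauss_uminus)
  finally show ?thesis .
qed

text \<open>
  The left-hand side is the derivative at \<open>s = 0\<close> of the convex function \<open>s \<mapsto> E F(z + s a)\<close>, so the
  increment over \<open>[0, 1]\<close> dominates it. Rather than differentiating, write \<open>E F(z + s a)\<close> with the
  translated density and use \<open>exp r \<ge> 1 + r\<close>, which preserves the inequality because \<open>F\<close> is
  nonnegative; the error is of second order in \<open>s\<close>.
\<close>

lemma gaussian_gradient_inequality_nonneg:
  fixes F :: "real ^ 'n \<Rightarrow> real"
  assumes F[measurable]: "F \<in> borel_measurable borel" and conv: "convex_on UNIV F"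
    and nn: "\<And>z. 0 \<le> F z" and C: "0 \<le> C" and gr: "\<And>z. F z \<le> A + C * norm z"
  shows "(\<integral>z. F z * (a \<bullet> z) \<partial>std_gauss) \<le> (\<integral>z. F (z + a) - F z \<partial>std_gauss)"
proof -
  have int_shift: "integrable std_gauss (\<lambda>z. F (z + b))" for b
  proof (rule integrable_std_gauss_linear(1))
    fix z
    have "F (z + b) \<le> A + C * (norm z + norm b)"
      using gr[of "z + b"] mult_left_mono[OF norm_triangle_ineq[of z b] C] by simp
    then show "\<bar>F (z + b)\<bar> \<le> (A + C * norm b) + C * norm z" using nn by (simp add: algebra_simps)
  qed (use C in auto)
  have int: "integrable std_gauss F" using int_shift[of 0] by simp
  have int_a: "integrable std_gauss (\<lambda>z. F z * (a \<bullet> z))"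
    by (rule integrable_std_gauss_linear(2)[OF F C]) (use nn gr in auto)
  let ?I = "\<integral>z. F (z + a) - F z \<partial>std_gauss" and ?J = "\<integral>z. F z * (a \<bullet> z) \<partial>std_gauss"
  let ?C = "(a \<bullet> a) / 2 * (\<integral>z. F z \<partial>std_gauss)"
  have key: "?J - s * ?C \<le> ?I" if s: "0 < s" "s \<le> 1" for s
  proof -
    have shift: "has_bochner_integral std_gauss (\<lambda>z. F z * exp ((s *\<^sub>R a) \<bullet> z - ((s *\<^sub>R a) \<bullet> (s *\<^sub>R a)) / 2))
        (\<integral>z. F (z + s *\<^sub>R a) \<partial>std_gauss)"
      by (rule integral_std_gauss_shift[OF F nn int_shift])
    have "s * ?J - s\<^sup>2 * ?C + (\<integral>z. F z \<partial>std_gauss)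
        = (\<integral>z. F z * (1 + (s * (a \<bullet> z) - s\<^sup>2 * (a \<bullet> a) / 2)) \<partial>std_gauss)"
      using int int_a by (simp add: algebra_simps)
    also have "\<dots> \<le> (\<integral>z. F z * exp ((s *\<^sub>R a) \<bullet> z - ((s *\<^sub>R a) \<bullet> (s *\<^sub>R a)) / 2) \<partial>std_gauss)"
    proof (rule integral_mono)
      show "integrable std_gauss (\<lambda>z. F z * (1 + (s * (a \<bullet> z) - s\<^sup>2 * (a \<bullet> a) / 2)))"
        using int int_a by (simp add: algebra_simps)
      show "integrable std_gauss (\<lambda>z. F z * exp ((s *\<^sub>R a) \<bullet> z - ((s *\<^sub>R a) \<bullet> (s *\<^sub>R a)) / 2))"
        using shift by (simp add: has_bochner_integral_iff)
      fix z
      have "(s *\<^sub>R a) \<bullet> z - ((s *\<^sub>R a) \<bullet> (s *\<^sub>R a)) / 2 = s * (a \<bullet> z) - s\<^sup>2 * (a \<bullet> a) / 2"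
        by (simp add: power2_eq_square)
      then show "F z * (1 + (s * (a \<bullet> z) - s\<^sup>2 * (a \<bullet> a) / 2)) \<le> F z * exp ((s *\<^sub>R a) \<bullet> z - ((s *\<^sub>R a) \<bullet> (s *\<^sub>R a)) / 2)"
        by (simp only:) (intro mult_left_mono nn exp_ge_add_one_self)
    qed
    also have "\<dots> = (\<integral>z. F (z + s *\<^sub>R a) \<partial>std_gauss)" using shift by (simp add: has_bochner_integral_iff)
    also have "\<dots> \<le> (\<integral>z. s * (F (z + a) - F z) + F z \<partial>std_gauss)"
    proof (rule integral_mono)
      fix z
      have "F ((1 - s) *\<^sub>R z + s *\<^sub>R (z + a)) \<le> (1 - s) * F z + s * F (z + a)"
        by (rule convex_onD[OF conv]) (use s in auto)
      moreover have "(1 - s) *\<^sub>R z + s *\<^sub>R (z + a) = z + s *\<^sub>R a" by (simp add: algebra_simps)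
      ultimately show "F (z + s *\<^sub>R a) \<le> s * (F (z + a) - F z) + F z" by (simp add: algebra_simps)
    qed (use int int_shift in auto)
    also have "\<dots> = s * ?I + (\<integral>z. F z \<partial>std_gauss)" using int int_shift by simp
    finally have "s * (?J - s * ?C) \<le> s * ?I" by (simp add: power2_eq_square algebra_simps)
    then show ?thesis using s by simp
  qed
  have "(\<lambda>m. ?J - inverse (real (Suc m)) * ?C) \<longlonglongrightarrow> ?J - 0 * ?C"
    by (intro tendsto_intros LIMSEQ_inverse_real_of_nat)
  moreover have "?J - inverse (real (Suc m)) * ?C \<le> ?I" for m
    by (rule key) (auto simp: inverse_le_1_iff)
  ultimately show ?thesis by (intro LIMSEQ_le_const2[of _ ?J]) auto
qed

text \<open>
  Both sides are unchanged when a constant is added to \<open>F\<close>, so the nonnegative case applies to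
  \<open>max F (- m) + m\<close>; the growth of \<open>F\<close> allows dominated convergence as \<open>m \<rightarrow> \<infinity>\<close>.
\<close>

lemma gaussian_gradient_inequality:
  fixes F :: "real ^ 'n \<Rightarrow> real"
  assumes F[measurable]: "F \<in> borel_measurable borel" and conv: "convex_on UNIV F"
    and C: "0 \<le> C" and gr: "\<And>z. \<bar>F z\<bar> \<le> A + C * norm z"
  shows "(\<integral>z. F z * (a \<bullet> z) \<partial>std_gauss) \<le> (\<integral>z. F (z + a) - F z \<partial>std_gauss)"
proof (rule LIMSEQ_le)
  let ?T = "\<lambda>m z. max (F z) (- real m)"
  have gr_shift: "\<bar>F (z + b)\<bar> \<le> (A + C * norm b) + C * norm z" for z b
    using gr[of "z + b"] mult_left_mono[OF norm_triangle_ineq[of z b] C] by (simp add: algebra_simps)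
  have T_le: "\<bar>?T m z\<bar> \<le> \<bar>F z\<bar>" for m z by auto
  have int_T: "integrable std_gauss (\<lambda>z. ?T m (z + b))" for m b
    by (rule integrable_std_gauss_linear(1)[OF _ C order_trans[OF T_le gr_shift]]) auto
  have int_Ta: "integrable std_gauss (\<lambda>z. ?T m z * (a \<bullet> z))" for m
    by (rule integrable_std_gauss_linear(2)[OF _ C order_trans[OF T_le gr]]) auto
  have int_a: "integrable std_gauss (\<lambda>z. 1 * (a \<bullet> z))"
    by (rule integrable_std_gauss_linear(2)[where A = 1 and C = 0]) auto
  have int_F: "integrable std_gauss (\<lambda>z. F (z + b))" for b
    by (rule integrable_std_gauss_linear(1)[OF _ C gr_shift]) auto
  have int_Fa: "integrable std_gauss (\<lambda>z. F z * (a \<bullet> z))"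
    by (rule integrable_std_gauss_linear(2)[OF _ C gr]) auto
  have ev: "\<forall>\<^sub>F m in sequentially. ?T m z = F z" for z
  proof -
    obtain m0 :: nat where "- F z \<le> real m0" using real_arch_simple by blast
    then show ?thesis by (intro eventually_sequentiallyI[of m0]) (auto simp: max_def)
  qed
  show "(\<lambda>m. \<integral>z. ?T m z * (a \<bullet> z) \<partial>std_gauss) \<longlonglongrightarrow> (\<integral>z. F z * (a \<bullet> z) \<partial>std_gauss)"
  proof (rule integral_dominated_convergence[where w = "\<lambda>z. \<bar>F z * (a \<bullet> z)\<bar>"])
    show "AE z in std_gauss. (\<lambda>m. ?T m z * (a \<bullet> z)) \<longlonglongrightarrow> F z * (a \<bullet> z)"
      by (intro AE_I2 tendsto_mult tendsto_const tendsto_eventually ev)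
    show "AE z in std_gauss. norm (?T m z * (a \<bullet> z)) \<le> \<bar>F z * (a \<bullet> z)\<bar>" for m
      using T_le by (auto simp: abs_mult intro!: mult_right_mono)
  qed (use int_Fa in auto)
  show "(\<lambda>m. \<integral>z. ?T m (z + a) - ?T m z \<partial>std_gauss) \<longlonglongrightarrow> (\<integral>z. F (z + a) - F z \<partial>std_gauss)"
  proof (rule integral_dominated_convergence[where w = "\<lambda>z. \<bar>F (z + a)\<bar> + \<bar>F z\<bar>"])
    show "AE z in std_gauss. (\<lambda>m. ?T m (z + a) - ?T m z) \<longlonglongrightarrow> F (z + a) - F z"
      by (intro AE_I2 tendsto_diff tendsto_eventually ev)
    show "AE z in std_gauss. norm (?T m (z + a) - ?T m z) \<le> \<bar>F (z + a)\<bar> + \<bar>F z\<bar>" for m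
      by (intro AE_I2) auto
    show "integrable std_gauss (\<lambda>z. \<bar>F (z + a)\<bar> + \<bar>F z\<bar>)"
      using int_F[of a] int_F[of 0] by auto
  qed auto
  show "\<exists>m0. \<forall>m\<ge>m0. (\<integral>z. ?T m z * (a \<bullet> z) \<partial>std_gauss) \<le> (\<integral>z. ?T m (z + a) - ?T m z \<partial>std_gauss)"
  proof (intro exI allI impI)
    fix m :: nat
    let ?S = "\<lambda>z. ?T m z + real m"
    have "(\<integral>z. ?T m z * (a \<bullet> z) \<partial>std_gauss) = (\<integral>z. ?S z * (a \<bullet> z) \<partial>std_gauss)"
      using int_Ta[of m] int_a by (simp add: distrib_right integral_std_gauss_inner)
    also have "\<dots> \<le> (\<integral>z. ?S (z + a) - ?S z \<partial>std_gauss)"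
    proof (rule gaussian_gradient_inequality_nonneg)
      show "convex_on UNIV ?S"
      proof (rule convex_onI)
        fix t :: real and x y :: "real ^ 'n" assume t: "0 < t" "t < 1"
        have "F ((1 - t) *\<^sub>R x + t *\<^sub>R y) \<le> (1 - t) * F x + t * F y"
          by (rule convex_onD[OF conv]) (use t in auto)
        also have "\<dots> \<le> (1 - t) * ?T m x + t * ?T m y"
          using t by (intro add_mono mult_left_mono) auto
        finally have 1: "F ((1 - t) *\<^sub>R x + t *\<^sub>R y) \<le> (1 - t) * ?T m x + t * ?T m y" .
        have "(1 - t) * (- real m) + t * (- real m) \<le> (1 - t) * ?T m x + t * ?T m y"
          using t by (intro add_mono mult_left_mono) auto
        then have "- real m \<le> (1 - t) * ?T m x + t * ?T m y" by (simp add: algebra_simps)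
        with 1 have "?T m ((1 - t) *\<^sub>R x + t *\<^sub>R y) \<le> (1 - t) * ?T m x + t * ?T m y" by simp
        then show "?S ((1 - t) *\<^sub>R x + t *\<^sub>R y) \<le> (1 - t) * ?S x + t * ?S y"
          by (simp add: algebra_simps)
      qed simp
      show "?S z \<le> (A + real m) + C * norm z" for z using order_trans[OF T_le[of z m] gr[of z]] by linarith
    qed (use C in auto)
    finally show "(\<integral>z. ?T m z * (a \<bullet> z) \<partial>std_gauss) \<le> (\<integral>z. ?T m (z + a) - ?T m z \<partial>std_gauss)" by simp
  qed
qed

text \<open>
  In expectation the oracle is a subgradient at \<open>y\<close> of the smoothed function \<open>v \<mapsto> E f(v + \<mu> z)\<close>, which
  lies between \<open>f\<close> (by Jensen's inequality) and \<open>f + \<mu> L E \<parallel>z\<parallel>\<close>.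
\<close>

lemma oracle_grad_inequality:
  fixes f :: "real ^ 'n \<Rightarrow> real"
  assumes conv: "convex_on UNIV f" and lip: "L-lipschitz_on UNIV f" and \<mu>: "0 < \<mu>"
  shows "f y - f u - \<mu> * L * sqrt (real CARD('n)) \<le> (\<integral>z. oracle_grad f \<mu> y z \<bullet> (y - u) \<partial>std_gauss)"
proof -
  interpret prob_space "std_gauss :: (real ^ 'n) measure" by (rule prob_space_std_gauss)
  have L: "0 \<le> L" using lip by (rule lipschitz_on_nonneg)
  have [measurable]: "f \<in> borel_measurable borel"
    by (intro borel_measurable_continuous_onI lipschitz_on_continuous_on[OF lip])
  let ?F = "\<lambda>y z. f (y + \<mu> *\<^sub>R z)"
  have dev: "\<bar>?F y z - f y\<bar> \<le> L * \<mu> * norm z" for y z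
    using lipschitz_onD[OF lip, of "y + \<mu> *\<^sub>R z" y] \<mu> by (simp add: dist_norm mult.assoc)
  have gr: "\<bar>?F y z\<bar> \<le> \<bar>f y\<bar> + (L * \<mu>) * norm z" for y z
    using dev[of y z] by linarith
  have conv_F: "convex_on UNIV (?F y)" for y
  proof (rule convex_onI)
    fix t :: real and x x' :: "real ^ 'n" assume t: "0 < t" "t < 1"
    have "y + \<mu> *\<^sub>R ((1 - t) *\<^sub>R x + t *\<^sub>R x') = (1 - t) *\<^sub>R (y + \<mu> *\<^sub>R x) + t *\<^sub>R (y + \<mu> *\<^sub>R x')"
      by (simp add: algebra_simps)
    then show "?F y ((1 - t) *\<^sub>R x + t *\<^sub>R x') \<le> (1 - t) * ?F y x + t * ?F y x'"
      using convex_onD[OF conv, of t "y + \<mu> *\<^sub>R x" "y + \<mu> *\<^sub>R x'"] t by simp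
  qed simp
  have L\<mu>: "0 \<le> L * \<mu>" using L \<mu> by simp
  have int: "integrable std_gauss (?F y)" for y
    by (rule integrable_std_gauss_linear(1)[OF _ L\<mu> gr]) simp
  define a where "a = (1 / \<mu>) *\<^sub>R (u - y)"
  have int_a: "integrable std_gauss (\<lambda>z. ?F y z * (a \<bullet> z))"
    by (rule integrable_std_gauss_linear(2)[OF _ L\<mu> gr]) simp
  have int_c: "integrable std_gauss (\<lambda>z. f y * (a \<bullet> z))"
    by (rule integrable_std_gauss_linear(2)[where A = "\<bar>f y\<bar>" and C = 0]) auto
  have shift: "?F y (z + a) = ?F u z" for z using \<mu> by (simp add: a_def algebra_simps)
  have "(\<integral>z. ?F y z * (a \<bullet> z) \<partial>std_gauss) \<le> (\<integral>z. ?F y (z + a) - ?F y z \<partial>std_gauss)"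
    by (rule gaussian_gradient_inequality[OF _ conv_F L\<mu> gr]) simp
  then have stein: "(\<integral>z. ?F y z * (a \<bullet> z) \<partial>std_gauss) \<le> (\<integral>z. ?F u z \<partial>std_gauss) - (\<integral>z. ?F y z \<partial>std_gauss)"
    unfolding shift using int by simp
  have lower: "f y \<le> (\<integral>z. ?F y z \<partial>std_gauss)"
    using std_gauss_jensen[OF _ int conv_F] by simp
  have int_norm: "integrable std_gauss (\<lambda>z :: real ^ 'n. norm z)"
    by (rule integrable_std_gauss_linear(1)[where A = 0 and C = 1]) auto
  have "(\<integral>z. ?F u z \<partial>std_gauss) \<le> (\<integral>z. f u + L * \<mu> * norm z \<partial>(std_gauss :: (real ^ 'n) measure))"
  proof (rule integral_mono[OF int])
    show "integrable std_gauss (\<lambda>z :: real ^ 'n. f u + L * \<mu> * norm z)" using int_norm by simp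
    show "?F u z \<le> f u + L * \<mu> * norm z" for z using dev[of u z] by linarith
  qed
  also have "\<dots> = f u + L * \<mu> * (\<integral>z. norm z \<partial>(std_gauss :: (real ^ 'n) measure))"
    using int_norm by simp
  also have "\<dots> \<le> f u + L * \<mu> * sqrt (real CARD('n))"
    using L\<mu> by (intro add_left_mono mult_left_mono std_gauss_norm_le)
  finally have upper: "(\<integral>z. ?F u z \<partial>std_gauss) \<le> f u + L * \<mu> * sqrt (real CARD('n))" .
  have "oracle_grad f \<mu> y z \<bullet> (y - u) = f y * (a \<bullet> z) - ?F y z * (a \<bullet> z)" for z
    using \<mu> by (simp add: oracle_grad_def a_def inner_commute inner_diff_left inner_diff_right field_simps)
  then have "(\<integral>z. oracle_grad f \<mu> y z \<bullet> (y - u) \<partial>std_gauss) = - (\<integral>z. ?F y z * (a \<bullet> z) \<partial>std_gauss)"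
    using int_a int_c by (simp add: integral_std_gauss_inner)
  then show ?thesis using stein lower upper by (simp add: mult_ac)
qed

lemma norm_oracle_grad_le:
  assumes lip: "L-lipschitz_on UNIV f" and \<mu>: "0 < \<mu>"
  shows "norm (oracle_grad f \<mu> y z) \<le> L * (norm z)\<^sup>2"
proof -
  have "\<bar>f (y + \<mu> *\<^sub>R z) - f y\<bar> \<le> L * (\<mu> * norm z)"
    using lipschitz_onD[OF lip, of "y + \<mu> *\<^sub>R z" y] \<mu> by (simp add: dist_norm)
  then have "\<bar>(f (y + \<mu> *\<^sub>R z) - f y) / \<mu>\<bar> \<le> L * norm z"
    using \<mu> by (simp add: abs_divide divide_le_eq mult_ac)
  then have "\<bar>(f (y + \<mu> *\<^sub>R z) - f y) / \<mu>\<bar> * norm z \<le> L * norm z * norm z"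
    by (rule mult_right_mono) simp
  then show ?thesis by (simp add: oracle_grad_def power2_eq_square mult.assoc)
qed

section \<open>One realisation of the algorithm\<close>

text \<open>
  Abel summation: as the weights increase and \<open>V\<close> stays in \<open>[0, K]\<close>, the sum is largest when \<open>V\<close>
  remains at \<open>K\<close> until it drops to \<open>0\<close> at the end.
\<close>

lemma weighted_telescoping_le:
  fixes w V :: "nat \<Rightarrow> real"
  assumes mono: "\<And>t. 1 \<le> t \<Longrightarrow> w t \<le> w (Suc t)" and w0: "0 \<le> w 1"
    and V: "\<And>t. 0 \<le> V t" "\<And>t. V t \<le> K" and T: "1 \<le> T"
  shows "(\<Sum>t=1..T. w t * (V t - V (Suc t))) \<le> w T * K"
proof -
  have w_nonneg: "0 \<le> w t" if "1 \<le> t" for t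
    using that by (induction t rule: dec_induct) (use w0 mono order_trans in auto)
  have "(\<Sum>t=1..T. w t * (V t - V (Suc t))) \<le> w T * (K - V (Suc T))"
    using T
  proof (induction T rule: dec_induct)
    case base
    then show ?case using w0 V(2)[of 1] by (simp add: mult_left_mono)
  next
    case (step T)
    have "w T * (K - V (Suc T)) \<le> w (Suc T) * (K - V (Suc T))"
      using mono[of T] V(2)[of "Suc T"] step by (intro mult_right_mono) auto
    then show ?case using step by (simp add: algebra_simps)
  qed
  also have "\<dots> \<le> w T * K"
    using w_nonneg[OF T] V(1)[of "Suc T"] by (simp add: mult_left_mono)
  finally show ?thesis .
qed

lemma weighted_avg_convex_combination:
  assumes "\<And>t. 0 < \<alpha> t" "1 \<le> T"
  shows "0 < (\<Sum>t=1..T. 1 / \<alpha> t)"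
    and "weighted_avg \<alpha> v T = (\<Sum>t=1..T. (1 / \<alpha> t / (\<Sum>t=1..T. 1 / \<alpha> t)) *\<^sub>R v t)"
    and "(\<Sum>t=1..T. 1 / \<alpha> t / (\<Sum>t=1..T. 1 / \<alpha> t)) = 1"
proof -
  show *: "0 < (\<Sum>t=1..T. 1 / \<alpha> t)" using assms by (intro sum_pos) auto
  show "weighted_avg \<alpha> v T = (\<Sum>t=1..T. (1 / \<alpha> t / (\<Sum>t=1..T. 1 / \<alpha> t)) *\<^sub>R v t)"
    unfolding weighted_avg_def by (simp add: scaleR_sum_right divide_inverse mult.commute)
  show "(\<Sum>t=1..T. 1 / \<alpha> t / (\<Sum>t=1..T. 1 / \<alpha> t)) = 1"
    unfolding sum_divide_distrib[symmetric] using * by simp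
qed

text \<open>
  The data of one run, with a common Lipschitz constant \<open>K\<close> for all agents. Monotonicity of
  the stepsizes starts at time \<open>1\<close>, because \<open>stepsize \<rho> \<delta> 0 = 1\<close> may be smaller than its successor.
\<close>

locale drgfmd_path =
  fixes E :: "nat \<Rightarrow> ('v::finite \<times> 'v) set" and P :: "nat \<Rightarrow> real ^ 'v ^ 'v" and B :: nat and \<zeta> :: real
    and X U :: "(real ^ 'n) set" and f :: "'v \<Rightarrow> real ^ 'n \<Rightarrow> real" and K :: real
    and \<phi> :: "real ^ 'n \<Rightarrow> real" and \<sigma> d :: real
    and \<mu> :: "'v \<Rightarrow> real" and \<alpha> :: "nat \<Rightarrow> real"
    and z x :: "'v \<Rightarrow> nat \<Rightarrow> real ^ 'n"
  assumes net: "network_assumption E P B \<zeta>"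
    and X: "compact X" "convex X" and zero: "0 \<in> X"
    and conv: "\<And>i. convex_on UNIV (f i)" and lip: "\<And>i. K-lipschitz_on UNIV (f i)"
    and br: "bregman_assumption U X \<phi> \<sigma>"
    and diam: "\<And>u v. u \<in> X \<Longrightarrow> v \<in> X \<Longrightarrow> bregman \<phi> u v \<le> d\<^sup>2"
    and \<mu>: "\<And>i. 0 < \<mu> i" and \<alpha>: "\<And>t. 0 < \<alpha> t" and \<alpha>_decr: "\<And>t. 1 \<le> t \<Longrightarrow> \<alpha> (Suc t) \<le> \<alpha> t"
    and run: "drgfmd_run X \<phi> f P \<mu> \<alpha> z x"
begin

definition y :: "'v \<Rightarrow> nat \<Rightarrow> real ^ 'n" where "y i t = mixing (P t) (\<lambda>k. x k t) i"

definition g :: "'v \<Rightarrow> nat \<Rightarrow> real ^ 'n" where "g i t = oracle_grad (f i) (\<mu> i) (y i t) (z i t)"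

lemma P_stochastic: "doubly_stochastic (P t)"
  using net by (simp add: network_assumption_def)

lemma x_0: "x i 0 = 0" using run by (simp add: drgfmd_run_def)

lemma x_step: "is_arg_min (\<lambda>u. \<alpha> t * (g i t \<bullet> u) + bregman \<phi> u (y i t)) (\<lambda>u. u \<in> X) (x i (Suc t))"
  using run by (simp add: drgfmd_run_def Let_def y_def g_def mixing_def)

lemma x_in: "x i t \<in> X"
  using x_step[of "t - 1" i] x_0 zero by (cases t) (auto simp: is_arg_min_def)

lemma y_in: "y i t \<in> X"
  unfolding y_def mixing_def using P_stochastic[of t] x_in X
  by (intro convex_sum) (auto simp: doubly_stochastic_def)

lemma \<sigma>: "0 < \<sigma>" using br by (simp add: bregman_assumption_def)

lemma K: "0 \<le> K" using lip by (rule lipschitz_on_nonneg)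

lemma norm_g_le: "norm (g i t) \<le> K * (norm (z i t))\<^sup>2"
  unfolding g_def by (rule norm_oracle_grad_le[OF lip \<mu>])

lemma step_length: "norm (x i (Suc t) - y i t) \<le> \<alpha> t * (K * (norm (z i t))\<^sup>2 / \<sigma>)"
proof -
  have "norm (x i (Suc t) - y i t) \<le> \<alpha> t * norm (g i t) / \<sigma>"
    by (rule mirror_step_length[OF br X y_in x_step]) (use \<alpha>[of t] in simp)
  also have "\<dots> \<le> \<alpha> t * (K * (norm (z i t))\<^sup>2) / \<sigma>"
    using norm_g_le \<alpha>[of t] \<sigma> by (intro divide_right_mono mult_left_mono) auto
  finally show ?thesis by simp
qed

text \<open>
  Jensen's inequality in each row, and then the column sums.
\<close>

lemma sum_bregman_mixing_le:
  assumes u: "u \<in> X"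
  shows "(\<Sum>i\<in>UNIV. bregman \<phi> u (y i t)) \<le> (\<Sum>i\<in>UNIV. bregman \<phi> u (x i t))"
proof -
  have "(\<Sum>i\<in>UNIV. bregman \<phi> u (y i t)) \<le> (\<Sum>i\<in>UNIV. \<Sum>j\<in>UNIV. P t $ i $ j * bregman \<phi> u (x j t))"
    unfolding y_def mixing_def using P_stochastic[of t] x_in
    by (intro sum_mono convex_on_sum[OF _ _ bregman_convex_second[OF br X(2) u]])
      (auto simp: doubly_stochastic_def)
  also have "\<dots> = (\<Sum>j\<in>UNIV. bregman \<phi> u (x j t))"
    by (subst sum.swap) (use P_stochastic[of t] in \<open>simp add: doubly_stochastic_def flip: sum_distrib_right\<close>)
  finally show ?thesis .
qed

text \<open>
  The inequality for one step is divided by \<open>(\<alpha> t)\<^sup>2\<close>, so that the error terms in \<open>\<parallel>g\<parallel>\<^sup>2\<close> no longer depend on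
  the stepsizes and the divergences carry increasing weights.
\<close>

lemma regret_bound:
  assumes u: "u \<in> X" and T: "1 \<le> T"
  shows "(\<Sum>t=1..T. \<Sum>i\<in>UNIV. (1 / \<alpha> t) * (g i t \<bullet> (y i t - u)))
    \<le> real CARD('v) * d\<^sup>2 / (\<alpha> T)\<^sup>2 + (\<Sum>t=1..T. \<Sum>i\<in>UNIV. K\<^sup>2 * norm (z i t) ^ 4 / (2 * \<sigma>))"
proof -
  define V where "V t = (\<Sum>i\<in>UNIV. bregman \<phi> u (x i t))" for t
  have step: "(\<Sum>i\<in>UNIV. (1 / \<alpha> t) * (g i t \<bullet> (y i t - u)))
      \<le> (1 / (\<alpha> t)\<^sup>2) * (V t - V (Suc t)) + (\<Sum>i\<in>UNIV. K\<^sup>2 * norm (z i t) ^ 4 / (2 * \<sigma>))" for t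
  proof -
    have one: "(1 / \<alpha> t) * (g i t \<bullet> (y i t - u))
        \<le> (1 / (\<alpha> t)\<^sup>2) * (bregman \<phi> u (y i t) - bregman \<phi> u (x i (Suc t))) + K\<^sup>2 * norm (z i t) ^ 4 / (2 * \<sigma>)" for i
    proof -
      have "(1 / (\<alpha> t)\<^sup>2) * (\<alpha> t * (g i t \<bullet> (y i t - u)))
          \<le> (1 / (\<alpha> t)\<^sup>2) * (bregman \<phi> u (y i t) - bregman \<phi> u (x i (Suc t)) + (\<alpha> t)\<^sup>2 * (norm (g i t))\<^sup>2 / (2 * \<sigma>))"
        by (intro mult_left_mono mirror_descent_step[OF br X y_in x_step u]) auto
      then have "(1 / \<alpha> t) * (g i t \<bullet> (y i t - u))
          \<le> (1 / (\<alpha> t)\<^sup>2) * (bregman \<phi> u (y i t) - bregman \<phi> u (x i (Suc t))) + (norm (g i t))\<^sup>2 / (2 * \<sigma>)"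
        using \<alpha>[of t] by (simp add: distrib_left power2_eq_square)
      also have "(norm (g i t))\<^sup>2 \<le> (K * (norm (z i t))\<^sup>2)\<^sup>2"
        by (intro power_mono norm_g_le) auto
      finally show ?thesis using \<sigma> by (simp add: power_mult_distrib divide_right_mono)
    qed
    have "(\<Sum>i\<in>UNIV. (1 / \<alpha> t) * (g i t \<bullet> (y i t - u)))
        \<le> (1 / (\<alpha> t)\<^sup>2) * ((\<Sum>i\<in>UNIV. bregman \<phi> u (y i t)) - V (Suc t)) + (\<Sum>i\<in>UNIV. K\<^sup>2 * norm (z i t) ^ 4 / (2 * \<sigma>))"
      unfolding V_def sum_subtractf[symmetric] sum_distrib_left sum.distrib[symmetric]
      by (intro sum_mono one)
    also have "\<dots> \<le> (1 / (\<alpha> t)\<^sup>2) * (V t - V (Suc t)) + (\<Sum>i\<in>UNIV. K\<^sup>2 * norm (z i t) ^ 4 / (2 * \<sigma>))"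
      using sum_bregman_mixing_le[OF u, of t]
      by (intro add_right_mono mult_left_mono) (auto simp: V_def)
    finally show ?thesis .
  qed
  have V0: "0 \<le> V t" and V1: "V t \<le> real CARD('v) * d\<^sup>2" for t
  proof -
    show "0 \<le> V t" unfolding V_def by (intro sum_nonneg bregman_nonneg[OF br u x_in])
    have "V t \<le> (\<Sum>i\<in>(UNIV :: 'v set). d\<^sup>2)" unfolding V_def by (intro sum_mono diam u x_in)
    then show "V t \<le> real CARD('v) * d\<^sup>2" by simp
  qed
  have "(\<Sum>t=1..T. \<Sum>i\<in>UNIV. (1 / \<alpha> t) * (g i t \<bullet> (y i t - u)))
      \<le> (\<Sum>t=1..T. (1 / (\<alpha> t)\<^sup>2) * (V t - V (Suc t)) + (\<Sum>i\<in>UNIV. K\<^sup>2 * norm (z i t) ^ 4 / (2 * \<sigma>)))"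
    by (intro sum_mono step)
  also have "(\<Sum>t=1..T. (1 / (\<alpha> t)\<^sup>2) * (V t - V (Suc t)) + (\<Sum>i\<in>UNIV. K\<^sup>2 * norm (z i t) ^ 4 / (2 * \<sigma>)))
    = (\<Sum>t=1..T. (1 / (\<alpha> t)\<^sup>2) * (V t - V (Suc t))) + (\<Sum>t=1..T. \<Sum>i\<in>UNIV. K\<^sup>2 * norm (z i t) ^ 4 / (2 * \<sigma>))"
    by (rule sum.distrib)
  also have "(\<Sum>t=1..T. (1 / (\<alpha> t)\<^sup>2) * (V t - V (Suc t))) \<le> (1 / (\<alpha> T)\<^sup>2) * (real CARD('v) * d\<^sup>2)"
  proof (rule weighted_telescoping_le[OF _ _ V0 V1 T])
    show "1 / (\<alpha> t)\<^sup>2 \<le> 1 / (\<alpha> (Suc t))\<^sup>2" if "1 \<le> t" for t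
      using \<alpha>_decr[OF that] \<alpha>[of t] \<alpha>[of "Suc t"] by (intro divide_left_mono power_mono) auto
  qed simp
  finally show ?thesis by simp
qed

lemma sum_disagreement_le:
  "(\<Sum>t=1..T. disagreement (\<lambda>i. x i t))
    \<le> Gamma_const CARD('v) \<zeta> / (1 - gamma_const CARD('v) \<zeta> B)
       * (\<Sum>s<T. \<Sum>i\<in>UNIV. \<alpha> s * (K * (norm (z i s))\<^sup>2 / \<sigma>))"
proof -
  let ?q = "1 - \<zeta> / (4 * (real CARD('v))\<^sup>2)"
  let ?b = "\<lambda>i s. \<alpha> s * (K * (norm (z i s))\<^sup>2 / \<sigma>)"
  have q: "0 \<le> ?q" using network_rate_bounds(1)[OF net] by simp
  have "(\<Sum>t=1..T. disagreement (\<lambda>i. x i t)) \<le> (\<Sum>t=1..T. \<Sum>s<t. ?q ^ ((t - Suc s) div B) * (\<Sum>i\<in>UNIV. ?b i s))"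
    by (intro sum_mono perturbed_consensus[where x = x, OF net x_0]) (use step_length in \<open>simp add: y_def\<close>)
  also have "\<dots> \<le> Gamma_const CARD('v) \<zeta> / (1 - gamma_const CARD('v) \<zeta> B) * (\<Sum>s<T. \<Sum>i\<in>UNIV. ?b i s)"
  proof (rule convolution_sum_le)
    show "0 \<le> (\<Sum>i\<in>UNIV. ?b i s)" for s
      using \<alpha>[of s] \<sigma> K by (intro sum_nonneg) auto
    show "0 \<le> ?q ^ (k div B)" for k using q by simp
  qed (rule sum_block_geometric_le[OF net])
  finally show ?thesis .
qed

text \<open>
  Both points are compared with the centroid, which mixing preserves.
\<close>

lemma norm_diff_mixed_le: "norm (x l t - y i t) \<le> 2 * disagreement (\<lambda>i. x i t)"
proof -
  let ?c = "centroid (\<lambda>i. x i t)"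
  have "norm (y i t - ?c) \<le> disagreement (\<lambda>i. x i t)"
    using norm_diff_centroid_le[of "mixing (P t) (\<lambda>k. x k t)" i]
      disagreement_mixing_le[OF P_stochastic, of t "\<lambda>k. x k t"]
    by (simp add: y_def centroid_mixing[OF P_stochastic])
  moreover have "norm (x l t - ?c) \<le> disagreement (\<lambda>i. x i t)"
    using norm_diff_centroid_le[of "\<lambda>k. x k t" l] by simp
  moreover have "norm (x l t - y i t) \<le> norm (x l t - ?c) + norm (y i t - ?c)"
    using norm_triangle_ineq4[of "x l t - ?c" "y i t - ?c"] by simp
  ultimately show ?thesis by linarith
qed

lemma objective_convex: "convex_on UNIV (objective f)"
proof (rule convex_onI)
  fix t :: real and a b :: "real ^ 'n" assume t: "0 < t" "t < 1"
  have "objective f ((1 - t) *\<^sub>R a + t *\<^sub>R b) \<le> (\<Sum>i\<in>UNIV. (1 - t) * f i a + t * f i b) / real CARD('v)"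
    unfolding objective_def using t by (intro divide_right_mono sum_mono convex_onD[OF conv]) auto
  then show "objective f ((1 - t) *\<^sub>R a + t *\<^sub>R b) \<le> (1 - t) * objective f a + t * objective f b"
    by (simp add: objective_def sum.distrib sum_distrib_left add_divide_distrib)
qed simp

text \<open>
  The first summand on the right is the only one whose mean requires the conditional law of the noise; the
  others involve only the norms of the noise vectors. The disagreements are
  weighted with the largest weight \<open>1 / \<alpha> T\<close>, since only their plain sum is controlled.
\<close>

lemma pathwise_bound:
  assumes u: "u \<in> X" and T: "1 \<le> T"
  shows "(\<Sum>t=1..T. 1 / \<alpha> t) * (objective f (weighted_avg \<alpha> (x l) T) - objective f u)
    \<le> (\<Sum>t=1..T. \<Sum>i\<in>UNIV. (1 / \<alpha> t) * (f i (y i t) - f i u - g i t \<bullet> (y i t - u))) / real CARD('v)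
      + d\<^sup>2 / (\<alpha> T)\<^sup>2
      + (\<Sum>t=1..T. \<Sum>i\<in>UNIV. K\<^sup>2 * norm (z i t) ^ 4 / (2 * \<sigma>)) / real CARD('v)
      + 2 * K / \<alpha> T * (Gamma_const CARD('v) \<zeta> / (1 - gamma_const CARD('v) \<zeta> B)
          * (\<Sum>s<T. \<Sum>i\<in>UNIV. \<alpha> s * (K * (norm (z i s))\<^sup>2 / \<sigma>)))"
proof -
  let ?N = "real CARD('v)"
  define A where "A = (\<Sum>t=1..T. 1 / \<alpha> t)"
  have A: "0 < A" unfolding A_def by (rule weighted_avg_convex_combination(1)[OF \<alpha> T])
  have \<alpha>_mono: "\<alpha> T \<le> \<alpha> t" if "1 \<le> t" "t \<le> T" for t
  proof -
    have "\<alpha> (t + k) \<le> \<alpha> t" for k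
      using \<open>1 \<le> t\<close> by (induction k) (auto intro: order_trans[OF \<alpha>_decr])
    from this[of "T - t"] that show ?thesis by simp
  qed
  have per: "objective f (x l t) - objective f u
      \<le> (\<Sum>i\<in>UNIV. f i (y i t) - f i u) / ?N + 2 * K * disagreement (\<lambda>i. x i t)" for t
  proof -
    have "f i (x l t) - f i (y i t) \<le> 2 * K * disagreement (\<lambda>i. x i t)" for i
    proof -
      have "f i (x l t) - f i (y i t) \<le> K * norm (x l t - y i t)"
        using lipschitz_onD[OF lip[of i], of "x l t" "y i t"] by (simp add: dist_norm)
      also have "\<dots> \<le> K * (2 * disagreement (\<lambda>i. x i t))"
        by (intro mult_left_mono norm_diff_mixed_le K)
      finally show ?thesis by simp
    qed
    then have "f i (x l t) - f i u \<le> (f i (y i t) - f i u) + 2 * K * disagreement (\<lambda>i. x i t)" for i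
      by (simp add: algebra_simps)
    then have "(\<Sum>i\<in>UNIV. f i (x l t) - f i u) \<le> (\<Sum>i\<in>UNIV. (f i (y i t) - f i u) + 2 * K * disagreement (\<lambda>i. x i t))"
      by (rule sum_mono)
    then have "(\<Sum>i\<in>UNIV. f i (x l t) - f i u) / ?N
        \<le> ((\<Sum>i\<in>UNIV. f i (y i t) - f i u) + ?N * (2 * K * disagreement (\<lambda>i. x i t))) / ?N"
      by (intro divide_right_mono) (simp_all add: sum.distrib)
    then show ?thesis by (simp add: objective_def sum_subtractf diff_divide_distrib add_divide_distrib)
  qed
  have "objective f (weighted_avg \<alpha> (x l) T) \<le> (\<Sum>t=1..T. (1 / \<alpha> t / A) * objective f (x l t))"
    unfolding weighted_avg_convex_combination(2)[OF \<alpha> T] A_def[symmetric]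
    using weighted_avg_convex_combination(3)[of \<alpha>, OF \<alpha> T] T \<alpha> A
    by (intro convex_on_sum[OF _ _ objective_convex]) (auto simp: A_def less_imp_le)
  then have "A * objective f (weighted_avg \<alpha> (x l) T) \<le> A * (\<Sum>t=1..T. (1 / \<alpha> t / A) * objective f (x l t))"
    using A by (intro mult_left_mono) auto
  also have "\<dots> = (\<Sum>t=1..T. (1 / \<alpha> t) * objective f (x l t))"
    using A by (simp add: sum_distrib_left)
  finally have "A * (objective f (weighted_avg \<alpha> (x l) T) - objective f u)
      \<le> (\<Sum>t=1..T. (1 / \<alpha> t) * (objective f (x l t) - objective f u))"
    by (simp add: A_def right_diff_distrib sum_subtractf sum_distrib_right)
  also have "\<dots> \<le> (\<Sum>t=1..T. (1 / \<alpha> t) * ((\<Sum>i\<in>UNIV. f i (y i t) - f i u) / ?N) + (2 * K / \<alpha> T) * disagreement (\<lambda>i. x i t))"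
  proof (rule sum_mono)
    fix t assume t: "t \<in> {1..T}"
    have "(1 / \<alpha> t) * (objective f (x l t) - objective f u)
        \<le> (1 / \<alpha> t) * ((\<Sum>i\<in>UNIV. f i (y i t) - f i u) / ?N + 2 * K * disagreement (\<lambda>i. x i t))"
      using \<alpha>[of t] by (intro mult_left_mono per) auto
    also have "\<dots> = (1 / \<alpha> t) * ((\<Sum>i\<in>UNIV. f i (y i t) - f i u) / ?N) + (1 / \<alpha> t) * (2 * K * disagreement (\<lambda>i. x i t))"
      by (rule distrib_left)
    also have "(1 / \<alpha> t) * (2 * K * disagreement (\<lambda>i. x i t)) \<le> (1 / \<alpha> T) * (2 * K * disagreement (\<lambda>i. x i t))"
      using \<alpha>_mono[of t] t \<alpha>[of T] \<alpha>[of t] K by (intro mult_right_mono divide_left_mono) auto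
    finally show "(1 / \<alpha> t) * (objective f (x l t) - objective f u)
      \<le> (1 / \<alpha> t) * ((\<Sum>i\<in>UNIV. f i (y i t) - f i u) / ?N) + (2 * K / \<alpha> T) * disagreement (\<lambda>i. x i t)"
      by simp
  qed
  also have "\<dots> = (\<Sum>t=1..T. \<Sum>i\<in>UNIV. (1 / \<alpha> t) * (f i (y i t) - f i u)) / ?N
      + (2 * K / \<alpha> T) * (\<Sum>t=1..T. disagreement (\<lambda>i. x i t))"
    by (simp only: sum.distrib sum_distrib_left sum_divide_distrib times_divide_eq_right)
  also have "(\<Sum>t=1..T. \<Sum>i\<in>UNIV. (1 / \<alpha> t) * (f i (y i t) - f i u))
      = (\<Sum>t=1..T. \<Sum>i\<in>UNIV. (1 / \<alpha> t) * (f i (y i t) - f i u - g i t \<bullet> (y i t - u)))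
       + (\<Sum>t=1..T. \<Sum>i\<in>UNIV. (1 / \<alpha> t) * (g i t \<bullet> (y i t - u)))"
    unfolding sum.distrib[symmetric] by (simp add: algebra_simps)
  also have "(2 * K / \<alpha> T) * (\<Sum>t=1..T. disagreement (\<lambda>i. x i t))
      \<le> (2 * K / \<alpha> T) * (Gamma_const CARD('v) \<zeta> / (1 - gamma_const CARD('v) \<zeta> B)
          * (\<Sum>s<T. \<Sum>i\<in>UNIV. \<alpha> s * (K * (norm (z i s))\<^sup>2 / \<sigma>)))"
    using K \<alpha>[of T] by (intro mult_left_mono sum_disagreement_le) auto
  also have "(\<Sum>t=1..T. \<Sum>i\<in>UNIV. (1 / \<alpha> t) * (g i t \<bullet> (y i t - u)))
    \<le> ?N * d\<^sup>2 / (\<alpha> T)\<^sup>2 + (\<Sum>t=1..T. \<Sum>i\<in>UNIV. K\<^sup>2 * norm (z i t) ^ 4 / (2 * \<sigma>))"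
    by (rule regret_bound[OF u T])
  finally show ?thesis
    by (simp add: A_def add_divide_distrib divide_right_mono)
qed

end

section \<open>Independence of the current noise from the past\<close>

text \<open>
  By independence the joint law is a product, so Fubini's theorem reduces the claim to the inequality
  with \<open>Y\<close> replaced by a fixed point.
\<close>

lemma oracle_grad_expectation:
  fixes Y Z :: "'w \<Rightarrow> real ^ 'n"
  assumes M: "prob_space M" and ind: "prob_space.indep_var M borel Y borel Z"
    and Z: "distr M borel Z = std_gauss"
    and conv: "convex_on UNIV f" and lip: "L-lipschitz_on UNIV f" and \<mu>: "0 < \<mu>"
    and bounded: "\<And>\<omega>. \<omega> \<in> space M \<Longrightarrow> norm (Y \<omega> - u) \<le> D"
  shows "integrable M (\<lambda>\<omega>. f (Y \<omega>) - f u - oracle_grad f \<mu> (Y \<omega>) (Z \<omega>) \<bullet> (Y \<omega> - u))" (is "integrable M ?h")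
    and "(\<integral>\<omega>. f (Y \<omega>) - f u - oracle_grad f \<mu> (Y \<omega>) (Z \<omega>) \<bullet> (Y \<omega> - u) \<partial>M) \<le> \<mu> * L * sqrt (real CARD('n))"
proof -
  interpret prob_space M by (rule M)
  interpret G: prob_space "std_gauss :: (real ^ 'n) measure" by (rule prob_space_std_gauss)
  have Ym[measurable]: "Y \<in> borel_measurable M" and Zm[measurable]: "Z \<in> borel_measurable M"
    using ind by (auto simp: indep_var_distribution_eq)
  interpret DY: prob_space "distr M borel Y" by (rule prob_space_distr) simp
  interpret pair_sigma_finite "distr M borel Y" "std_gauss :: (real ^ 'n) measure" ..
  have L: "0 \<le> L" using lip by (rule lipschitz_on_nonneg)
  have fm[measurable]: "f \<in> borel_measurable borel"
    by (intro borel_measurable_continuous_onI lipschitz_on_continuous_on[OF lip])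
  define H where "H p = f (fst p) - f u - oracle_grad f \<mu> (fst p) (snd p) \<bullet> (fst p - u)" for p :: "(real ^ 'n) \<times> (real ^ 'n)"
  have H_le: "\<bar>H (y, z)\<bar> \<le> L * norm (y - u) + L * norm (y - u) * (norm z)\<^sup>2" for y z
  proof -
    have 1: "\<bar>f y - f u\<bar> \<le> L * norm (y - u)"
      using lipschitz_onD[OF lip, of y u] by (simp add: dist_norm)
    have 2: "\<bar>oracle_grad f \<mu> y z \<bullet> (y - u)\<bar> \<le> L * (norm z)\<^sup>2 * norm (y - u)"
      by (rule order_trans[OF Cauchy_Schwarz_ineq2])
        (intro mult_right_mono norm_oracle_grad_le[OF lip \<mu>] norm_ge_zero)
    show ?thesis using 1 2 unfolding H_def fst_conv snd_conv by (simp add: mult_ac)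
  qed
  have Hm[measurable]: "H \<in> borel_measurable (borel \<Otimes>\<^sub>M borel)"
    unfolding H_def oracle_grad_def by measurable
  have joint: "distr M (borel \<Otimes>\<^sub>M borel) (\<lambda>\<omega>. (Y \<omega>, Z \<omega>)) = distr M borel Y \<Otimes>\<^sub>M std_gauss"
    using ind unfolding indep_var_distribution_eq Z by simp
  have intZ: "integrable M (\<lambda>\<omega>. (norm (Z \<omega>))\<^sup>2)"
    using std_gauss_norm_power2[where 'n='n] integrable_distr_eq[of Z M borel "\<lambda>z. (norm z)\<^sup>2"]
    by (simp add: Z has_bochner_integral_iff)
  have intM: "integrable M (\<lambda>\<omega>. H (Y \<omega>, Z \<omega>))"
  proof (rule Bochner_Integration.integrable_bound)
    show "integrable M (\<lambda>\<omega>. L * D + L * D * (norm (Z \<omega>))\<^sup>2)" using intZ by auto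
    show "AE \<omega> in M. norm (H (Y \<omega>, Z \<omega>)) \<le> norm (L * D + L * D * (norm (Z \<omega>))\<^sup>2)"
    proof (rule AE_I2)
      fix \<omega> assume \<omega>: "\<omega> \<in> space M"
      have "L * norm (Y \<omega> - u) \<le> L * D" using bounded[OF \<omega>] L by (rule mult_left_mono)
      then have "L * norm (Y \<omega> - u) + L * norm (Y \<omega> - u) * (norm (Z \<omega>))\<^sup>2 \<le> L * D + L * D * (norm (Z \<omega>))\<^sup>2"
        by (intro add_mono mult_right_mono) auto
      then show "norm (H (Y \<omega>, Z \<omega>)) \<le> norm (L * D + L * D * (norm (Z \<omega>))\<^sup>2)"
        using H_le[of "Y \<omega>" "Z \<omega>"] by simp
    qed
  qed simp
  then show "integrable M ?h" by (simp add: H_def)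
  have intP: "integrable (distr M borel Y \<Otimes>\<^sub>M std_gauss) H"
    unfolding joint[symmetric] using intM by (subst integrable_distr_eq) auto
  have inner: "(\<integral>z. H (y, z) \<partial>std_gauss) \<le> \<mu> * L * sqrt (real CARD('n))" for y
  proof -
    have "integrable std_gauss (\<lambda>z. oracle_grad f \<mu> y z \<bullet> (y - u))"
    proof (rule integrable_std_gauss_quadratic)
      show "(\<lambda>z. oracle_grad f \<mu> y z \<bullet> (y - u)) \<in> borel_measurable borel"
        unfolding oracle_grad_def by measurable
      show "\<bar>oracle_grad f \<mu> y z \<bullet> (y - u)\<bar> \<le> 0 + (L * norm (y - u)) * (norm z)\<^sup>2" for z
      proof -
        have "\<bar>oracle_grad f \<mu> y z \<bullet> (y - u)\<bar> \<le> L * (norm z)\<^sup>2 * norm (y - u)"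
          by (rule order_trans[OF Cauchy_Schwarz_ineq2])
            (intro mult_right_mono norm_oracle_grad_le[OF lip \<mu>] norm_ge_zero)
        then show ?thesis by (simp add: mult_ac)
      qed
    qed
    then have "(\<integral>z. H (y, z) \<partial>std_gauss) = f y - f u - (\<integral>z. oracle_grad f \<mu> y z \<bullet> (y - u) \<partial>std_gauss)"
      by (simp add: H_def)
    then show ?thesis using oracle_grad_inequality[OF conv lip \<mu>, of y u] by simp
  qed
  have "(\<integral>\<omega>. ?h \<omega> \<partial>M) = (\<integral>\<omega>. H (Y \<omega>, Z \<omega>) \<partial>M)" by (simp add: H_def)
  also have "\<dots> = (\<integral>p. H p \<partial>(distr M borel Y \<Otimes>\<^sub>M std_gauss))"
    unfolding joint[symmetric] by (subst integral_distr) auto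
  also have "\<dots> = (\<integral>y. (\<integral>z. H (y, z) \<partial>std_gauss) \<partial>distr M borel Y)"
    by (rule integral_fst'[OF intP, symmetric])
  also have "\<dots> \<le> (\<integral>y. \<mu> * L * sqrt (real CARD('n)) \<partial>distr M borel Y)"
    by (intro integral_mono inner integrable_fst'[OF intP]) simp
  also have "\<dots> = \<mu> * L * sqrt (real CARD('n))" using DY.prob_space by simp
  finally show "(\<integral>\<omega>. ?h \<omega> \<partial>M) \<le> \<mu> * L * sqrt (real CARD('n))" .
qed

text \<open>
  Independence passes to all random variables that are measurable with respect to the \<open>\<sigma>\<close>-algebras
  generated by two independent ones.
\<close>

lemma (in prob_space) indep_var_generated:
  assumes ind: "indep_var N1 R1 N2 R2"
    and Y: "Y \<in> measurable (vimage_algebra (space M) R1 N1) S"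
    and Z: "Z \<in> measurable (vimage_algebra (space M) R2 N2) S"
  shows "indep_var S Y S Z"
proof -
  have gen: "random_variable S h \<and> sigma_sets (space M) {h -` A \<inter> space M | A. A \<in> sets S}
      \<subseteq> sigma_sets (space M) {R -` A \<inter> space M | A. A \<in> sets N}"
    if R: "random_variable N R" and h: "h \<in> measurable (vimage_algebra (space M) R N) S" for R N h
  proof -
    have sets: "sets (vimage_algebra (space M) R N) = {R -` A \<inter> space M | A. A \<in> sets N}"
      using R by (intro sets_vimage_algebra2) (auto dest: measurable_space)
    have pre: "h -` A \<inter> space M \<in> {R -` A \<inter> space M | A. A \<in> sets N}" if "A \<in> sets S" for A
      using measurable_sets[OF h that] sets by simp
    have "random_variable S h"
    proof (rule measurableI)
      show "h \<omega> \<in> space S" if "\<omega> \<in> space M" for \<omega> using measurable_space[OF h] that by simp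
      show "h -` A \<inter> space M \<in> sets M" if "A \<in> sets S" for A
        using pre[OF that] measurable_sets[OF R] by auto
    qed
    moreover have "sigma_sets (space M) {h -` A \<inter> space M | A. A \<in> sets S}
      \<subseteq> sigma_sets (space M) {R -` A \<inter> space M | A. A \<in> sets N}"
      by (rule sigma_sets_mono) (use pre in \<open>auto intro: sigma_sets.Basic\<close>)
    ultimately show ?thesis by simp
  qed
  have R: "random_variable N1 R1" "random_variable N2 R2" using ind by (auto simp: indep_var_eq)
  have "indep_set (sigma_sets (space M) {R1 -` A \<inter> space M | A. A \<in> sets N1})
      (sigma_sets (space M) {R2 -` A \<inter> space M | A. A \<in> sets N2})"
    using ind by (simp add: indep_var_eq)
  then have "indep_set (sigma_sets (space M) {Y -` A \<inter> space M | A. A \<in> sets S})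
      (sigma_sets (space M) {Z -` A \<inter> space M | A. A \<in> sets S})"
    unfolding indep_set_def using gen[OF R(1) Y] gen[OF R(2) Z]
    by (elim indep_sets_mono_sets) (auto split: bool.split)
  then show ?thesis using gen[OF R(1) Y] gen[OF R(2) Z] by (simp add: indep_var_eq)
qed

locale drgfmd_random =
  fixes E :: "nat \<Rightarrow> ('v::finite \<times> 'v) set" and P :: "nat \<Rightarrow> real ^ 'v ^ 'v" and B :: nat and \<zeta> :: real
    and X U :: "(real ^ 'n) set" and f :: "'v \<Rightarrow> real ^ 'n \<Rightarrow> real" and K :: real
    and \<phi> :: "real ^ 'n \<Rightarrow> real" and \<sigma> d :: real
    and \<mu> :: "'v \<Rightarrow> real" and \<alpha> :: "nat \<Rightarrow> real"
    and M :: "'w measure" and \<xi> x :: "'v \<Rightarrow> nat \<Rightarrow> 'w \<Rightarrow> real ^ 'n"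
  assumes noise: "gaussian_noise M \<xi>"
    and path: "\<And>\<omega>. \<omega> \<in> space M \<Longrightarrow>
      drgfmd_path E P B \<zeta> X U f K \<phi> \<sigma> d \<mu> \<alpha> (\<lambda>i t. \<xi> i t \<omega>) (\<lambda>i t. x i t \<omega>)"
begin

sublocale prob_space M using noise by (simp add: gaussian_noise_def)

lemma data:
  shows X: "compact X" "convex X" "0 \<in> X" and br: "bregman_assumption U X \<phi> \<sigma>"
    and conv: "convex_on UNIV (f i)" and lip: "K-lipschitz_on UNIV (f i)" and \<mu>: "0 < \<mu> i" and \<alpha>: "0 < \<alpha> t"
proof -
  obtain \<omega> where "\<omega> \<in> space M" using not_empty by blast
  from path[OF this] interpret drgfmd_path E P B \<zeta> X U f K \<phi> \<sigma> d \<mu> \<alpha> "\<lambda>i t. \<xi> i t \<omega>" "\<lambda>i t. x i t \<omega>" .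
  show "compact X" "convex X" "0 \<in> X" "bregman_assumption U X \<phi> \<sigma>" "convex_on UNIV (f i)"
    "K-lipschitz_on UNIV (f i)" "0 < \<mu> i" "0 < \<alpha> t"
    using X zero br conv lip \<mu> \<alpha> by auto
qed

definition y :: "'v \<Rightarrow> nat \<Rightarrow> 'w \<Rightarrow> real ^ 'n" where
  "y i t \<omega> = mixing (P t) (\<lambda>k. x k t \<omega>) i"

definition past :: "nat \<Rightarrow> ('v \<times> nat) set" where "past t = {k. snd k < t}"

definition history :: "nat \<Rightarrow> 'w \<Rightarrow> 'v \<times> nat \<Rightarrow> real ^ 'n" where
  "history t \<omega> = (\<lambda>k\<in>past t. \<xi> (fst k) (snd k) \<omega>)"

text \<open>
  The past is generated by a single map into a product space, because the independence of the whole
  family of noise vectors passes to its restrictions to disjoint index sets.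
\<close>

definition filtration :: "nat \<Rightarrow> 'w measure" where
  "filtration t = vimage_algebra (space M) (history t) (PiM (past t) (\<lambda>_. borel))"

lemma space_filtration [simp]: "space (filtration t) = space M"
  by (simp add: filtration_def)

lemma history_measurable_filtration: "history t \<in> measurable (filtration t) (PiM (past t) (\<lambda>_. borel))"
  unfolding filtration_def
  by (rule measurable_vimage_algebra1) (auto simp: history_def space_PiM)

lemma \<xi>_measurable_filtration:
  assumes "s < t"
  shows "\<xi> i s \<in> borel_measurable (filtration t)"
proof -
  have "(i, s) \<in> past t" using assms by (simp add: past_def)
  from measurable_compose[OF history_measurable_filtration measurable_component_singleton[OF this]]
  show ?thesis using \<open>(i, s) \<in> past t\<close> by (simp add: history_def)
qed

text \<open>
  The gradient is continuous only near \<open>X\<close>, where all mixed points lie; off \<open>X\<close> it is replaced by zero.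
\<close>

lemma grad_measurable: "(\<lambda>v. indicator X v *\<^sub>R grad \<phi> v) \<in> borel_measurable borel"
proof (rule borel_measurable_continuous_on_indicator)
  show "X \<in> sets borel" using X(1) by (simp add: compact_imp_closed)
  have "continuous_on U (grad \<phi>)"
    using bregman_assumption_derivatives(2)[OF br]
    by (intro continuous_at_imp_continuous_on) (blast intro: has_derivative_continuous)
  then show "continuous_on X (grad \<phi>)"
    using br continuous_on_subset by (auto simp: bregman_assumption_def)
qed

lemma f_measurable [measurable]: "f i \<in> borel_measurable borel"
  by (intro borel_measurable_continuous_onI lipschitz_on_continuous_on[OF lip])

lemma mirror_map_measurable [measurable]: "mirror_map X \<phi> \<in> borel_measurable borel"
  using X by (intro borel_measurable_continuous_onI continuous_mirror_map[OF br]) auto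

lemma x_step_eq:
  assumes "\<omega> \<in> space M"
  shows "x i (Suc t) \<omega> = mirror_map X \<phi> (indicator X (y i t \<omega>) *\<^sub>R grad \<phi> (y i t \<omega>)
    - \<alpha> t *\<^sub>R oracle_grad (f i) (\<mu> i) (y i t \<omega>) (\<xi> i t \<omega>))"
    and "y i t \<omega> \<in> X" and "x i t \<omega> \<in> X" and "x i 0 \<omega> = 0"
proof -
  interpret p: drgfmd_path E P B \<zeta> X U f K \<phi> \<sigma> d \<mu> \<alpha> "\<lambda>i t. \<xi> i t \<omega>" "\<lambda>i t. x i t \<omega>" by (rule path[OF assms])
  have y: "p.y i t = y i t \<omega>" by (simp add: p.y_def y_def)
  show "y i t \<omega> \<in> X" "x i t \<omega> \<in> X" "x i 0 \<omega> = 0" using p.y_in[of i t] p.x_in p.x_0 y by auto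
  then show "x i (Suc t) \<omega> = mirror_map X \<phi> (indicator X (y i t \<omega>) *\<^sub>R grad \<phi> (y i t \<omega>)
    - \<alpha> t *\<^sub>R oracle_grad (f i) (\<mu> i) (y i t \<omega>) (\<xi> i t \<omega>))"
    using mirror_map_step(2)[OF p.br p.X p.x_step[of t i]] by (simp add: p.g_def y)
qed

lemma x_adapted: "t \<le> s \<Longrightarrow> x i t \<in> borel_measurable (filtration s)"
proof (induction t arbitrary: i)
  case 0
  show ?case by (subst measurable_cong[where g = "\<lambda>_. 0"]) (simp_all add: x_step_eq(4))
next
  case (Suc t)
  have [measurable]: "x j t \<in> borel_measurable (filtration s)" for j using Suc by simp
  have [measurable]: "y j t \<in> borel_measurable (filtration s)" for j
    unfolding y_def mixing_def by measurable
  have [measurable]: "\<xi> i t \<in> borel_measurable (filtration s)" using Suc by (intro \<xi>_measurable_filtration) simp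
  have [measurable]: "(\<lambda>\<omega>. indicator X (y i t \<omega>) *\<^sub>R grad \<phi> (y i t \<omega>)) \<in> borel_measurable (filtration s)"
    by (rule measurable_compose[OF _ grad_measurable]) simp
  have "x i (Suc t) \<in> borel_measurable (filtration s) \<longleftrightarrow>
      (\<lambda>\<omega>. mirror_map X \<phi> (indicator X (y i t \<omega>) *\<^sub>R grad \<phi> (y i t \<omega>)
        - \<alpha> t *\<^sub>R oracle_grad (f i) (\<mu> i) (y i t \<omega>) (\<xi> i t \<omega>))) \<in> borel_measurable (filtration s)"
    by (rule measurable_cong) (simp add: x_step_eq(1))
  also have "\<dots>" unfolding oracle_grad_def by measurable
  finally show ?case .
qed

lemma y_adapted: "y i t \<in> borel_measurable (filtration t)"
proof -
  have [measurable]: "x j t \<in> borel_measurable (filtration t)" for j by (rule x_adapted) simp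
  show ?thesis unfolding y_def mixing_def by measurable
qed

lemma \<xi>_law: "distr M borel (\<xi> i t) = std_gauss" and \<xi>_measurable [measurable]: "\<xi> i t \<in> borel_measurable M"
proof -
  have "std_gaussian M (\<xi> i t)" using noise by (simp add: gaussian_noise_def)
  then show "distr M borel (\<xi> i t) = std_gauss" "\<xi> i t \<in> borel_measurable M"
    by (rule std_gaussian_distr)+
qed

lemma filtration_measurable:
  assumes "h \<in> borel_measurable (filtration t)"
  shows "h \<in> borel_measurable M"
proof -
  have "history t \<in> measurable M (PiM (past t) (\<lambda>_. borel))"
    unfolding history_def by (rule measurable_restrict) simp
  then have "sets (filtration t) \<subseteq> sets M"
    unfolding filtration_def
    by (subst sets_vimage_algebra2) (auto simp: measurable_sets dest: measurable_space)
  with assms show ?thesis by (auto simp: measurable_def)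
qed

lemma x_measurable [measurable]: "x i t \<in> borel_measurable M"
  by (rule filtration_measurable[OF x_adapted[OF order_refl]])

text \<open>
  The index sets \<open>past t\<close> and \<open>{(i, t)}\<close> are disjoint.
\<close>

lemma noise_independent_of_past:
  assumes Y: "Y \<in> borel_measurable (filtration t)"
  shows "indep_var borel Y borel (\<xi> i t)"
proof -
  let ?N = "\<lambda>A. PiM A (\<lambda>_. borel :: (real ^ 'n) measure)"
  let ?\<xi> = "\<lambda>k. \<xi> (fst k) (snd k)"
  have "indep_vars (\<lambda>_. borel) ?\<xi> UNIV"
    using noise by (simp add: gaussian_noise_def case_prod_beta')
  then have ind: "indep_var (?N (past t)) (history t) (?N {(i, t)}) (\<lambda>\<omega>. \<lambda>k\<in>{(i, t)}. ?\<xi> k \<omega>)"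
    unfolding history_def by (rule indep_var_restrict) (auto simp: past_def)
  let ?R = "\<lambda>\<omega>. \<lambda>k\<in>{(i, t)}. ?\<xi> k \<omega>"
  have "?R \<in> measurable (vimage_algebra (space M) ?R (?N {(i, t)})) (?N {(i, t)})"
    by (rule measurable_vimage_algebra1) (auto simp: space_PiM)
  from measurable_compose[OF this measurable_component_singleton[of "(i, t)"]]
  have "\<xi> i t \<in> borel_measurable (vimage_algebra (space M) ?R (?N {(i, t)}))" by simp
  then show ?thesis using indep_var_generated[OF ind] Y by (simp add: filtration_def)
qed

lemma oracle_expectation:
  assumes u: "u \<in> X"
  shows "integrable M (\<lambda>\<omega>. f i (y i t \<omega>) - f i u - oracle_grad (f i) (\<mu> i) (y i t \<omega>) (\<xi> i t \<omega>) \<bullet> (y i t \<omega> - u))"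
    and "(\<integral>\<omega>. f i (y i t \<omega>) - f i u - oracle_grad (f i) (\<mu> i) (y i t \<omega>) (\<xi> i t \<omega>) \<bullet> (y i t \<omega> - u) \<partial>M)
      \<le> \<mu> i * K * sqrt (real CARD('n))"
proof -
  have "bounded X" using X(1) by (rule compact_imp_bounded)
  then have D: "norm (v - u) \<le> diameter X" if "v \<in> X" for v
    using diameter_bounded_bound[of X v u] that u by (simp add: dist_norm)
  show "integrable M (\<lambda>\<omega>. f i (y i t \<omega>) - f i u - oracle_grad (f i) (\<mu> i) (y i t \<omega>) (\<xi> i t \<omega>) \<bullet> (y i t \<omega> - u))"
    by (rule oracle_grad_expectation(1)[OF prob_space_axioms noise_independent_of_past[OF y_adapted] \<xi>_law conv lip \<mu>])
      (use D x_step_eq(2) in auto)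
  show "(\<integral>\<omega>. f i (y i t \<omega>) - f i u - oracle_grad (f i) (\<mu> i) (y i t \<omega>) (\<xi> i t \<omega>) \<bullet> (y i t \<omega> - u) \<partial>M)
      \<le> \<mu> i * K * sqrt (real CARD('n))"
    by (rule oracle_grad_expectation(2)[OF prob_space_axioms noise_independent_of_past[OF y_adapted] \<xi>_law conv lip \<mu>])
      (use D x_step_eq(2) in auto)
qed

lemma \<xi>_moments:
  "has_bochner_integral M (\<lambda>\<omega>. (norm (\<xi> i t \<omega>))\<^sup>2) (real CARD('n))"
  "has_bochner_integral M (\<lambda>\<omega>. norm (\<xi> i t \<omega>) ^ 4) (real CARD('n) * (real CARD('n) + 2))"
  using std_gauss_norm_power2[where 'n='n] std_gauss_norm_power4[where 'n='n]
    integrable_distr_eq[of "\<xi> i t" M borel "\<lambda>z. (norm z)\<^sup>2"] integral_distr[of "\<xi> i t" M borel "\<lambda>z. (norm z)\<^sup>2"]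
    integrable_distr_eq[of "\<xi> i t" M borel "\<lambda>z. norm z ^ 4"] integral_distr[of "\<xi> i t" M borel "\<lambda>z. norm z ^ 4"]
  by (simp_all add: \<xi>_law has_bochner_integral_iff)

lemma objective_avg_integrable:
  assumes T: "1 \<le> T"
  shows "integrable M (\<lambda>\<omega>. objective f (weighted_avg \<alpha> (\<lambda>t. x l t \<omega>) T))"
proof -
  have [measurable]: "(\<lambda>\<omega>. weighted_avg \<alpha> (\<lambda>t. x l t \<omega>) T) \<in> borel_measurable M"
    unfolding weighted_avg_def by measurable
  have cont: "continuous_on UNIV (objective f)"
    unfolding objective_def by (intro continuous_intros lipschitz_on_continuous_on[OF lip]) auto
  then have [measurable]: "objective f \<in> borel_measurable borel" by (rule borel_measurable_continuous_onI)
  obtain C where C: "\<And>v. v \<in> X \<Longrightarrow> \<bar>objective f v\<bar> \<le> C"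
  proof -
    have "bounded (objective f ` X)"
      using X(1) continuous_on_subset[OF cont] by (intro compact_imp_bounded compact_continuous_image) auto
    then show ?thesis using that unfolding bounded_iff by auto
  qed
  have avg: "weighted_avg \<alpha> (\<lambda>t. x l t \<omega>) T \<in> X" if \<omega>: "\<omega> \<in> space M" for \<omega>
  proof -
    show ?thesis
      unfolding weighted_avg_convex_combination(2)[of \<alpha>, OF \<alpha> T]
      using weighted_avg_convex_combination(1,3)[of \<alpha>, OF \<alpha> T] \<alpha> x_step_eq(3)[OF \<omega>] X(2)
      by (intro convex_sum) (auto intro: less_imp_le)
  qed
  show ?thesis
    by (rule integrable_const_bound[where B = C]) (use C avg in auto)
qed

end

section \<open>Expected error and convergence rate\<close>

lemma powr_increment_le:
  fixes a c :: real
  assumes "1 \<le> a" "1 \<le> c"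
  shows "(a + 1) powr c - a powr c \<le> c * (a + 1) powr (c - 1)"
proof -
  have "((\<lambda>s. s powr c) has_real_derivative c * s powr (c - 1)) (at s)" if "a \<le> s" "s \<le> a + 1" for s
    using that assms by (auto intro!: derivative_eq_intros)
  from MVT2[of a "a + 1" "\<lambda>s. s powr c" "\<lambda>s. c * s powr (c - 1)", OF _ this]
  obtain s where s: "a < s" "s < a + 1" "(a + 1) powr c - a powr c = c * s powr (c - 1)" by auto
  have "s powr (c - 1) \<le> (a + 1) powr (c - 1)" using s assms by (intro powr_mono2) auto
  then show ?thesis using s assms by (simp add: mult_left_mono)
qed

lemma powr_increment_ge:
  fixes a c :: real
  assumes "1 \<le> a" "0 < c" "c \<le> 1"
  shows "c * (a + 1) powr (c - 1) \<le> (a + 1) powr c - a powr c"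
proof -
  have "((\<lambda>s. s powr c) has_real_derivative c * s powr (c - 1)) (at s)" if "a \<le> s" "s \<le> a + 1" for s
    using that assms by (auto intro!: derivative_eq_intros)
  from MVT2[of a "a + 1" "\<lambda>s. s powr c" "\<lambda>s. c * s powr (c - 1)", OF _ this]
  obtain s where s: "a < s" "s < a + 1" "(a + 1) powr c - a powr c = c * s powr (c - 1)" by auto
  have "(a + 1) powr (c - 1) \<le> s powr (c - 1)" using s assms by (intro powr_mono2') auto
  then show ?thesis using s assms by (simp add: mult_left_mono)
qed

lemma stepsize_pos: "0 < \<rho> \<Longrightarrow> 0 < stepsize \<rho> \<delta> t"
  by (auto simp: stepsize_def)

lemma stepsize_antimono:
  assumes "0 < \<rho>" "0 < \<delta>" "1 \<le> t"
  shows "stepsize \<rho> \<delta> (Suc t) \<le> stepsize \<rho> \<delta> t"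
proof -
  have "(real t + 1) powr \<delta> \<le> (real (Suc t) + 1) powr \<delta>" using assms by (intro powr_mono2) auto
  then show ?thesis using assms by (auto simp: stepsize_def intro!: divide_left_mono)
qed

text \<open>
  Comparison with an integral gives \<open>((T + 1)\<^bsup>1 + \<delta>\<^esup> - 1) / (1 + \<delta>)\<close>. The lost \<open>1\<close> is at most the
  fraction \<open>1 / 2\<^bsup>1 + \<delta>\<^esup>\<close> of the leading term, as \<open>T \<ge> 1\<close>; this is where the condition on \<open>p\<close>
  enters.
\<close>

lemma sum_inverse_stepsize_ge:
  assumes "0 < \<delta>" "0 < \<rho>" "0 < p" "p \<le> 1 - 1 / 2 powr (1 + \<delta>)" "1 \<le> T"
  shows "p * (real T + 1) powr (1 + \<delta>) / (\<rho> * (1 + \<delta>)) \<le> (\<Sum>t=1..T. 1 / stepsize \<rho> \<delta> t)"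
proof -
  let ?S = "(real T + 1) powr (1 + \<delta>)"
  have "(real T + 1) powr (1 + \<delta>) - 1 \<le> (1 + \<delta>) * (\<Sum>t=1..T. (real t + 1) powr \<delta>)"
    using \<open>1 \<le> T\<close>
  proof (induction T rule: dec_induct)
    case base
    then show ?case using powr_increment_le[of 1 "1 + \<delta>"] assms by simp
  next
    case (step T)
    then show ?case using powr_increment_le[of "real T + 1" "1 + \<delta>"] assms
      by (simp add: algebra_simps)
  qed
  then have lower: "?S - 1 \<le> (1 + \<delta>) * (\<Sum>t=1..T. (real t + 1) powr \<delta>)" .
  have "2 powr (1 + \<delta>) \<le> ?S" using assms by (intro powr_mono2) auto
  then have "1 \<le> ?S / 2 powr (1 + \<delta>)" by (simp add: le_divide_eq)
  moreover have "p * ?S \<le> (1 - 1 / 2 powr (1 + \<delta>)) * ?S" using assms by (intro mult_right_mono) auto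
  moreover have "(1 - 1 / 2 powr (1 + \<delta>)) * ?S = ?S - ?S / 2 powr (1 + \<delta>)" by (simp add: left_diff_distrib)
  ultimately have "p * ?S \<le> ?S - 1" by linarith
  with lower have "p * ?S \<le> (1 + \<delta>) * (\<Sum>t=1..T. (real t + 1) powr \<delta>)" by linarith
  then have "p * ?S / (\<rho> * (1 + \<delta>)) \<le> (1 + \<delta>) * (\<Sum>t=1..T. (real t + 1) powr \<delta>) / (\<rho> * (1 + \<delta>))"
    using assms by (intro divide_right_mono) auto
  also have "\<dots> = (\<Sum>t=1..T. (real t + 1) powr \<delta>) / \<rho>" using assms by simp
  also have "\<dots> = (\<Sum>t=1..T. 1 / stepsize \<rho> \<delta> t)"
    unfolding sum_divide_distrib by (intro sum.cong) (auto simp: stepsize_def)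
  finally show ?thesis .
qed

text \<open>
  The integral comparison covers the terms from \<open>s = 1\<close> on; the first step \<open>1\<close> is bounded by
  \<open>(T + 1)\<^bsup>1 - \<delta>\<^esup>\<close>.
\<close>

lemma sum_stepsize_le:
  assumes "0 < \<delta>" "\<delta> < 1" "0 < \<rho>" "1 \<le> T"
  shows "(\<Sum>s<T. stepsize \<rho> \<delta> s) \<le> (\<rho> + 1 - \<delta>) / (1 - \<delta>) * (real T + 1) powr (1 - \<delta>)"
proof -
  have "(\<Sum>s<T. stepsize \<rho> \<delta> s) \<le> 1 + \<rho> / (1 - \<delta>) * (real T) powr (1 - \<delta>)"
    using \<open>1 \<le> T\<close>
  proof (induction T rule: dec_induct)
    case base
    then show ?case using assms by (simp add: stepsize_def)
  next
    case (step T)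
    have "(1 - \<delta>) * (real T + 1) powr (- \<delta>) \<le> (real T + 1) powr (1 - \<delta>) - real T powr (1 - \<delta>)"
      using powr_increment_ge[of "real T" "1 - \<delta>"] step assms by simp
    then have "\<rho> / (1 - \<delta>) * ((1 - \<delta>) * (real T + 1) powr (- \<delta>))
        \<le> \<rho> / (1 - \<delta>) * ((real T + 1) powr (1 - \<delta>) - real T powr (1 - \<delta>))"
      using assms by (intro mult_left_mono) auto
    moreover have "stepsize \<rho> \<delta> T = \<rho> / (1 - \<delta>) * ((1 - \<delta>) * (real T + 1) powr (- \<delta>))"
      using step assms by (simp add: stepsize_def powr_minus divide_inverse)
    ultimately show ?case using step by (simp add: algebra_simps)
  qed
  also have "\<dots> \<le> (real T + 1) powr (1 - \<delta>) + \<rho> / (1 - \<delta>) * (real T + 1) powr (1 - \<delta>)"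
    using assms by (intro add_mono mult_left_mono powr_mono2 ge_one_powr_ge_zero) auto
  also have "\<dots> = (\<rho> + 1 - \<delta>) / (1 - \<delta>) * (real T + 1) powr (1 - \<delta>)"
    using assms by (simp add: field_simps)
  finally show ?thesis .
qed

context drgfmd_random
begin

lemma expected_bound:
  assumes u: "u \<in> X" and T: "1 \<le> T"
  shows "(\<Sum>t=1..T. 1 / \<alpha> t) * ((\<integral>\<omega>. objective f (weighted_avg \<alpha> (\<lambda>t. x l t \<omega>) T) \<partial>M) - objective f u)
    \<le> (\<Sum>t=1..T. 1 / \<alpha> t) * (sqrt (real CARD('n)) * K * ((\<Sum>i\<in>UNIV. \<mu> i) / real CARD('v)))
      + d\<^sup>2 / (\<alpha> T)\<^sup>2
      + real T * (K\<^sup>2 * (real CARD('n) * (real CARD('n) + 2)) / (2 * \<sigma>))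
      + 2 * K / \<alpha> T * (Gamma_const CARD('v) \<zeta> / (1 - gamma_const CARD('v) \<zeta> B)
          * (real CARD('v) * (K * real CARD('n) / \<sigma>) * (\<Sum>s<T. \<alpha> s)))"
proof -
  let ?N = "real CARD('v)" and ?n = "real CARD('n)"
  let ?A = "\<Sum>t=1..T. 1 / \<alpha> t"
  let ?c = "2 * K / \<alpha> T * (Gamma_const CARD('v) \<zeta> / (1 - gamma_const CARD('v) \<zeta> B))"
  define h where "h i t \<omega> = f i (y i t \<omega>) - f i u - oracle_grad (f i) (\<mu> i) (y i t \<omega>) (\<xi> i t \<omega>) \<bullet> (y i t \<omega> - u)"
    for i t \<omega>
  let ?R = "\<lambda>\<omega>. (\<Sum>t=1..T. \<Sum>i\<in>UNIV. (1 / \<alpha> t) * h i t \<omega>) / ?N + d\<^sup>2 / (\<alpha> T)\<^sup>2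
      + (\<Sum>t=1..T. \<Sum>i\<in>UNIV. K\<^sup>2 * norm (\<xi> i t \<omega>) ^ 4 / (2 * \<sigma>)) / ?N
      + ?c * (\<Sum>s<T. \<Sum>i\<in>UNIV. \<alpha> s * (K * (norm (\<xi> i s \<omega>))\<^sup>2 / \<sigma>))"
  note int = objective_avg_integrable[OF T, of l]
  have int_h: "integrable M (h i t)" for i t unfolding h_def by (rule oracle_expectation(1)[OF u])
  have exp_h: "(\<integral>\<omega>. h i t \<omega> \<partial>M) \<le> \<mu> i * K * sqrt ?n" for i t
    unfolding h_def by (rule oracle_expectation(2)[OF u])
  have m2: "integrable M (\<lambda>\<omega>. (norm (\<xi> i t \<omega>))\<^sup>2)" "(\<integral>\<omega>. (norm (\<xi> i t \<omega>))\<^sup>2 \<partial>M) = ?n"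
    and m4: "integrable M (\<lambda>\<omega>. norm (\<xi> i t \<omega>) ^ 4)" "(\<integral>\<omega>. norm (\<xi> i t \<omega>) ^ 4 \<partial>M) = ?n * (?n + 2)" for i t
    using \<xi>_moments[of i t] by (auto simp: has_bochner_integral_iff)
  have I1: "integrable M (\<lambda>\<omega>. (\<Sum>t=1..T. \<Sum>i\<in>UNIV. (1 / \<alpha> t) * h i t \<omega>) / ?N)"
    by (intro integrable_divide Bochner_Integration.integrable_sum integrable_mult_right int_h)
  have I3: "integrable M (\<lambda>\<omega>. (\<Sum>t=1..T. \<Sum>i\<in>UNIV. K\<^sup>2 * norm (\<xi> i t \<omega>) ^ 4 / (2 * \<sigma>)) / ?N)"
    by (intro integrable_divide Bochner_Integration.integrable_sum integrable_mult_right m4)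
  have I4: "integrable M (\<lambda>\<omega>. ?c * (\<Sum>s<T. \<Sum>i\<in>UNIV. \<alpha> s * (K * (norm (\<xi> i s \<omega>))\<^sup>2 / \<sigma>)))"
    by (intro integrable_divide Bochner_Integration.integrable_sum integrable_mult_right m2)
  have "?A * ((\<integral>\<omega>. objective f (weighted_avg \<alpha> (\<lambda>t. x l t \<omega>) T) \<partial>M) - objective f u)
      = (\<integral>\<omega>. ?A * (objective f (weighted_avg \<alpha> (\<lambda>t. x l t \<omega>) T) - objective f u) \<partial>M)"
    using int by (simp add: prob_space)
  also have "\<dots> \<le> (\<integral>\<omega>. ?R \<omega> \<partial>M)"
  proof (rule integral_mono)
    show "integrable M (\<lambda>\<omega>. ?A * (objective f (weighted_avg \<alpha> (\<lambda>t. x l t \<omega>) T) - objective f u))"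
      using int by simp
    show "integrable M ?R"
      by (intro Bochner_Integration.integrable_add I1 I3 I4) simp
    fix \<omega> assume \<omega>: "\<omega> \<in> space M"
    interpret p: drgfmd_path E P B \<zeta> X U f K \<phi> \<sigma> d \<mu> \<alpha> "\<lambda>i t. \<xi> i t \<omega>" "\<lambda>i t. x i t \<omega>" by (rule path[OF \<omega>])
    have y: "p.y i t = y i t \<omega>" for i t by (simp add: p.y_def y_def)
    show "?A * (objective f (weighted_avg \<alpha> (\<lambda>t. x l t \<omega>) T) - objective f u) \<le> ?R \<omega>"
      using p.pathwise_bound[OF u T, of l] unfolding p.g_def y h_def by (simp only: mult.assoc)
  qed
  also have "\<dots> = (\<integral>\<omega>. (\<Sum>t=1..T. \<Sum>i\<in>UNIV. (1 / \<alpha> t) * h i t \<omega>) / ?N \<partial>M) + d\<^sup>2 / (\<alpha> T)\<^sup>2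
      + (\<integral>\<omega>. (\<Sum>t=1..T. \<Sum>i\<in>UNIV. K\<^sup>2 * norm (\<xi> i t \<omega>) ^ 4 / (2 * \<sigma>)) / ?N \<partial>M)
      + (\<integral>\<omega>. ?c * (\<Sum>s<T. \<Sum>i\<in>UNIV. \<alpha> s * (K * (norm (\<xi> i s \<omega>))\<^sup>2 / \<sigma>)) \<partial>M)"
    using I1 I3 I4 by (simp only: Bochner_Integration.integral_add Bochner_Integration.integrable_add
        integrable_const lebesgue_integral_const prob_space scaleR_one)
  also have "(\<integral>\<omega>. (\<Sum>t=1..T. \<Sum>i\<in>UNIV. K\<^sup>2 * norm (\<xi> i t \<omega>) ^ 4 / (2 * \<sigma>)) / ?N \<partial>M)
      = real T * (K\<^sup>2 * (?n * (?n + 2)) / (2 * \<sigma>))"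
    using m4 by (simp add: Bochner_Integration.integral_sum)
  also have "(\<integral>\<omega>. ?c * (\<Sum>s<T. \<Sum>i\<in>UNIV. \<alpha> s * (K * (norm (\<xi> i s \<omega>))\<^sup>2 / \<sigma>)) \<partial>M)
      = ?c * (\<Sum>s<T. \<Sum>i\<in>(UNIV :: 'v set). \<alpha> s * (K * ?n / \<sigma>))"
    using m2 by (simp add: Bochner_Integration.integral_sum)
  also have "(\<Sum>s<T. \<Sum>i\<in>(UNIV :: 'v set). \<alpha> s * (K * ?n / \<sigma>)) = ?N * (K * ?n / \<sigma>) * (\<Sum>s<T. \<alpha> s)"
    by (simp add: sum_distrib_left sum_divide_distrib mult_ac)
  also have "(\<integral>\<omega>. (\<Sum>t=1..T. \<Sum>i\<in>UNIV. (1 / \<alpha> t) * h i t \<omega>) / ?N \<partial>M)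
      = (\<Sum>t=1..T. \<Sum>i\<in>UNIV. (1 / \<alpha> t) * (\<integral>\<omega>. h i t \<omega> \<partial>M)) / ?N"
    using int_h by (simp add: Bochner_Integration.integral_sum)
  also have "\<dots> \<le> (\<Sum>t=1..T. \<Sum>i\<in>UNIV. (1 / \<alpha> t) * (\<mu> i * K * sqrt ?n)) / ?N"
    using \<alpha> by (intro divide_right_mono sum_mono mult_left_mono exp_h) (auto simp: less_imp_le)
  also have "(\<Sum>t=1..T. \<Sum>i\<in>UNIV. (1 / \<alpha> t) * (\<mu> i * K * sqrt ?n)) / ?N = ?A * (sqrt ?n * K * ((\<Sum>i\<in>UNIV. \<mu> i) / ?N))"
    by (simp add: sum_distrib_left sum_distrib_right sum_divide_distrib mult_ac) (rule sum.swap)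
  finally show ?thesis by (simp only: mult.assoc)
qed

end

text \<open>
  Here \<open>S = T + 1\<close> and \<open>e\<close> is the expected error. Dividing the bound by
  \<open>A \<ge> p S\<^bsup>1 + \<delta>\<^esup> / (\<rho> (1 + \<delta>))\<close>, the divergence term, of order \<open>S\<^bsup>2\<delta>\<^esup>\<close>, yields the rate
  \<open>S\<^bsup>\<delta> - 1\<^esup>\<close>, and the other two, of order \<open>S\<close>, yield \<open>S\<^bsup>- \<delta>\<^esup>\<close>.
\<close>

lemma rate_arithmetic:
  fixes S :: real
  assumes A: "p * S powr (1 + \<delta>) / (\<rho> * (1 + \<delta>)) \<le> A"
    and S: "1 \<le> S" "T \<le> S" and pos: "0 < p" "0 < \<rho>" "0 < \<delta>" "\<delta> < 1"
    and nonneg: "0 \<le> D" "0 \<le> c1" "0 \<le> c2" and T: "0 \<le> T"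
    and \<Sigma>: "\<Sigma> \<le> (\<rho> + 1 - \<delta>) / (1 - \<delta>) * S powr (1 - \<delta>)"
    and bound: "A * e \<le> A * m + D / (\<rho> / S powr \<delta>)\<^sup>2 + T * c1 + c2 / (\<rho> / S powr \<delta>) * \<Sigma>"
  shows "e \<le> m + (\<delta> + 1) * D / (p * \<rho>) / S powr (1 - \<delta>)
    + (c1 + c2 * (\<rho> + 1 - \<delta>) / (\<rho> * (1 - \<delta>))) * (\<rho> * (\<delta> + 1) / p) / S powr \<delta>"
proof -
  define s where "s = S powr \<delta>"
  have s: "0 < s" using S by (simp add: s_def)
  have S1: "S powr (1 + \<delta>) = S * s" using S by (simp add: s_def powr_add)
  have S2: "S powr (1 - \<delta>) = S / s" using S by (simp add: s_def powr_diff)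
  have A0: "0 < p * S powr (1 + \<delta>) / (\<rho> * (1 + \<delta>))" using pos S by simp
  with A have Apos: "0 < A" by linarith
  let ?q = "(\<rho> * (1 + \<delta>)) / (p * (S * s))"
  have "1 / A \<le> 1 / (p * S powr (1 + \<delta>) / (\<rho> * (1 + \<delta>)))"
    by (intro divide_left_mono mult_pos_pos A A0 Apos) simp
  then have q: "1 / A \<le> ?q" by (simp add: S1)
  let ?W = "D * s\<^sup>2 / \<rho>\<^sup>2 + S * c1 + c2 * (s / \<rho>) * ((\<rho> + 1 - \<delta>) / (1 - \<delta>) * (S / s))"
  have W0: "0 \<le> ?W" using nonneg pos s S by (intro add_nonneg_nonneg mult_nonneg_nonneg divide_nonneg_nonneg) auto
  have "A * (e - m) \<le> D / (\<rho> / s)\<^sup>2 + T * c1 + c2 / (\<rho> / s) * \<Sigma>"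
    using bound by (simp add: s_def right_diff_distrib)
  also have "\<dots> \<le> ?W"
  proof (intro add_mono)
    show "D / (\<rho> / s)\<^sup>2 \<le> D * s\<^sup>2 / \<rho>\<^sup>2" by (simp add: power_divide)
    show "T * c1 \<le> S * c1" using S nonneg by (intro mult_right_mono) auto
    have "c2 / (\<rho> / s) * \<Sigma> = c2 * (s / \<rho>) * \<Sigma>" by simp
    also have "\<dots> \<le> c2 * (s / \<rho>) * ((\<rho> + 1 - \<delta>) / (1 - \<delta>) * (S / s))"
      using \<Sigma> nonneg pos s by (intro mult_left_mono) (auto simp: S2)
    finally show "c2 / (\<rho> / s) * \<Sigma> \<le> c2 * (s / \<rho>) * ((\<rho> + 1 - \<delta>) / (1 - \<delta>) * (S / s))" .
  qed
  finally have "e - m \<le> ?W * (1 / A)" using Apos by (simp add: le_divide_eq mult.commute)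
  also have "\<dots> \<le> ?W * ?q" using q W0 by (rule mult_left_mono)
  also have "\<dots> = (\<delta> + 1) * D / (p * \<rho>) / (S / s)
    + (c1 + c2 * (\<rho> + 1 - \<delta>) / (\<rho> * (1 - \<delta>))) * (\<rho> * (\<delta> + 1) / p) / s"
    using pos s S by (simp add: field_simps power2_eq_square)
  finally show ?thesis by (simp add: s_def[symmetric] S2)
qed

theorem theorem6:
  fixes E :: "nat \<Rightarrow> ('v::finite \<times> 'v) set" and P :: "nat \<Rightarrow> real ^ 'v ^ 'v"
    and B :: nat and \<zeta> :: real
    and X U :: "(real ^ 'n) set" and f :: "'v \<Rightarrow> real ^ 'n \<Rightarrow> real" and L :: "'v \<Rightarrow> real"
    and \<phi> :: "real ^ 'n \<Rightarrow> real" and \<sigma> d :: real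
    and M :: "'w measure" and \<xi> x :: "'v \<Rightarrow> nat \<Rightarrow> 'w \<Rightarrow> real ^ 'n" and \<mu> :: "'v \<Rightarrow> real"
    and \<delta> \<rho> p :: real and l :: 'v and xstar :: "real ^ 'n" and T :: nat
  assumes "network_assumption E P B \<zeta>"
    and "problem_assumption X f L"
    and "bregman_assumption U X \<phi> \<sigma>"
    and "\<forall>u\<in>X. \<forall>v\<in>X. bregman \<phi> u v \<le> d\<^sup>2"
    and "gaussian_noise M \<xi>"
    and "\<forall>i. 0 < \<mu> i"
    and "0 < \<delta>" "\<delta> < 1" "0 < \<rho>" "0 < p" "p \<le> 1 - 1 / 2 powr (1 + \<delta>)"
    and "0 \<in> X"
    and "\<forall>\<omega>\<in>space M.
           drgfmd_run X \<phi> f P \<mu> (stepsize \<rho> \<delta>) (\<lambda>i t. \<xi> i t \<omega>) (\<lambda>i t. x i t \<omega>)"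
    and "is_arg_min (objective f) (\<lambda>u. u \<in> X) xstar"
    and "1 \<le> T"
  shows
    "(let N = CARD('v); n = CARD('n); Lhat = Max (range L);
          \<Gamma> = Gamma_const N \<zeta>; \<gamma> = gamma_const N \<zeta> B
      in (\<integral>\<omega>. objective f (weighted_avg (stepsize \<rho> \<delta>) (\<lambda>t. x l t \<omega>) T) \<partial>M) - objective f xstar
           \<le> sqrt (real n) * Lhat * ((\<Sum>i\<in>UNIV. \<mu> i) / real N)
             + C_delta1 \<delta> d p \<rho> / (real T + 1) powr (1 - \<delta>)
             + C_delta2 \<delta> p \<rho> n Lhat \<sigma> (C_tilde N n Lhat \<sigma> \<Gamma> \<gamma>) / (real T + 1) powr \<delta>)"
proof -
  note net = assms(1) and prb = assms(2) and br = assms(3) and diam = assms(4) and noise = assms(5)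
    and \<mu> = assms(6) and par = assms(7-11) and run = assms(13) and T = assms(15)
  define Lhat where "Lhat = Max (range L)"
  define N where "N = real CARD('v)"
  define n where "n = real CARD('n)"
  define \<Gamma> where "\<Gamma> = Gamma_const CARD('v) \<zeta>"
  define \<gamma> where "\<gamma> = gamma_const CARD('v) \<zeta> B"
  have lip: "Lhat-lipschitz_on UNIV (f i)" for i
  proof (rule lipschitz_on_le)
    show "(L i)-lipschitz_on UNIV (f i)" using prb by (simp add: problem_assumption_def)
    show "L i \<le> Lhat" by (simp add: Lhat_def)
  qed
  have Lhat: "0 \<le> Lhat" by (rule lipschitz_on_nonneg[OF lip])
  have \<sigma>: "0 < \<sigma>" using br by (simp add: bregman_assumption_def)
  interpret R: drgfmd_random E P B \<zeta> X U f Lhat \<phi> \<sigma> d \<mu> "stepsize \<rho> \<delta>" M \<xi> x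
  proof (rule drgfmd_random.intro)
    show "gaussian_noise M \<xi>" by (rule noise)
    fix \<omega> assume "\<omega> \<in> space M"
    then show "drgfmd_path E P B \<zeta> X U f Lhat \<phi> \<sigma> d \<mu> (stepsize \<rho> \<delta>) (\<lambda>i t. \<xi> i t \<omega>) (\<lambda>i t. x i t \<omega>)"
      using net prb br diam \<mu> par run \<open>0 \<in> X\<close> lip
      by unfold_locales (auto simp: problem_assumption_def stepsize_pos stepsize_antimono)
  qed
  have xstar: "xstar \<in> X" using assms(14) by (simp add: is_arg_min_def)
  have \<Gamma>: "0 \<le> \<Gamma>" by (simp add: \<Gamma>_def Gamma_const_def power_int_minus)
  have \<gamma>: "\<gamma> < 1" using sum_block_geometric_le(3)[OF net] by (simp add: \<gamma>_def)
  have nN: "0 \<le> n" "0 \<le> N" by (simp_all add: n_def N_def)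
  have stepT: "stepsize \<rho> \<delta> T = \<rho> / (real T + 1) powr \<delta>" using T by (simp add: stepsize_def)
  define c1 where "c1 = (n + 4)\<^sup>2 * Lhat\<^sup>2 / (2 * \<sigma>)"
  define c2 where "c2 = C_tilde CARD('v) CARD('n) Lhat \<sigma> \<Gamma> \<gamma>"
  have c1: "Lhat\<^sup>2 * (n * (n + 2)) / (2 * \<sigma>) \<le> c1" "0 \<le> c1"
  proof -
    have "n * (n + 2) \<le> (n + 4)\<^sup>2" using nN by (simp add: power2_eq_square algebra_simps)
    then have "Lhat\<^sup>2 * (n * (n + 2)) / (2 * \<sigma>) \<le> Lhat\<^sup>2 * (n + 4)\<^sup>2 / (2 * \<sigma>)"
      using \<sigma> by (intro divide_right_mono mult_left_mono) auto
    then show "Lhat\<^sup>2 * (n * (n + 2)) / (2 * \<sigma>) \<le> c1" by (simp add: c1_def mult.commute)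
    show "0 \<le> c1" using \<sigma> by (simp add: c1_def)
  qed
  \<comment> \<open>The constant of the disagreement term, which the first summand of \<open>C_tilde\<close> dominates.\<close>
  define c3 where "c3 = 2 * Lhat * (\<Gamma> / (1 - \<gamma>)) * (N * (Lhat * n / \<sigma>))"
  have c3: "0 \<le> c3" "c3 \<le> c2"
  proof -
    show "0 \<le> c3" using Lhat \<Gamma> \<gamma> \<sigma> nN by (simp add: c3_def)
    have "n \<le> (n + 4)\<^sup>2" using nN by (simp add: power2_eq_square algebra_simps)
    have "c3 = 2 * N * n * \<Gamma> * Lhat\<^sup>2 / (\<sigma> * (1 - \<gamma>))"
      by (simp add: c3_def power2_eq_square mult_ac)
    also have "\<dots> \<le> 2 * N * (n + 4)\<^sup>2 * \<Gamma> * Lhat\<^sup>2 / (\<sigma> * (1 - \<gamma>))"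
      using \<open>n \<le> (n + 4)\<^sup>2\<close> \<Gamma> \<gamma> \<sigma> nN by (intro divide_right_mono mult_right_mono mult_left_mono) auto
    also have "\<dots> \<le> c2" using \<sigma> by (simp add: c2_def C_tilde_def N_def n_def)
    finally show "c3 \<le> c2" .
  qed
  have \<Sigma>0: "0 \<le> (\<Sum>s<T. stepsize \<rho> \<delta> s)" using par by (intro sum_nonneg) (simp add: stepsize_pos less_imp_le)
  let ?e = "(\<integral>\<omega>. objective f (weighted_avg (stepsize \<rho> \<delta>) (\<lambda>t. x l t \<omega>) T) \<partial>M) - objective f xstar"
  let ?m = "sqrt n * Lhat * ((\<Sum>i\<in>UNIV. \<mu> i) / N)"
  let ?A = "\<Sum>t=1..T. 1 / stepsize \<rho> \<delta> t"
  have "?A * ?e \<le> ?A * ?m + d\<^sup>2 / (\<rho> / (real T + 1) powr \<delta>)\<^sup>2 + real T * (Lhat\<^sup>2 * (n * (n + 2)) / (2 * \<sigma>))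
      + c3 / (\<rho> / (real T + 1) powr \<delta>) * (\<Sum>s<T. stepsize \<rho> \<delta> s)"
    using R.expected_bound[OF xstar T, of l] unfolding stepT
    by (simp add: c3_def N_def n_def \<Gamma>_def \<gamma>_def mult_ac)
  also have "\<dots> \<le> ?A * ?m + d\<^sup>2 / (\<rho> / (real T + 1) powr \<delta>)\<^sup>2 + real T * c1
      + c2 / (\<rho> / (real T + 1) powr \<delta>) * (\<Sum>s<T. stepsize \<rho> \<delta> s)"
    using c1 c3 par \<Sigma>0 by (intro add_mono order_refl mult_left_mono mult_right_mono divide_right_mono) auto
  finally have "?e \<le> ?m + (\<delta> + 1) * d\<^sup>2 / (p * \<rho>) / (real T + 1) powr (1 - \<delta>)
    + (c1 + c2 * (\<rho> + 1 - \<delta>) / (\<rho> * (1 - \<delta>))) * (\<rho> * (\<delta> + 1) / p) / (real T + 1) powr \<delta>"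
    using c1 c3 par T
    by (intro rate_arithmetic[OF sum_inverse_stepsize_ge _ _ _ _ _ _ _ _ _ _ sum_stepsize_le]) auto
  then show ?thesis
    unfolding Let_def C_delta1_def C_delta2_def
    by (simp add: c1_def c2_def Lhat_def N_def n_def \<Gamma>_def \<gamma>_def)
qed

end
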